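(* Let $d_1,d_2\ge1$, $d=d_1+d_2$, and let $B=(B_x)_{x\in\mathbb{R}^d}$ be a real-valued, continuous, centered, stationary Gaussian field with unit variance, whose covariance function $C:\mathbb{R}^d\to\mathbb{R}$ is a Gneiting covariance function, i.e. $$C(x_1,x_2)=\psi(\|x_2\|^2)^{-d_1/2}\,\phi\!\left(\frac{\|x_1\|^2}{\psi(\|x_2\|^2)}\right),\qquad x_1\in\mathbb{R}^{d_1},\ x_2\in\mathbb{R}^{d_2},$$ where $\phi:[0,\infty)\to(0,\infty)$ is completely monotone, $\psi:[0,\infty)\to(0,\infty)$ has completely monotone derivative, and $\phi(0)=\psi(0)=1$. Let $q\ge1$ be an integer and fix $j\in\{1,2\}$. If $$\widetilde Y_j(t_j)[q]\overset{d}{\to}N(0,1)\qquad\text{as }t_j\to\infty,$$ then, with $t_k>0$ fixed for $k\in\{1,2\}$, $k\ne j$, $$\widetilde Y(t_1,t_2)[q]\overset{d}{\to}N(0,1)\qquad\text{as }t_j\to\infty.$$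
   Context: The covariance function of $B$ is $C$, defined by $\mathrm{Cov}(B_x,B_y)=C(x-y)$. A function $\phi:[0,\infty)\to(0,\infty)$ is completely monotone if $(-1)^n\phi^{(n)}(t)\ge0$ for all $n\in\mathbb{N}$ and $t\ge0$. The normalization $\phi(0)=\psi(0)=1$ is without loss of generality, since $C(0,0)=1$. $D_1\subseteq\mathbb{R}^{d_1}$ and $D_2\subseteq\mathbb{R}^{d_2}$ are compact sets with $\mathrm{Vol}(D_i)>0$. $H_q$ is the $q$th (probabilists') Hermite polynomial. The marginal fields are $B^{(1)}_{x_1}=B_{(x_1,0)}$, $x_1\in\mathbb{R}^{d_1}$, and $B^{(2)}_{x_2}=B_{(0,x_2)}$, $x_2\in\mathbb{R}^{d_2}$; they are stationary Gaussian with covariance functions $C_1(x_1)=C(x_1,0)=\phi(\|x_1\|^2)$ and $C_2(x_2)=C(0,x_2)=\psi(\|x_2\|^2)^{-d_1/2}$ respectively. Functionals: $$Y(t_1,t_2)[q]=\int_{t_1D_1\times t_2D_2}H_q(B_x)\,dx,\qquad Y_i(t_i)[q]=\int_{t_iD_i}H_q(B^{(i)}_{x_i})\,dx_i\quad(i=1,2),$$ and a tilde denotes standardization: $\widetilde Z=(Z-\mathbb{E}[Z])/\sqrt{\mathrm{Var}(Z)}$. *)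

theory Defs
  imports "HOL-Probability.Probability"
begin

(* Differentiability at 0 is one-sided, since the functions live on [0, \<infinity>); D n is the
   n-th derivative on that half-line. The sign condition alone is recorded here; strict positivity
   of the values is required separately where it is wanted. *)
definition completely_monotone :: "(real \<Rightarrow> real) \<Rightarrow> bool" where
  "completely_monotone f \<longleftrightarrow>
     (\<exists>D :: nat \<Rightarrow> real \<Rightarrow> real.
        (\<forall>t\<ge>0. D 0 t = f t) \<and>
        (\<forall>n. \<forall>t\<ge>0. (D n has_real_derivative D (Suc n) t) (at t within {0..})) \<and>
        (\<forall>n. \<forall>t\<ge>0. (-1) ^ n * D n t \<ge> 0))"

definition has_completely_monotone_derivative :: "(real \<Rightarrow> real) \<Rightarrow> bool" where
  "has_completely_monotone_derivative f \<longleftrightarrow>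
     (\<exists>f'. (\<forall>t\<ge>0. (f has_real_derivative f' t) (at t within {0..})) \<and> completely_monotone f')"

definition gneiting_covariance ::
  "(real \<Rightarrow> real) \<Rightarrow> (real \<Rightarrow> real) \<Rightarrow> ('a::euclidean_space \<times> 'b::euclidean_space \<Rightarrow> real) \<Rightarrow> bool" where
  "gneiting_covariance \<phi> \<psi> C \<longleftrightarrow>
     (\<forall>t\<ge>0. \<phi> t > 0) \<and> (\<forall>t\<ge>0. \<psi> t > 0) \<and>
     completely_monotone \<phi> \<and> has_completely_monotone_derivative \<psi> \<and>
     \<phi> 0 = 1 \<and> \<psi> 0 = 1 \<and>
     (\<forall>x1 x2. C (x1, x2) =
        \<psi> ((norm x2)\<^sup>2) powr (- real DIM('a) / 2) * \<phi> ((norm x1)\<^sup>2 / \<psi> ((norm x2)\<^sup>2)))"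

(* s = 0 gives the point masses, which count as (degenerate) normal laws. *)
definition gaussian_rv :: "'w measure \<Rightarrow> ('w \<Rightarrow> real) \<Rightarrow> bool" where
  "gaussian_rv M X \<longleftrightarrow> X \<in> borel_measurable M \<and>
     (\<exists>m s. distr M borel X = distr std_normal_distribution borel (\<lambda>z. m + s * z))"

definition gaussian_field :: "'w measure \<Rightarrow> ('x \<Rightarrow> 'w \<Rightarrow> real) \<Rightarrow> bool" where
  "gaussian_field M B \<longleftrightarrow>
     (\<forall>F a. finite F \<longrightarrow> gaussian_rv M (\<lambda>\<omega>. \<Sum>x\<in>F. a x * B x \<omega>))"

definition stationary_field :: "'w measure \<Rightarrow> ('x::ab_group_add \<Rightarrow> 'w \<Rightarrow> real) \<Rightarrow> bool" where
  "stationary_field M B \<longleftrightarrow>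
     (\<forall>F h. finite F \<longrightarrow>
        distr M (PiM F (\<lambda>_. borel)) (\<lambda>\<omega>. \<lambda>x\<in>F. B (x + h) \<omega>) =
        distr M (PiM F (\<lambda>_. borel)) (\<lambda>\<omega>. \<lambda>x\<in>F. B x \<omega>))"

definition variance_of :: "'w measure \<Rightarrow> ('w \<Rightarrow> real) \<Rightarrow> real" where
  "variance_of M X = (\<integral>\<omega>. (X \<omega> - (\<integral>\<omega>'. X \<omega>' \<partial>M))\<^sup>2 \<partial>M)"

definition covariance_of :: "'w measure \<Rightarrow> ('w \<Rightarrow> real) \<Rightarrow> ('w \<Rightarrow> real) \<Rightarrow> real" where
  "covariance_of M X Y =
     (\<integral>\<omega>. (X \<omega> - (\<integral>\<omega>'. X \<omega>' \<partial>M)) * (Y \<omega> - (\<integral>\<omega>'. Y \<omega>' \<partial>M)) \<partial>M)"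

definition standardize :: "'w measure \<Rightarrow> ('w \<Rightarrow> real) \<Rightarrow> 'w \<Rightarrow> real" where
  "standardize M Z = (\<lambda>\<omega>. (Z \<omega> - (\<integral>\<omega>'. Z \<omega>' \<partial>M)) / sqrt (variance_of M Z))"

(* Probabilists' normalization: monic, orthogonal for the standard normal law. *)
fun hermite :: "nat \<Rightarrow> real \<Rightarrow> real" where
  "hermite 0 x = 1"
| "hermite (Suc 0) x = x"
| "hermite (Suc (Suc n)) x = x * hermite (Suc n) x - real (Suc n) * hermite n x"

definition hermite_functional ::
  "('x::euclidean_space \<Rightarrow> 'w \<Rightarrow> real) \<Rightarrow> nat \<Rightarrow> 'x set \<Rightarrow> 'w \<Rightarrow> real" where
  "hermite_functional B q S = (\<lambda>\<omega>. LINT x:S|lborel. hermite q (B x \<omega>))"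

(* Convergence of distribution functions at the continuity points of the limit: weak_conv_m with
   the sequence replaced by a real parameter tending to infinity. *)
definition converges_in_distribution ::
  "'w measure \<Rightarrow> (real \<Rightarrow> 'w \<Rightarrow> real) \<Rightarrow> real measure \<Rightarrow> bool" where
  "converges_in_distribution M Z N \<longleftrightarrow>
     (\<forall>x. isCont (cdf N) x \<longrightarrow>
        ((\<lambda>t. cdf (distr M borel (Z t)) x) \<longlongrightarrow> cdf N x) at_top)"

end

theory Submission
  imports Defs
begin

text \<open>
  By Wick's formula the \<open>m\<close>-th moment of a Hermite functional is an integral of a polynomial in the
  covariances with nonnegative coefficients. Its part coming from perfect pairings of the \<open>m\<close> points
  equals the \<open>m\<close>-th moment of the standard normal law times the \<open>m\<close>-th power of the standard deviation.
  Since Gneiting covariances are positive, the remaining part is nonnegative and monotone in the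
  covariance. Hoelder's inequality bounds all standardized moments uniformly, so that
  asymptotic normality holds if and only if all the remainders are negligible. On
  \<open>t\<^sub>1 D\<^sub>1 \<times> t\<^sub>2 D\<^sub>2\<close> with one factor fixed, the covariance is comparable with the marginal one, up to a
  constant and, when the first factor grows, a rescaling of space; hence the remainders of the
  marginal functional dominate those of the functional over the product.
\<close>

section \<open>Wick contractions\<close>

text \<open>What decides normality is a remainder divided by a power of the standard deviation, so
  it needs an upper bound on the covariance in the numerator and a lower bound in the denominator.
  When the second factor grows, both bounds involve the same function, \<open>\<phi> (R\<^sup>2) * C
  (0, x2) \<le> C (x1, x2) \<le> C (0, x2)\<close>, where \<open>R\<close> bounds the norm of
  \<open>x1\<close>. When the first factor grows they do not match: \<psi> varies over the fixed
  factor, and \<open>\<phi> (s / L)\<close> is in general not bounded by a multiple of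
  \<open>\<phi> s\<close>, as \<open>exp (- s)\<close> shows. The upper bound then involves the
  marginal field on a domain shrunk by \<open>sqrt L\<close>, the lower bound the marginal field on
  the original domain. The gap is closed by a doubling property: the energies of the two domains are
  comparable uniformly in the size. This uses that the marginal covariance is radially decreasing;
  nothing is known about its rate of decay.\<close>

definition dec :: "'i \<Rightarrow> ('i \<Rightarrow> nat) \<Rightarrow> 'i \<Rightarrow> nat" where
  "dec i a = a(i := a i - 1)"

lemma dec_same [simp]: "dec i a i = a i - 1"
  and dec_other [simp]: "j \<noteq> i \<Longrightarrow> dec i a j = a j"
  by (auto simp: dec_def)

text \<open>The sum over all complete contractions, without loops, of \<open>a i\<close> half-edges at each vertex \<open>i\<close> of a
  distinct list; the first half-edge of the first vertex is contracted first.\<close>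

function wick :: "('i \<Rightarrow> 'i \<Rightarrow> real) \<Rightarrow> ('i \<Rightarrow> nat) \<Rightarrow> 'i list \<Rightarrow> real" where
  "wick c a [] = 1"
| "wick c a (i # is) =
     (if a i = 0 then wick c a is
      else \<Sum>j\<in>set is. c i j * real (a j) * wick c (dec i (dec j a)) (i # is))"
  by pat_completeness auto
termination
  by (relation "measures [\<lambda>(c, a, is). length is, \<lambda>(c, a, is). a (hd is)]")
    (auto simp: dec_def)

declare wick.simps(2) [simp del]

lemma wick_Cons_0: "a i = 0 \<Longrightarrow> wick c a (i # is) = wick c a is"
  by (simp add: wick.simps(2))

lemma wick_Cons_Suc:
  "0 < a i \<Longrightarrow> wick c a (i # is) =
     (\<Sum>j\<in>set is. c i j * real (a j) * wick c (dec i (dec j a)) (i # is))"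
  by (simp add: wick.simps(2))

text \<open>The kernel is constant along the recursion. Dropping it from \<open>wick.induct\<close>
  lets one induction treat two kernels at once, or all of them.\<close>

lemma wick_induct [case_names Nil zero pos]:
  assumes "\<And>a. P a []"
    and "\<And>a i is. a i = 0 \<Longrightarrow> P a is \<Longrightarrow> P a (i # is)"
    and "\<And>a i is. 0 < a i \<Longrightarrow> (\<And>j. j \<in> set is \<Longrightarrow> P (dec i (dec j a)) (i # is)) \<Longrightarrow> P a (i # is)"
  shows "P a is"
proof -
  have "P a is" for c :: "'a \<Rightarrow> 'a \<Rightarrow> real"
  proof (induction c a "is" rule: wick.induct)
    case (2 c a i "is")
    then show ?case using assms(2,3)[of a i "is"] by (cases "a i = 0") auto
  qed (rule assms(1))
  then show ?thesis .
qed

lemma wick_cong: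
  assumes "\<And>i. i \<in> set is \<Longrightarrow> a i = a' i"
    and "\<And>i j. i \<in> set is \<Longrightarrow> j \<in> set is \<Longrightarrow> c i j = c' i j"
  shows "wick c a is = wick c' a' is"
  using assms
proof (induction a "is" arbitrary: a' rule: wick_induct)
  case (zero a i "is")
  then have "a' i = 0" by simp
  with zero show ?case by (simp add: wick_Cons_0)
next
  case (pos a i "is")
  have a': "0 < a' i" using pos by simp
  have "wick c (dec i (dec j a)) (i # is) = wick c' (dec i (dec j a')) (i # is)" if "j \<in> set is" for j
    by (rule pos.IH) (use pos.prems that in \<open>auto simp: dec_def\<close>)
  then show ?case
    using pos.prems pos.hyps a' by (auto simp: wick_Cons_Suc intro!: sum.cong)
qed simp

lemma wick_nonneg:
  assumes "\<And>i j. i \<in> set is \<Longrightarrow> j \<in> set is \<Longrightarrow> 0 \<le> c i j"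
  shows "0 \<le> wick c a is"
  using assms
proof (induction a "is" rule: wick_induct)
  case (pos a i "is")
  then show ?case
    unfolding wick_Cons_Suc[of a i, OF pos.hyps(1)]
    by (intro sum_nonneg mult_nonneg_nonneg) auto
qed (auto simp: wick_Cons_0)

lemma sum_dec:
  assumes "finite A" "i \<in> A" "0 < a i"
  shows "(\<Sum>l\<in>A. a l) = Suc (\<Sum>l\<in>A. dec i a l)"
proof -
  have "(\<Sum>l\<in>A - {i}. dec i a l) = (\<Sum>l\<in>A - {i}. a l)"
    by (intro sum.cong) auto
  then show ?thesis
    using assms by (simp add: sum.remove[of A i])
qed

text \<open>Every factor \<open>c i j\<close> uses up two half-edges. Scaling by
  \<open>r\<^sup>2\<close> avoids halving the exponent and covers an odd total, where both sides
  vanish.\<close>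

lemma wick_homogeneous:
  assumes "distinct is"
  shows "wick (\<lambda>i j. r\<^sup>2 * c i j) a is = r ^ (\<Sum>i\<in>set is. a i) * wick c a is"
  using assms
proof (induction a "is" rule: wick_induct)
  case (pos a i "is")
  have "r\<^sup>2 * c i j * real (a j) * wick (\<lambda>i j. r\<^sup>2 * c i j) (dec i (dec j a)) (i # is)
      = r ^ (\<Sum>l\<in>set (i # is). a l) * (c i j * real (a j) * wick c (dec i (dec j a)) (i # is))"
    if j: "j \<in> set is" for j
  proof (cases "a j = 0")
    \<comment> \<open>For \<open>a j = 0\<close> the truncated subtraction in \<open>dec\<close>
      would spoil the count of half-edges, but there the factor \<open>a j\<close> kills the
      term.\<close>
    case False
    have ij: "i \<noteq> j" using pos.prems j by auto
    have "(\<Sum>l\<in>set (i # is). a l) = Suc (Suc (\<Sum>l\<in>set (i # is). dec i (dec j a) l))"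
      using sum_dec[of "set (i # is)" j a] sum_dec[of "set (i # is)" i "dec j a"] j ij False pos.hyps
      by (simp del: sum.insert)
    then show ?thesis
      using pos.IH[OF j pos.prems] by (simp add: power2_eq_square algebra_simps)
  qed simp
  then show ?case
    unfolding wick_Cons_Suc[of a i, OF pos.hyps(1)] sum_distrib_left by (intro sum.cong) auto
qed (auto simp: wick_Cons_0)

lemma wick_0_remove:
  assumes "distinct is" "a l = 0" "l \<in> set is"
  shows "wick c a is = wick c a (remove1 l is)"
  using assms
proof (induction a "is" rule: wick_induct)
  case (zero a i "is")
  then show ?case by (cases "i = l") (auto simp: wick_Cons_0)
next
  case (pos a i "is")
  then have il: "i \<noteq> l" and l: "l \<in> set is" by auto
  have *: "wick c (dec i (dec j a)) (i # is) = wick c (dec i (dec j a)) (i # remove1 l is)"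
    if "j \<in> set is" for j
  proof -
    have "dec i (dec j a) l = 0" using pos.prems(2) by (auto simp: dec_def)
    with pos.IH[OF that pos.prems(1) _ pos.prems(3)] il show ?thesis by simp
  qed
  have "wick c a (i # is) =
     (\<Sum>j\<in>set is. c i j * real (a j) * wick c (dec i (dec j a)) (i # remove1 l is))"
    unfolding wick_Cons_Suc[of a i, OF pos.hyps(1)] using * by (intro sum.cong) auto
  also have "\<dots> = (\<Sum>j\<in>set is - {l}. c i j * real (a j) * wick c (dec i (dec j a)) (i # remove1 l is))"
    using l pos.prems(2) by (subst sum.remove[of _ l]) auto
  also have "\<dots> = wick c a (i # remove1 l is)"
    using pos.hyps pos.prems(1) by (simp add: wick_Cons_Suc set_remove1_eq)
  finally show ?case using il by simp
qed auto

text \<open>With only two vertices a contraction is a bijection between their half-edges.\<close>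

lemma wick_pair:
  assumes "i \<noteq> j" "a i = a j"
  shows "wick c a [i, j] = fact (a i) * c i j ^ a i"
  using assms
proof (induction "a i" arbitrary: a)
  case 0
  then show ?case by (simp add: wick_Cons_0)
next
  case (Suc n)
  have ai: "a i = Suc n" and aj: "a j = Suc n" using Suc by auto
  have "wick c (dec i (dec j a)) [i, j] = fact n * c i j ^ n"
    using Suc.hyps(1)[of "dec i (dec j a)"] Suc.prems(1) ai aj by simp
  then show ?case
    by (subst wick_Cons_Suc) (auto simp: ai aj algebra_simps)
qed

lemma wick_single: "0 < a i \<Longrightarrow> wick c a [i] = 0"
  by (simp add: wick_Cons_Suc)

text \<open>The properties of polynomials of degree at most \<open>N\<close> with nonnegative coefficients that survive
  the passage to an arbitrary function of the covariance matrix.\<close>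

definition posynomial :: "nat \<Rightarrow> (('i \<Rightarrow> 'i \<Rightarrow> real) \<Rightarrow> real) \<Rightarrow> bool" where
  "posynomial N f \<longleftrightarrow> (\<forall>c. (\<forall>i j. 0 \<le> c i j) \<longrightarrow> 0 \<le> f c) \<and>
     (\<forall>c c' K. 1 \<le> K \<longrightarrow> (\<forall>i j. 0 \<le> c i j) \<longrightarrow> (\<forall>i j. c i j \<le> K * c' i j) \<longrightarrow> f c \<le> K ^ N * f c')"

lemma posynomial_nonneg: "posynomial N f \<Longrightarrow> (\<And>i j. 0 \<le> c i j) \<Longrightarrow> 0 \<le> f c"
  unfolding posynomial_def by (drule conjunct1) simp

lemma posynomial_le:
  assumes "posynomial N f" "1 \<le> K" "\<And>i j. 0 \<le> c i j" "\<And>i j. c i j \<le> K * c' i j"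
  shows "f c \<le> K ^ N * f c'"
  by (rule assms(1)[unfolded posynomial_def, THEN conjunct2, rule_format]) (use assms in auto)

lemma nonneg_if_dominated:
  fixes c c' :: real
  assumes "1 \<le> K" "0 \<le> c" "c \<le> K * c'"
  shows "0 \<le> c'"
proof -
  have "0 \<le> K * c'" using assms by linarith
  with assms(1) show ?thesis by (simp add: zero_le_mult_iff)
qed

lemma posynomial_mono:
  assumes "posynomial N f" "N \<le> N'"
  shows "posynomial N' f"
  unfolding posynomial_def
proof (intro conjI allI impI)
  fix c c' :: "'a \<Rightarrow> 'a \<Rightarrow> real" and K :: real
  assume K: "1 \<le> K" and *: "\<forall>i j. 0 \<le> c i j" "\<forall>i j. c i j \<le> K * c' i j"
  then have "0 \<le> c' i j" for i j
    using nonneg_if_dominated[of K "c i j" "c' i j"] by simp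
  then have "0 \<le> f c'"
    using posynomial_nonneg[OF assms(1)] by simp
  then have "K ^ N * f c' \<le> K ^ N' * f c'"
    using K assms(2) by (intro mult_right_mono power_increasing)
  moreover have "f c \<le> K ^ N * f c'"
    using posynomial_le[OF assms(1) K] * by simp
  ultimately show "f c \<le> K ^ N' * f c'" by simp
qed (use posynomial_nonneg[OF assms(1)] in simp)

lemma posynomial_const: "0 \<le> r \<Longrightarrow> posynomial N (\<lambda>_. r)"
  by (rule posynomial_mono[of 0]) (auto simp: posynomial_def)

lemma posynomial_var: "posynomial 1 (\<lambda>c. c i j)"
  by (auto simp: posynomial_def)

lemma posynomial_add:
  assumes "posynomial N f" "posynomial N g"
  shows "posynomial N (\<lambda>c. f c + g c)"
  unfolding posynomial_def
proof (intro conjI allI impI)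
  fix c c' :: "'a \<Rightarrow> 'a \<Rightarrow> real" and K :: real
  assume "1 \<le> K" "\<forall>i j. 0 \<le> c i j" "\<forall>i j. c i j \<le> K * c' i j"
  then show "f c + g c \<le> K ^ N * (f c' + g c')"
    using posynomial_le[OF assms(1), of K c c'] posynomial_le[OF assms(2), of K c c']
    by (simp add: distrib_left)
qed (use posynomial_nonneg[OF assms(1)] posynomial_nonneg[OF assms(2)] in simp)

lemma posynomial_mult:
  assumes "posynomial N f" "posynomial N' g"
  shows "posynomial (N + N') (\<lambda>c. f c * g c)"
  unfolding posynomial_def
proof (intro conjI allI impI)
  fix c c' :: "'a \<Rightarrow> 'a \<Rightarrow> real" and K :: real
  assume K: "1 \<le> K" and *: "\<forall>i j. 0 \<le> c i j" "\<forall>i j. c i j \<le> K * c' i j"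
  have fg: "0 \<le> f c" "f c \<le> K ^ N * f c'" "0 \<le> g c" "g c \<le> K ^ N' * g c'"
    using posynomial_nonneg[OF assms(1), of c] posynomial_le[OF assms(1) K, of c c']
      posynomial_nonneg[OF assms(2), of c] posynomial_le[OF assms(2) K, of c c'] * by auto
  then have "f c * g c \<le> (K ^ N * f c') * (K ^ N' * g c')"
    by (intro mult_mono) auto
  then show "f c * g c \<le> K ^ (N + N') * (f c' * g c')"
    by (simp add: power_add algebra_simps)
qed (use posynomial_nonneg[OF assms(1)] posynomial_nonneg[OF assms(2)] in simp)

lemma posynomial_sum:
  assumes "finite A" "\<And>x. x \<in> A \<Longrightarrow> posynomial N (f x)"
  shows "posynomial N (\<lambda>c. \<Sum>x\<in>A. f x c)"
  using assms by (induction A rule: finite_induct) (auto intro: posynomial_add posynomial_const)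

lemma posynomial_common_degree:
  assumes "finite A" "\<And>x. x \<in> A \<Longrightarrow> \<exists>N. posynomial N (f x)"
  shows "\<exists>N. \<forall>x\<in>A. posynomial N (f x)"
proof -
  obtain N where N: "\<And>x. x \<in> A \<Longrightarrow> posynomial (N x) (f x)"
    using assms(2) by metis
  have "posynomial (Max (N ` A)) (f x)" if "x \<in> A" for x
    using N[OF that] by (rule posynomial_mono) (use assms(1) that in auto)
  then show ?thesis by blast
qed

lemma posynomial_ex_sum:
  assumes "finite A" "\<And>x. x \<in> A \<Longrightarrow> \<exists>N. posynomial N (f x)"
  shows "\<exists>N. posynomial N (\<lambda>c. \<Sum>x\<in>A. f x c)"
proof -
  obtain N where N: "\<forall>x\<in>A. posynomial N (f x)"
    using posynomial_common_degree[OF assms] by (rule exE)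
  show ?thesis
    by (rule exI, rule posynomial_sum[OF assms(1)], rule N[THEN bspec])
qed

lemma posynomial_ex_mult:
  assumes "\<exists>N. posynomial N f" "\<exists>N. posynomial N g"
  shows "\<exists>N. posynomial N (\<lambda>c. f c * g c)"
  using assms by (elim exE) (rule exI, rule posynomial_mult)

lemma posynomial_ex_add:
  assumes "\<exists>N. posynomial N f" "\<exists>N. posynomial N g"
  shows "\<exists>N. posynomial N (\<lambda>c. f c + g c)"
proof -
  obtain N N' where "posynomial N f" "posynomial N' g" using assms by blast
  then have "posynomial (max N N') f" "posynomial (max N N') g"
    by (simp_all add: posynomial_mono[of N f] posynomial_mono[of N' g])
  then show ?thesis by (intro exI posynomial_add)
qed

lemma posynomial_ex_var: "\<exists>N. posynomial N (\<lambda>c. c i j)"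
  by (rule exI) (rule posynomial_var)

lemma posynomial_ex_const: "0 \<le> r \<Longrightarrow> \<exists>N. posynomial N (\<lambda>_. r)"
  using posynomial_const by blast

lemmas posynomial_ex_intros =
  posynomial_ex_add posynomial_ex_sum posynomial_ex_mult posynomial_ex_var posynomial_ex_const

lemma posynomial_wick: "\<exists>N. posynomial N (\<lambda>c. wick c a is)"
proof (induction a "is" rule: wick_induct)
  case (Nil a)
  then show ?case using posynomial_const[of 1] by auto
next
  case (zero a i "is")
  then show ?case by (simp add: wick_Cons_0)
next
  case (pos a i "is")
  have "\<exists>N. posynomial N (\<lambda>c. \<Sum>j\<in>set is. c i j * real (a j) * wick c (dec i (dec j a)) (i # is))"
    by (intro posynomial_ex_intros pos.IH) auto
  then show ?case by (subst wick_Cons_Suc[of a i, OF pos.hyps(1)])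
qed

text \<open>The weight of a pair is the value found in \<open>wick_pair\<close>: all
  \<open>q\<close> half-edges of \<open>i\<close> go to the same \<open>j\<close>, in
  \<open>fact q\<close> ways.\<close>

function pairing :: "nat \<Rightarrow> ('i \<Rightarrow> 'i \<Rightarrow> real) \<Rightarrow> 'i list \<Rightarrow> real" where
  "pairing q c [] = 1"
| "pairing q c (i # is) = (\<Sum>j\<in>set is. fact q * c i j ^ q * pairing q c (remove1 j is))"
  by pat_completeness auto
termination
  by (relation "measures [\<lambda>(q, c, is). length is]") (simp_all add: length_remove1 less_Suc_eq_le)

text \<open>The displayed term collects the contractions in which all half-edges at \<open>i\<close> go to \<open>j\<close>.\<close>

lemma wick_two_vertices:
  assumes "distinct (i # is)" "j \<in> set is" "a i = a j"
  shows "\<exists>f N. posynomial N f \<and>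
    (\<forall>c. wick c a (i # is) = fact (a i) * c i j ^ a i * wick c a (remove1 j is) + f c)"
  using assms
proof (induction "a i" arbitrary: a)
  case 0
  have ai: "a i = 0" and aj: "a j = 0" using 0 by auto
  have "wick c a (i # is) = wick c a (remove1 j is)" for c
    using wick_0_remove[of "is" a j c] 0(2,3) by (simp only: wick_Cons_0 ai aj distinct.simps)
  then have "\<forall>c. wick c a (i # is) = fact (a i) * c i j ^ a i * wick c a (remove1 j is) + 0"
    by (simp add: ai)
  then show ?case by (intro exI[of _ "\<lambda>_. 0"] exI[of _ 0] conjI posynomial_const) auto
next
  case (Suc n)
  have ij: "i \<noteq> j" and ai: "a i = Suc n" and aj: "a j = Suc n" using Suc by auto
  define a' where "a' = dec i (dec j a)"
  have a': "a' i = n" "a' j = n" using ij ai aj by (auto simp: a'_def)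
  obtain f where f: "\<exists>N. posynomial N f"
    "\<And>c. wick c a' (i # is) = fact n * c i j ^ n * wick c a' (remove1 j is) + f c"
    using Suc.hyps(1)[of a'] a' Suc.prems by auto
  \<comment> \<open>Contracting with \<open>j\<close> leads to the same situation with one half-edge
    fewer at both ends. Once a half-edge of \<open>i\<close> has gone elsewhere, the contraction is
    not of the displayed kind, so those terms enter the remainder whole.\<close>
  define g where "g = (\<lambda>c. c i j * real (Suc n) * f c +
    (\<Sum>l\<in>set is - {j}. c i l * real (a l) * wick c (dec i (dec l a)) (i # is)))"
  have "\<exists>N. posynomial N g" unfolding g_def
    by (intro posynomial_ex_intros posynomial_wick f(1)) auto
  moreover have "wick c a (i # is) = fact (a i) * c i j ^ a i * wick c a (remove1 j is) + g c" for c
  proof -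
    have "wick c a (i # is) = c i j * real (a j) * wick c a' (i # is)
       + (\<Sum>l\<in>set is - {j}. c i l * real (a l) * wick c (dec i (dec l a)) (i # is))"
      using Suc.prems(2) ai unfolding a'_def by (subst wick_Cons_Suc) (auto simp: sum.remove)
    moreover have "wick c a' (remove1 j is) = wick c a (remove1 j is)"
      using Suc.prems by (intro wick_cong) (auto simp: a'_def dec_def)
    ultimately show ?thesis
      unfolding g_def by (simp add: f(2) ai aj algebra_simps)
  qed
  ultimately show ?case by (elim exE) (intro exI conjI allI)
qed

text \<open>The recursion fixes the partner \<open>j\<close> of the first half-edge at
  \<open>i\<close>. If the other \<open>q - 1\<close> half-edges at \<open>i\<close> follow it, what
  is left is \<open>wick\<close> on the remaining vertices, and the induction applies; everything
  else has nonnegative coefficients. For \<open>q = 0\<close> there is only the empty contraction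
  while \<open>pairing\<close> still counts matchings, so the difference could be negative.\<close>

lemma wick_eq_pairing_plus:
  assumes "distinct is" "0 < q"
  shows "\<exists>f N. posynomial N f \<and> (\<forall>c. wick c (\<lambda>_. q) is = pairing q c is + f c)"
  using assms(1)
proof (induction "length is" arbitrary: "is" rule: less_induct)
  case (less "is")
  show ?case
  proof (cases "is")
    case Nil
    then have "\<forall>c. wick c (\<lambda>_. q) is = pairing q c is + 0" by simp
    then show ?thesis by (intro exI[of _ "\<lambda>_. 0"] exI[of _ 0] conjI posynomial_const) auto
  next
    case (Cons i js)
    have "\<exists>g. \<forall>j\<in>set js. (\<exists>N. posynomial N (g j)) \<and>
      (\<forall>c. wick c (\<lambda>_. q) (remove1 j js) = pairing q c (remove1 j js) + g j c)"
    proof (intro bchoice ballI)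
      fix j assume "j \<in> set js"
      then have "length (remove1 j js) < length is" "distinct (remove1 j js)"
        using Cons less.prems by (auto simp: length_remove1)
      from less.hyps[OF this] show "\<exists>g. (\<exists>N. posynomial N g) \<and>
          (\<forall>c. wick c (\<lambda>_. q) (remove1 j js) = pairing q c (remove1 j js) + g c)"
        by (elim exE conjE) (intro exI conjI)
    qed
    then obtain g where g': "\<forall>j\<in>set js. (\<exists>N. posynomial N (g j)) \<and> (\<forall>c. wick c (\<lambda>_. q) (remove1 j js) = pairing q c (remove1 j js) + g j c)"
      by (rule exE)
    note g = g'[THEN bspec, THEN conjunct1] g'[THEN bspec, THEN conjunct2, THEN spec]
    define b where "b j = dec i (dec j (\<lambda>_. q))" for j
    have "\<exists>h. \<forall>j\<in>set js. (\<exists>N. posynomial N (h j)) \<and> (\<forall>c. wick c (b j) (i # js) =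
        fact (q - 1) * c i j ^ (q - 1) * wick c (\<lambda>_. q) (remove1 j js) + h j c)"
    proof (intro bchoice ballI)
      fix j assume j: "j \<in> set js"
      have ij: "i \<noteq> j" and dist: "distinct (i # js)" using less.prems Cons j by auto
      have b: "b j i = q - 1" "b j j = q - 1" using ij by (auto simp: b_def)
      have rem: "wick c (b j) (remove1 j js) = wick c (\<lambda>_. q) (remove1 j js)" for c
        using dist by (intro wick_cong) (auto simp: b_def dec_def)
      show "\<exists>h. (\<exists>N. posynomial N h) \<and> (\<forall>c. wick c (b j) (i # js) =
        fact (q - 1) * c i j ^ (q - 1) * wick c (\<lambda>_. q) (remove1 j js) + h c)"
        using wick_two_vertices[OF dist j, of "b j"] unfolding b rem
        by (elim exE conjE meta_impE[OF _ refl]) (intro exI conjI)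
    qed
    then obtain h where h': "\<forall>j\<in>set js. (\<exists>N. posynomial N (h j)) \<and> (\<forall>c. wick c (b j) (i # js) =
        fact (q - 1) * c i j ^ (q - 1) * wick c (\<lambda>_. q) (remove1 j js) + h j c)"
      by (rule exE)
    note h = h'[THEN bspec, THEN conjunct1] h'[THEN bspec, THEN conjunct2, THEN spec]
    define f where "f = (\<lambda>c. \<Sum>j\<in>set js.
      (c i j * real q) * (fact (q - 1) * c i j ^ (q - 1) * g j c) + c i j * real q * h j c)"
    have pow: "\<exists>N. posynomial N (\<lambda>c. c i j ^ n)" for j and n :: nat
    proof (induction n)
      case 0
      show ?case unfolding power_0 by (rule posynomial_ex_const) simp
    next
      case (Suc n)
      show ?case
        unfolding power_Suc by (rule posynomial_ex_mult[OF posynomial_ex_var Suc])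
    qed
    have "\<exists>N. posynomial N f" unfolding f_def
      by (intro posynomial_ex_intros pow g h) auto
    moreover have "wick c (\<lambda>_. q) is = pairing q c is + f c" for c
    proof -
      have q: "fact q = real q * fact (q - 1)" "c i j ^ q = c i j * c i j ^ (q - 1)" for j
        using assms(2) by (simp_all add: fact_reduce power_eq_if)
      have "wick c (\<lambda>_. q) is = (\<Sum>j\<in>set js. c i j * real q * wick c (b j) (i # js))"
        using assms(2) unfolding Cons b_def by (subst wick_Cons_Suc) auto
      also have "\<dots> = (\<Sum>j\<in>set js. fact q * c i j ^ q * pairing q c (remove1 j js) +
         ((c i j * real q) * (fact (q - 1) * c i j ^ (q - 1) * g j c) + c i j * real q * h j c))"
        by (intro sum.cong refl) (simp add: g(2) h(2) q algebra_simps)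
      finally show ?thesis unfolding Cons f_def by (simp add: sum.distrib)
    qed
    ultimately show ?thesis by (elim exE) (intro exI conjI allI)
  qed
qed

section \<open>Gaussian integration by parts\<close>

lemma
  fixes f :: "real \<Rightarrow> real"
  assumes X: "X \<in> borel_measurable M"
    and distr: "distr M borel X = distr std_normal_distribution borel (\<lambda>z. m + s * z)"
    and f: "f \<in> borel_measurable borel"
  shows integrable_gaussian_iff:
      "integrable M (\<lambda>w. f (X w)) \<longleftrightarrow> integrable lborel (\<lambda>z. std_normal_density z * f (m + s * z))"
    and integral_gaussian:
      "(\<integral>w. f (X w) \<partial>M) = (\<integral>z. std_normal_density z * f (m + s * z) \<partial>lborel)"
proof -
  have m: "(\<lambda>z. m + s * z) \<in> measurable std_normal_distribution borel" by simp
  have "integrable M (\<lambda>w. f (X w)) \<longleftrightarrow> integrable (distr M borel X) f"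
    by (simp add: integrable_distr_eq[OF X f])
  also have "\<dots> \<longleftrightarrow> integrable std_normal_distribution (\<lambda>z. f (m + s * z))"
    unfolding distr using integrable_distr_eq[OF m f] by simp
  also have "\<dots> \<longleftrightarrow> integrable lborel (\<lambda>z. std_normal_density z * f (m + s * z))"
    using f by (subst integrable_density) (auto simp: real_scaleR_def)
  finally show "integrable M (\<lambda>w. f (X w)) \<longleftrightarrow> \<dots>" .
  have "(\<integral>w. f (X w) \<partial>M) = integral\<^sup>L (distr M borel X) f"
    by (simp add: integral_distr[OF X f])
  also have "\<dots> = (\<integral>z. f (m + s * z) \<partial>std_normal_distribution)"
    unfolding distr using integral_distr[OF m f] by simp
  also have "\<dots> = (\<integral>z. std_normal_density z * f (m + s * z) \<partial>lborel)"
    using f by (subst integral_density) auto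
  finally show "(\<integral>w. f (X w) \<partial>M) = \<dots>" .
qed

text \<open>Completing the square turns the integrand into a multiple of the normal density with
  mean \<open>s\<close>.\<close>

lemma std_normal_exp_moment:
  "has_bochner_integral lborel (\<lambda>z. std_normal_density z * exp (s * z)) (exp (s\<^sup>2 / 2))"
proof -
  have eq: "std_normal_density z * exp (s * z) = exp (s\<^sup>2 / 2) * normal_density s 1 z" for z
    unfolding normal_density_def
    by (auto simp: exp_add[symmetric] power2_eq_square field_simps)
  have "has_bochner_integral lborel (\<lambda>z. normal_density s 1 z) 1"
    using integrable_normal_density[of 1 s] integral_normal_density[of 1 s]
    by (simp add: has_bochner_integral_iff)
  from has_bochner_integral_mult_right[OF this, of "exp (s\<^sup>2 / 2)"] show ?thesis
    by (simp add: eq)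
qed

lemma std_normal_first_moments:
  "has_bochner_integral lborel std_normal_density 1"
  "has_bochner_integral lborel (\<lambda>z. std_normal_density z * z) 0"
  "has_bochner_integral lborel (\<lambda>z. std_normal_density z * z\<^sup>2) 1"
  using std_normal_moment_even[of 0] std_normal_moment_odd[of 0] std_normal_moment_even[of 1] by simp_all

lemma gaussian_centered_moments:
  assumes "gaussian_rv M X" "(\<integral>w. X w \<partial>M) = 0"
  shows "integrable M (\<lambda>w. exp (X w))" "integrable M (\<lambda>w. (X w)\<^sup>2)"
    "(\<integral>w. exp (X w) \<partial>M) = exp ((\<integral>w. (X w)\<^sup>2 \<partial>M) / 2)"
proof -
  obtain m s where X: "X \<in> borel_measurable M"
    and distr: "distr M borel X = distr std_normal_distribution borel (\<lambda>z. m + s * z)"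
    using assms(1) unfolding gaussian_rv_def by blast
  note int = integrable_gaussian_iff[OF X distr] and val = integral_gaussian[OF X distr]
  have "has_bochner_integral lborel (\<lambda>z. m * std_normal_density z + s * (std_normal_density z * z)) (m * 1 + s * 0)"
    by (intro has_bochner_integral_add has_bochner_integral_mult_right std_normal_first_moments)
  then have "has_bochner_integral lborel (\<lambda>z. std_normal_density z * (m + s * z)) m"
    by (simp add: algebra_simps)
  with val[of "\<lambda>x. x"] assms(2) have m: "m = 0"
    by (simp add: has_bochner_integral_integral_eq)
  have "has_bochner_integral lborel (\<lambda>z. s\<^sup>2 * (std_normal_density z * z\<^sup>2)) (s\<^sup>2 * 1)"
    by (intro has_bochner_integral_mult_right std_normal_first_moments)
  then have sq: "has_bochner_integral lborel (\<lambda>z. std_normal_density z * (m + s * z)\<^sup>2) (s\<^sup>2)"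
    by (simp add: m power_mult_distrib algebra_simps)
  show "integrable M (\<lambda>w. (X w)\<^sup>2)"
    using int[of "\<lambda>x. x\<^sup>2"] sq by (simp add: has_bochner_integral_iff)
  have var: "(\<integral>w. (X w)\<^sup>2 \<partial>M) = s\<^sup>2"
    using val[of "\<lambda>x. x\<^sup>2"] sq by (simp add: has_bochner_integral_iff)
  show "integrable M (\<lambda>w. exp (X w))" "(\<integral>w. exp (X w) \<partial>M) = exp ((\<integral>w. (X w)\<^sup>2 \<partial>M) / 2)"
    using int[of exp] val[of exp] std_normal_exp_moment[of s]
    unfolding var by (simp_all add: has_bochner_integral_iff m)
qed

section \<open>Differentiating exponentials of Gaussian variables\<close>

lemma abs_mult_exp_le:
  fixes x y :: real
  shows "\<bar>y\<bar> * exp x \<le> exp (x + y) + exp (x + - y)"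
proof -
  have "\<bar>y\<bar> \<le> exp \<bar>y\<bar>" using exp_ge_add_one_self[of "\<bar>y\<bar>"] by linarith
  also have "\<dots> \<le> exp y + exp (- y)" by (simp add: abs_if)
  finally have "\<bar>y\<bar> * exp x \<le> (exp y + exp (- y)) * exp x"
    by (intro mult_right_mono) auto
  then show ?thesis by (simp only: exp_add) (simp add: algebra_simps)
qed

text \<open>The majorant for differentiating under the expectation. It is free of \<open>t\<close>
  and is again a sum of exponentials of linear combinations of \<open>x\<close> and
  \<open>y\<close>, hence integrable against tame functions. The factor 2 comes from absorbing
  \<open>\<bar>y\<bar> * exp \<bar>y\<bar>\<close> into
  \<open>exp (2 * \<bar>y\<bar>)\<close>.\<close>

lemma difference_quotient_exp_le:
  fixes x y t :: real
  assumes "0 < t" "t \<le> 1"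
  shows "\<bar>(exp (x + t * y) - exp x) / t\<bar> \<le> exp (x + 2 * y) + exp (x + - 2 * y)"
proof -
  have *: "\<bar>exp u - 1\<bar> \<le> \<bar>u\<bar> * exp \<bar>u\<bar>" for u :: real
  proof (cases "0 \<le> u")
    case True
    have "1 - u \<le> exp (- u)" using exp_ge_add_one_self[of "- u"] by simp
    then have "(1 - u) * exp u \<le> exp (- u) * exp u" by (intro mult_right_mono) auto
    then have "(1 - u) * exp u \<le> 1" by (simp add: exp_minus)
    with True show ?thesis by (simp add: algebra_simps)
  next
    case False
    have "1 - exp u \<le> - u" using exp_ge_add_one_self[of u] by linarith
    also have "\<dots> \<le> - u * exp (- u)" using False by (simp add: mult_le_cancel_left1)
    finally show ?thesis using False by simp
  qed
  have "\<bar>exp (t * y) - 1\<bar> \<le> t * (\<bar>y\<bar> * exp \<bar>y\<bar>)"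
  proof -
    have "\<bar>exp (t * y) - 1\<bar> \<le> \<bar>t * y\<bar> * exp \<bar>t * y\<bar>" by (rule *)
    also have "\<dots> \<le> (t * \<bar>y\<bar>) * exp \<bar>y\<bar>"
      using assms by (intro mult_mono) (auto simp: abs_mult mult_left_le_one_le)
    finally show ?thesis by simp
  qed
  then have "\<bar>(exp (t * y) - 1) / t\<bar> \<le> \<bar>y\<bar> * exp \<bar>y\<bar>"
    using assms by (simp add: divide_le_eq mult.commute)
  also have "\<dots> \<le> exp \<bar>y\<bar> * exp \<bar>y\<bar>"
    using exp_ge_add_one_self[of "\<bar>y\<bar>"] by (intro mult_right_mono) (linarith, simp)
  also have "\<dots> \<le> exp (2 * y) + exp (- 2 * y)"
    by (simp add: exp_add[symmetric] abs_if)
  finally have "\<bar>(exp (t * y) - 1) / t\<bar> * exp x \<le> (exp (2 * y) + exp (- 2 * y)) * exp x"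
    by (intro mult_right_mono) auto
  moreover have "(exp (x + t * y) - exp x) / t = (exp (t * y) - 1) / t * exp x"
    by (simp add: exp_add algebra_simps diff_divide_distrib)
  moreover have "(exp (2 * y) + exp (- 2 * y)) * exp x = exp (x + 2 * y) + exp (x + - 2 * y)"
    by (simp only: exp_add) (simp add: algebra_simps)
  ultimately show ?thesis by (simp only: abs_mult abs_exp_cancel)
qed

lemma difference_quotient_tendsto:
  fixes f :: "real \<Rightarrow> real"
  assumes "(f has_real_derivative D) (at 0)"
  shows "(\<lambda>n. (f (1 / real (Suc n)) - f 0) / (1 / real (Suc n))) \<longlonglongrightarrow> D"
proof -
  have "(\<lambda>h. (f (0 + h) - f 0) / h) \<midarrow>0\<rightarrow> D"
    using assms by (simp add: has_field_derivative_iff)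
  moreover have "filterlim (\<lambda>n. 1 / real (Suc n)) (at 0) sequentially"
    unfolding filterlim_at
    using LIMSEQ_inverse_real_of_nat by (auto simp: inverse_eq_divide)
  ultimately have "((\<lambda>n. (f (0 + 1 / real (Suc n)) - f 0) / (1 / real (Suc n))) \<longlongrightarrow> D) sequentially"
    by (rule filterlim_compose)
  then show ?thesis by simp
qed

text \<open>Joint Gaussianity is encoded by closure under linear combinations. Neither densities nor
  invertible covariance matrices appear, so repeated or linearly dependent variables are allowed;
  they do occur when moments of squares are computed.\<close>

locale centered_gaussian_space = prob_space M for M :: "'w measure" +
  fixes V :: "('w \<Rightarrow> real) set"
  assumes V_add: "S \<in> V \<Longrightarrow> T \<in> V \<Longrightarrow> (\<lambda>w. S w + T w) \<in> V"
    and V_scale: "S \<in> V \<Longrightarrow> (\<lambda>w. c * S w) \<in> V"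
    and V_gaussian: "S \<in> V \<Longrightarrow> gaussian_rv M S"
    and V_centered: "S \<in> V \<Longrightarrow> expectation S = 0"
begin

lemma V_measurable [measurable_dest]: "S \<in> V \<Longrightarrow> S \<in> borel_measurable M"
  using V_gaussian unfolding gaussian_rv_def by blast

lemma integrable_exp_V: "S \<in> V \<Longrightarrow> integrable M (\<lambda>w. exp (S w))"
  and integrable_sq_V: "S \<in> V \<Longrightarrow> integrable M (\<lambda>w. (S w)\<^sup>2)"
  and expectation_exp_V: "S \<in> V \<Longrightarrow> expectation (\<lambda>w. exp (S w)) = exp (expectation (\<lambda>w. (S w)\<^sup>2) / 2)"
  by (rule gaussian_centered_moments[OF V_gaussian V_centered]; assumption)+

lemma integrable_mult_V:
  assumes "S \<in> V" "T \<in> V"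
  shows "integrable M (\<lambda>w. S w * T w)"
proof (rule Bochner_Integration.integrable_bound[of _ "\<lambda>w. (S w)\<^sup>2 + (T w)\<^sup>2"])
  show "AE w in M. norm (S w * T w) \<le> norm ((S w)\<^sup>2 + (T w)\<^sup>2)"
  proof (rule AE_I2)
    fix w
    have "2 * (\<bar>S w\<bar> * \<bar>T w\<bar>) \<le> (S w)\<^sup>2 + (T w)\<^sup>2"
      using sum_squares_bound[of "\<bar>S w\<bar>" "\<bar>T w\<bar>"] by simp
    then show "norm (S w * T w) \<le> norm ((S w)\<^sup>2 + (T w)\<^sup>2)"
      by (simp add: abs_mult) (smt (verit) abs_ge_zero mult_nonneg_nonneg)
  qed
qed (use assms integrable_sq_V in \<open>auto intro: V_measurable\<close>)

text \<open>Since \<open>\<bar>Z\<bar> \<le> exp Z + exp (- Z)\<close>, integrability against all exponentials of \<open>V\<close> is stable under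
  multiplication by elements of \<open>V\<close>.\<close>

definition tame :: "('w \<Rightarrow> real) \<Rightarrow> bool" where
  "tame F \<longleftrightarrow> F \<in> borel_measurable M \<and> (\<forall>S\<in>V. integrable M (\<lambda>w. F w * exp (S w)))"

lemma
  assumes "tame F"
  shows tame_measurable: "F \<in> borel_measurable M"
    and tame_integrable_exp: "S \<in> V \<Longrightarrow> integrable M (\<lambda>w. F w * exp (S w))"
  using assms unfolding tame_def by auto

lemma tame_const: "tame (\<lambda>_. c)"
  unfolding tame_def using integrable_exp_V by auto

lemma tame_add: "tame F \<Longrightarrow> tame G \<Longrightarrow> tame (\<lambda>w. F w + G w)"
  unfolding tame_def by (auto simp: distrib_right)

lemma tame_scale: "tame F \<Longrightarrow> tame (\<lambda>w. c * F w)"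
  unfolding tame_def by (auto simp: mult.assoc)

lemma tame_mult_V:
  assumes F: "tame F" and Z: "Z \<in> V"
  shows "tame (\<lambda>w. Z w * F w)"
  unfolding tame_def
proof (intro conjI ballI)
  note [measurable] = tame_measurable[OF F] V_measurable[OF Z]
  show "(\<lambda>w. Z w * F w) \<in> borel_measurable M" by measurable
  fix S assume S: "S \<in> V"
  note [measurable] = V_measurable[OF S]
  have "(\<lambda>w. S w + Z w) \<in> V" "(\<lambda>w. S w + - 1 * Z w) \<in> V"
    by (intro V_add V_scale S Z)+
  then have "integrable M (\<lambda>w. norm (F w * exp (S w + Z w)) + norm (F w * exp (S w + - 1 * Z w)))"
    by (intro Bochner_Integration.integrable_add integrable_norm tame_integrable_exp[OF F])
  then show "integrable M (\<lambda>w. Z w * F w * exp (S w))"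
  proof (rule Bochner_Integration.integrable_bound)
    show "AE w in M. norm (Z w * F w * exp (S w)) \<le>
        norm (norm (F w * exp (S w + Z w)) + norm (F w * exp (S w + - 1 * Z w)))"
    proof (rule AE_I2)
      fix w
      have "\<bar>F w\<bar> * (\<bar>Z w\<bar> * exp (S w)) \<le> \<bar>F w\<bar> * (exp (S w + Z w) + exp (S w + - Z w))"
        by (intro mult_left_mono abs_mult_exp_le) auto
      then show "norm (Z w * F w * exp (S w)) \<le>
        norm (norm (F w * exp (S w + Z w)) + norm (F w * exp (S w + - 1 * Z w)))"
        by (simp add: abs_mult algebra_simps)
    qed
  qed measurable
qed

lemma tame_integrable: "tame F \<Longrightarrow> Z \<in> V \<Longrightarrow> integrable M F"
  using tame_integrable_exp[of F "\<lambda>w. 0 * Z w"] V_scale[of Z 0] by simp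

text \<open>A derivative along the steps \<open>1 / real (Suc n)\<close> only: dominated convergence
  works with sequences, and the limit is used solely to identify two expressions.\<close>

lemma expectation_exp_derivative:
  assumes F: "tame F" and S: "S \<in> V" and Z: "Z \<in> V"
  shows "(\<lambda>n. (expectation (\<lambda>w. F w * exp (S w + 1 / real (Suc n) * Z w)) - expectation (\<lambda>w. F w * exp (S w)))
      / (1 / real (Suc n))) \<longlonglongrightarrow> expectation (\<lambda>w. Z w * F w * exp (S w))"
proof -
  note [measurable] = tame_measurable[OF F] V_measurable[OF Z] V_measurable[OF S]
  have SZ: "(\<lambda>w. S w + c * Z w) \<in> V" for c
    by (intro V_add V_scale S Z)
  define d where "d n w = F w * ((exp (S w + 1 / real (Suc n) * Z w) - exp (S w)) / (1 / real (Suc n)))" for n w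
  have "(\<lambda>n. expectation (d n)) \<longlonglongrightarrow> expectation (\<lambda>w. Z w * F w * exp (S w))"
  proof (rule integral_dominated_convergence)
    show "integrable M (\<lambda>w. norm (F w * exp (S w + 2 * Z w)) + norm (F w * exp (S w + - 2 * Z w)))"
      by (intro Bochner_Integration.integrable_add integrable_norm tame_integrable_exp[OF F] SZ)
    show "AE w in M. (\<lambda>n. d n w) \<longlonglongrightarrow> Z w * F w * exp (S w)"
    proof (rule AE_I2)
      fix w
      have "((\<lambda>t. exp (S w + t * Z w)) has_real_derivative exp (S w) * Z w) (at 0)"
        by (auto intro!: derivative_eq_intros)
      from tendsto_mult_left[OF difference_quotient_tendsto[OF this], of "F w"]
      show "(\<lambda>n. d n w) \<longlonglongrightarrow> Z w * F w * exp (S w)"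
        unfolding d_def by (simp add: algebra_simps)
    qed
    fix n
    show "AE w in M. norm (d n w) \<le> norm (F w * exp (S w + 2 * Z w)) + norm (F w * exp (S w + - 2 * Z w))"
    proof (rule AE_I2)
      fix w
      have "\<bar>F w\<bar> * \<bar>(exp (S w + 1 / real (Suc n) * Z w) - exp (S w)) / (1 / real (Suc n))\<bar>
          \<le> \<bar>F w\<bar> * (exp (S w + 2 * Z w) + exp (S w + - 2 * Z w))"
        by (intro mult_left_mono difference_quotient_exp_le) auto
      then show "norm (d n w) \<le> norm (F w * exp (S w + 2 * Z w)) + norm (F w * exp (S w + - 2 * Z w))"
        unfolding d_def by (simp only: real_norm_def abs_mult abs_exp_cancel distrib_left)
    qed
  qed (unfold d_def, measurable)
  moreover have "expectation (d n) = (expectation (\<lambda>w. F w * exp (S w + 1 / real (Suc n) * Z w))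
      - expectation (\<lambda>w. F w * exp (S w))) / (1 / real (Suc n))" for n
  proof -
    have "d n = (\<lambda>w. (F w * exp (S w + 1 / real (Suc n) * Z w) - F w * exp (S w)) / (1 / real (Suc n)))"
      unfolding d_def by (auto simp: algebra_simps)
    then show ?thesis
      using tame_integrable_exp[OF F SZ] tame_integrable_exp[OF F S]
      by (simp only: integral_divide_zero Bochner_Integration.integral_diff)
  qed
  ultimately show ?thesis by simp
qed

text \<open>\<open>F'\<close> plays the role of the derivative of \<open>F\<close> in the direction \<open>X\<close>. Testing against all
  exponentials makes the relation stable under multiplication by elements of \<open>V\<close>.\<close>

definition ibp :: "('w \<Rightarrow> real) \<Rightarrow> ('w \<Rightarrow> real) \<Rightarrow> ('w \<Rightarrow> real) \<Rightarrow> bool" where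
  "ibp X F F' \<longleftrightarrow> tame F \<and> tame F' \<and> (\<forall>S\<in>V. expectation (\<lambda>w. X w * F w * exp (S w)) =
     expectation (\<lambda>w. X w * S w) * expectation (\<lambda>w. F w * exp (S w)) + expectation (\<lambda>w. F' w * exp (S w)))"

text \<open>Both sides are the derivative at \<open>t = 0\<close> of the expectation of
  \<open>exp (S + t * X)\<close>, once taken under the expectation and once from the explicit value,
  whose exponent is quadratic in \<open>t\<close>.\<close>

lemma ibp_const:
  assumes X: "X \<in> V"
  shows "ibp X (\<lambda>_. 1) (\<lambda>_. 0)"
  unfolding ibp_def
proof (intro conjI ballI tame_const)
  fix S assume S: "S \<in> V"
  have SX: "(\<lambda>w. S w + t * X w) \<in> V" for t
    by (intro V_add V_scale S X)
  define A where "A = expectation (\<lambda>w. (S w)\<^sup>2)"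
  define B where "B = expectation (\<lambda>w. X w * S w)"
  define D where "D = expectation (\<lambda>w. (X w)\<^sup>2)"
  have sq: "expectation (\<lambda>w. (S w + t * X w)\<^sup>2) = A + 2 * t * B + t\<^sup>2 * D" for t
  proof -
    have "(\<lambda>w. (S w + t * X w)\<^sup>2) = (\<lambda>w. (S w)\<^sup>2 + 2 * t * (X w * S w) + t\<^sup>2 * (X w)\<^sup>2)"
      by (auto simp: power2_eq_square algebra_simps)
    then show ?thesis
      unfolding A_def B_def D_def
      using integrable_sq_V[OF S] integrable_sq_V[OF X] integrable_mult_V[OF X S] by simp
  qed
  have val: "expectation (\<lambda>w. 1 * exp (S w + t * X w)) = exp ((A + 2 * t * B + t\<^sup>2 * D) / 2)" for t
    using expectation_exp_V[OF SX[of t]] by (simp add: sq)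
  have "((\<lambda>t. exp ((A + 2 * t * B + t\<^sup>2 * D) / 2)) has_real_derivative B * exp (A / 2)) (at 0)"
    by (auto intro!: derivative_eq_intros)
  moreover have S0: "expectation (\<lambda>w. 1 * exp (S w)) = exp ((A + 2 * 0 * B + 0\<^sup>2 * D) / 2)"
    using val[of 0] by simp
  ultimately have "(\<lambda>n. (expectation (\<lambda>w. 1 * exp (S w + 1 / real (Suc n) * X w)) - expectation (\<lambda>w. 1 * exp (S w)))
      / (1 / real (Suc n))) \<longlonglongrightarrow> B * exp (A / 2)"
    unfolding val S0 by (intro difference_quotient_tendsto)
  then have "expectation (\<lambda>w. X w * 1 * exp (S w)) = B * exp (A / 2)"
    using expectation_exp_derivative[OF tame_const S X, of 1] by (blast intro: LIMSEQ_unique)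
  with val[of 0] show "expectation (\<lambda>w. X w * 1 * exp (S w)) =
      expectation (\<lambda>w. X w * S w) * expectation (\<lambda>w. 1 * exp (S w)) + expectation (\<lambda>w. 0 * exp (S w))"
    by (simp add: B_def)
qed

lemma ibp_add:
  assumes X: "X \<in> V" and F: "ibp X F F'" and G: "ibp X G G'"
  shows "ibp X (\<lambda>w. F w + G w) (\<lambda>w. F' w + G' w)"
proof -
  have t: "tame F" "tame G" "tame F'" "tame G'" using F G by (auto simp: ibp_def)
  note t' = tame_integrable_exp[OF t(1)] tame_integrable_exp[OF t(2)] tame_integrable_exp[OF t(3)]
    tame_integrable_exp[OF t(4)] tame_integrable_exp[OF tame_mult_V[OF t(1) X]]
    tame_integrable_exp[OF tame_mult_V[OF t(2) X]]
  show ?thesis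
    unfolding ibp_def
  proof (intro conjI ballI tame_add t)
    fix S assume S: "S \<in> V"
    show "expectation (\<lambda>w. X w * (F w + G w) * exp (S w)) = expectation (\<lambda>w. X w * S w) *
        expectation (\<lambda>w. (F w + G w) * exp (S w)) + expectation (\<lambda>w. (F' w + G' w) * exp (S w))"
      using F G S t' by (simp add: ibp_def distrib_left distrib_right)
  qed
qed

lemma ibp_scale:
  assumes F: "ibp X F F'"
  shows "ibp X (\<lambda>w. c * F w) (\<lambda>w. c * F' w)"
proof -
  have "expectation (\<lambda>w. X w * (c * F w) * exp (S w)) = c * expectation (\<lambda>w. X w * F w * exp (S w))"
    "expectation (\<lambda>w. c * G w * exp (S w)) = c * expectation (\<lambda>w. G w * exp (S w))" for S G
    by (simp_all flip: integral_mult_right_zero add: ac_simps)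
  with F show ?thesis
    unfolding ibp_def by (simp add: tame_scale algebra_simps)
qed

text \<open>The identity for \<open>F\<close> holds with \<open>S + e * Z\<close> in place of
  \<open>S\<close>. Its derivative in \<open>e\<close> at 0 brings down a factor \<open>Z\<close> in
  every expectation; the additional term of the product rule comes from the coefficient
  \<open>expectation (X * (S + e * Z))\<close>, which is affine in \<open>e\<close>.\<close>

lemma ibp_mult_V:
  assumes X: "X \<in> V" and Z: "Z \<in> V" and F: "ibp X F F'"
  shows "ibp X (\<lambda>w. Z w * F w) (\<lambda>w. Z w * F' w + expectation (\<lambda>w. X w * Z w) * F w)"
proof -
  have t: "tame F" "tame F'" and
    eq: "\<And>S. S \<in> V \<Longrightarrow> expectation (\<lambda>w. X w * F w * exp (S w)) = expectation (\<lambda>w. X w * S w) *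
       expectation (\<lambda>w. F w * exp (S w)) + expectation (\<lambda>w. F' w * exp (S w))"
    using F by (auto simp: ibp_def)
  show ?thesis
    unfolding ibp_def
  proof (intro conjI ballI tame_add tame_scale tame_mult_V t Z)
    fix S assume S: "S \<in> V"
    define c where "c = expectation (\<lambda>w. X w * Z w)"
    define e where "e n = 1 / real (Suc n)" for n
    have e: "e n \<noteq> 0" for n by (simp add: e_def)
    have SZ: "(\<lambda>w. S w + e n * Z w) \<in> V" for n
      by (intro V_add V_scale S Z)
    define P where "P n = expectation (\<lambda>w. F w * exp (S w + e n * Z w))" for n
    define Q where "Q n = expectation (\<lambda>w. F' w * exp (S w + e n * Z w))" for n
    define P0 where "P0 = expectation (\<lambda>w. F w * exp (S w))"
    define Q0 where "Q0 = expectation (\<lambda>w. F' w * exp (S w))"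
    define b where "b = expectation (\<lambda>w. X w * S w)"
    define P1 where "P1 = expectation (\<lambda>w. Z w * F w * exp (S w))"
    define Q1 where "Q1 = expectation (\<lambda>w. Z w * F' w * exp (S w))"
    have dP: "(\<lambda>n. (P n - P0) / e n) \<longlonglongrightarrow> P1" and dQ: "(\<lambda>n. (Q n - Q0) / e n) \<longlonglongrightarrow> Q1"
      unfolding P_def Q_def P0_def Q0_def e_def P1_def Q1_def by (rule expectation_exp_derivative t S Z)+
    have e0: "e \<longlonglongrightarrow> 0" unfolding e_def using LIMSEQ_inverse_real_of_nat by (simp add: inverse_eq_divide)
    have "(\<lambda>n. (P n - P0) / e n * e n + P0) \<longlonglongrightarrow> P1 * 0 + P0"
      by (intro tendsto_intros dP e0)
    then have P: "P \<longlonglongrightarrow> P0" using e by simp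
    have lin: "expectation (\<lambda>w. X w * (S w + e n * Z w)) = b + e n * c" for n
      unfolding b_def c_def using integrable_mult_V[OF X S] integrable_mult_V[OF X Z]
      by (simp only: distrib_left mult.left_commute[of _ "e n"]) simp
    have "(\<lambda>n. (expectation (\<lambda>w. X w * F w * exp (S w + e n * Z w)) - expectation (\<lambda>w. X w * F w * exp (S w))) / e n)
        \<longlonglongrightarrow> expectation (\<lambda>w. Z w * (X w * F w) * exp (S w))"
      unfolding e_def by (intro expectation_exp_derivative tame_mult_V t X S Z)
    moreover have "(expectation (\<lambda>w. X w * F w * exp (S w + e n * Z w)) - expectation (\<lambda>w. X w * F w * exp (S w))) / e n
        = b * ((P n - P0) / e n) + c * P n + (Q n - Q0) / e n" for n
    proof -
      have "expectation (\<lambda>w. X w * F w * exp (S w + e n * Z w)) = (b + e n * c) * P n + Q n"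
        unfolding eq[OF SZ] lin P_def Q_def ..
      moreover have "expectation (\<lambda>w. X w * F w * exp (S w)) = b * P0 + Q0"
        unfolding eq[OF S] b_def P0_def Q0_def ..
      ultimately show ?thesis using e[of n] by (simp add: field_simps)
    qed
    moreover have "(\<lambda>n. b * ((P n - P0) / e n) + c * P n + (Q n - Q0) / e n) \<longlonglongrightarrow> b * P1 + c * P0 + Q1"
      by (intro tendsto_intros dP dQ P)
    ultimately have "expectation (\<lambda>w. Z w * (X w * F w) * exp (S w)) = b * P1 + c * P0 + Q1"
      by (auto intro: LIMSEQ_unique)
    moreover have "expectation (\<lambda>w. (Z w * F' w + c * F w) * exp (S w)) = Q1 + c * P0"
      unfolding Q1_def P0_def
      using tame_integrable_exp[OF tame_mult_V[OF t(2) Z] S] tame_integrable_exp[OF t(1) S]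
      by (simp add: distrib_right mult.assoc)
    ultimately show "expectation (\<lambda>w. X w * (Z w * F w) * exp (S w)) =
        expectation (\<lambda>w. X w * S w) * expectation (\<lambda>w. Z w * F w * exp (S w)) +
        expectation (\<lambda>w. (Z w * F' w + expectation (\<lambda>w. X w * Z w) * F w) * exp (S w))"
      by (simp flip: b_def c_def P1_def add: mult.left_commute)
  qed
qed

lemma ibp_expectation:
  assumes "ibp X F F'" "X \<in> V"
  shows "expectation (\<lambda>w. X w * F w) = expectation F'"
  using assms V_scale[of X 0] by (auto simp: ibp_def dest!: bspec[of _ _ "\<lambda>w. 0 * X w"])

text \<open>\<open>real n * hermite (n - 1)\<close> is the derivative of \<open>hermite n\<close>.
  The three-term recurrence reduces the claim to linearity and multiplication by \<open>Z\<close>.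
  At \<open>n = 0\<close> the truncated index is harmless because of the factor 0.\<close>

lemma ibp_hermite:
  assumes X: "X \<in> V" and Z: "Z \<in> V" and F: "ibp X F F'"
  shows "ibp X (\<lambda>w. hermite n (Z w) * F w)
    (\<lambda>w. hermite n (Z w) * F' w + expectation (\<lambda>w. X w * Z w) * (real n * hermite (n - 1) (Z w)) * F w)"
proof (induction n rule: induct_nat_012)
  case 0
  then show ?case using F by simp
next
  case 1
  then show ?case using ibp_mult_V[OF X Z F] by simp
next
  case (ge2 n)
  let ?c = "expectation (\<lambda>w. X w * Z w)"
  have "ibp X (\<lambda>w. Z w * (hermite (Suc n) (Z w) * F w) + - real (Suc n) * (hermite n (Z w) * F w))
   (\<lambda>w. (Z w * (hermite (Suc n) (Z w) * F' w + ?c * (real (Suc n) * hermite (Suc n - 1) (Z w)) * F w)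
        + ?c * (hermite (Suc n) (Z w) * F w))
      + - real (Suc n) * (hermite n (Z w) * F' w + ?c * (real n * hermite (n - 1) (Z w)) * F w))"
    by (intro ibp_add ibp_mult_V ibp_scale X Z ge2)
  moreover have "Z w * (hermite (Suc n) (Z w) * F w) + - real (Suc n) * (hermite n (Z w) * F w) =
      hermite (Suc (Suc n)) (Z w) * F w" for w
    by (simp add: algebra_simps)
  moreover have "Z w * (hermite (Suc n) (Z w) * F' w + ?c * (real (Suc n) * hermite (Suc n - 1) (Z w)) * F w)
        + ?c * (hermite (Suc n) (Z w) * F w)
      + - real (Suc n) * (hermite n (Z w) * F' w + ?c * (real n * hermite (n - 1) (Z w)) * F w) =
    hermite (Suc (Suc n)) (Z w) * F' w + ?c * (real (Suc (Suc n)) * hermite (Suc (Suc n) - 1) (Z w)) * F w" for w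
    by (cases n) (simp_all add: algebra_simps)
  ultimately show ?case by (simp only:)
qed

section \<open>Wick's formula for products of Hermite polynomials\<close>

definition cov :: "('w \<Rightarrow> real) \<Rightarrow> ('w \<Rightarrow> real) \<Rightarrow> real" where
  "cov S T = expectation (\<lambda>w. S w * T w)"

lemma ibp_prod_hermite:
  assumes X: "X \<in> V" and Z: "\<And>i. i \<in> A \<Longrightarrow> Z i \<in> V" and "finite A"
  shows "ibp X (\<lambda>w. \<Prod>i\<in>A. hermite (a i) (Z i w))
    (\<lambda>w. \<Sum>i\<in>A. cov X (Z i) * real (a i) * (\<Prod>l\<in>A. hermite (dec i a l) (Z l w)))"
  using \<open>finite A\<close> Z
proof (induction A rule: finite_induct)
  case empty
  then show ?case using ibp_const[OF X] by simp
next
  case (insert j A)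
  have e1: "(\<Prod>l\<in>insert j A. hermite (dec j a l) (Z l w)) =
      hermite (a j - 1) (Z j w) * (\<Prod>l\<in>A. hermite (a l) (Z l w))" for w
    using insert.hyps by (auto simp: dec_def intro!: prod.cong)
  have e2: "(\<Prod>l\<in>insert j A. hermite (dec i a l) (Z l w)) =
      hermite (a j) (Z j w) * (\<Prod>l\<in>A. hermite (dec i a l) (Z l w))" if "i \<in> A" for i w
  proof -
    have "j \<noteq> i" using that insert.hyps by auto
    then show ?thesis using insert.hyps by simp
  qed
  have "(\<Sum>i\<in>insert j A. cov X (Z i) * real (a i) * (\<Prod>l\<in>insert j A. hermite (dec i a l) (Z l w)))
     = hermite (a j) (Z j w) * (\<Sum>i\<in>A. cov X (Z i) * real (a i) * (\<Prod>l\<in>A. hermite (dec i a l) (Z l w)))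
     + cov X (Z j) * (real (a j) * hermite (a j - 1) (Z j w)) * (\<Prod>l\<in>A. hermite (a l) (Z l w))" for w
    unfolding sum.insert[OF insert.hyps] e1 sum_distrib_left
    using e2 by (simp add: mult_ac del: prod.insert cong: sum.cong)
  moreover have "ibp X (\<lambda>w. \<Prod>i\<in>A. hermite (a i) (Z i w))
    (\<lambda>w. \<Sum>i\<in>A. cov X (Z i) * real (a i) * (\<Prod>l\<in>A. hermite (dec i a l) (Z l w)))"
    using insert by auto
  ultimately show ?case
    using ibp_hermite[OF X, of "Z j" "\<lambda>w. \<Prod>i\<in>A. hermite (a i) (Z i w)"
      "\<lambda>w. \<Sum>i\<in>A. cov X (Z i) * real (a i) * (\<Prod>l\<in>A. hermite (dec i a l) (Z l w))" "a j"]
      insert.hyps insert.prems by (simp flip: cov_def)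
qed

lemma tame_prod_hermite:
  assumes "\<And>i. i \<in> A \<Longrightarrow> Z i \<in> V" and "finite A"
  shows "tame (\<lambda>w. \<Prod>i\<in>A. hermite (a i) (Z i w))"
proof (cases "A = {}")
  case True
  then show ?thesis using tame_const[of 1] by simp
next
  case False
  then show ?thesis using ibp_prod_hermite[of _ A Z a] assms unfolding ibp_def by blast
qed

lemma integrable_prod_hermite:
  assumes "\<And>i. i \<in> A \<Longrightarrow> Z i \<in> V" and "finite A"
  shows "integrable M (\<lambda>w. \<Prod>i\<in>A. hermite (a i) (Z i w))"
proof (cases "A = {}")
  case False
  then obtain i where "i \<in> A" by blast
  then show ?thesis using assms by (intro tame_integrable[of _ "Z i"] tame_prod_hermite) auto
qed simp

text \<open>One factor \<open>Z i\<close> is split off by the recurrence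
  \<open>hermite (Suc n) z = z * hermite n z - n * hermite (n - 1) z\<close> and integrated by
  parts. Since \<open>Z i\<close> has unit variance, the diagonal term of the integration by parts
  cancels the subtracted term exactly; this is why the contractions have no loops. The other terms
  are the recursion of \<open>wick\<close>.\<close>

theorem expectation_prod_hermite:
  assumes "\<And>i. i \<in> set is \<Longrightarrow> Z i \<in> V" "\<And>i. i \<in> set is \<Longrightarrow> cov (Z i) (Z i) = 1" "distinct is"
  shows "expectation (\<lambda>w. \<Prod>i\<in>set is. hermite (a i) (Z i w)) = wick (\<lambda>i j. cov (Z i) (Z j)) a is"
  using assms
proof (induction a "is" rule: wick_induct)
  case (Nil a)
  then show ?case by (simp add: prob_space)
next
  case (zero a i "is")
  then show ?case by (simp add: wick_Cons_0)
next
  case (pos a i "is")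
  define A where "A = set (i # is)"
  have A: "finite A" "i \<in> A" "A = insert i (set is)" "i \<notin> set is" and Z: "\<And>j. j \<in> A \<Longrightarrow> Z j \<in> V"
    using pos.prems by (auto simp: A_def)
  define b where "b = dec i a"
  obtain n where n: "a i = Suc n" using pos.hyps(1) by (cases "a i") auto
  have b: "b i = n" "\<And>j. j \<noteq> i \<Longrightarrow> b j = a j" by (auto simp: b_def n)
  define G where "G c w = (\<Prod>l\<in>A. hermite (c l) (Z l w))" for c w
  have intG: "integrable M (G c)" for c
    unfolding G_def using Z A(1) by (intro integrable_prod_hermite) auto
  have split: "G c w = hermite (c i) (Z i w) * (\<Prod>l\<in>set is. hermite (c l) (Z l w))" for c w
    using A by (simp add: G_def)
  have G: "G a w = Z i w * G b w - real n * G (dec i b) w" for w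
  proof -
    define P where "P = (\<Prod>l\<in>set is. hermite (a l) (Z l w))"
    have "(\<Prod>l\<in>set is. hermite (b l) (Z l w)) = P" "(\<Prod>l\<in>set is. hermite (dec i b l) (Z l w)) = P"
      unfolding P_def using A(4) by (auto simp: b_def dec_def intro!: prod.cong)
    moreover have "hermite (Suc n) (Z i w) = Z i w * hermite n (Z i w) - real n * hermite (n - 1) (Z i w)"
      by (cases n) auto
    ultimately show ?thesis
      by (simp only: split n b(1) dec_same flip: P_def) (simp add: algebra_simps)
  qed
  have ibp: "ibp (Z i) (G b) (\<lambda>w. \<Sum>j\<in>A. cov (Z i) (Z j) * real (b j) * G (dec j b) w)"
    unfolding G_def by (rule ibp_prod_hermite[OF Z[OF A(2)] Z A(1)])
  have "expectation (\<lambda>w. Z i w * G b w) = (\<Sum>j\<in>A. cov (Z i) (Z j) * real (b j) * expectation (G (dec j b)))"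
    unfolding ibp_expectation[OF ibp Z[OF A(2)]] using intG by simp
  also have "\<dots> = real n * expectation (G (dec i b)) +
      (\<Sum>j\<in>set is. cov (Z i) (Z j) * real (a j) * expectation (G (dec i (dec j a))))"
  proof -
    have "dec j b = dec i (dec j a)" "b j = a j" if "j \<in> set is" for j
      using that A(4) by (auto simp: b_def dec_def fun_upd_twist)
    then show ?thesis
      using A pos.prems(2)[of i] b by simp
  qed
  also have "(\<Sum>j\<in>set is. cov (Z i) (Z j) * real (a j) * expectation (G (dec i (dec j a)))) =
     wick (\<lambda>i j. cov (Z i) (Z j)) a (i # is)"
    unfolding wick_Cons_Suc[of a i, OF pos.hyps(1)]
  proof (intro sum.cong refl arg_cong2[where f = "(*)"])
    fix j assume "j \<in> set is"
    then show "expectation (G (dec i (dec j a))) = wick (\<lambda>i j. cov (Z i) (Z j)) (dec i (dec j a)) (i # is)"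
      unfolding G_def[abs_def] A_def by (rule pos.IH) (use pos.prems in auto)
  qed
  finally have "expectation (\<lambda>w. Z i w * G b w) - real n * expectation (G (dec i b)) =
      wick (\<lambda>i j. cov (Z i) (Z j)) a (i # is)" by simp
  moreover have "integrable M (\<lambda>w. Z i w * G b w)"
    using tame_integrable[OF tame_mult_V[OF tame_prod_hermite[of A Z b] Z[OF A(2)]] Z[OF A(2)]] Z A(1)
    by (simp add: G_def)
  moreover have "G a = (\<lambda>w. Z i w * G b w - real n * G (dec i b) w)"
    using G by auto
  ultimately have "expectation (G a) = wick (\<lambda>i j. cov (Z i) (Z j)) a (i # is)"
    using intG[of "dec i b"] by (simp only:) simp
  then show ?case by (simp only: G_def[abs_def] A_def)
qed

end

section \<open>Integrals of contractions\<close>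

text \<open>Jensen's inequality for \<open>exp\<close> at the points \<open>q * ln (x l)\<close>
  with the weights \<open>e l / q\<close>.\<close>

lemma weighted_am_gm:
  fixes x :: "'i \<Rightarrow> real"
  assumes A: "finite A" and e: "(\<Sum>l\<in>A. e l) = q" and q: "0 < q" and x: "\<And>l. l \<in> A \<Longrightarrow> 0 < x l"
  shows "(\<Prod>l\<in>A. x l ^ e l) \<le> (\<Sum>l\<in>A. real (e l) / real q * x l ^ q)"
proof -
  have "A \<noteq> {}" using e q by auto
  have "(\<Prod>l\<in>A. x l ^ e l) = (\<Prod>l\<in>A. exp (real (e l) * ln (x l)))"
    using x by (intro prod.cong refl) (simp add: exp_of_nat_mult)
  also have "\<dots> = exp (\<Sum>l\<in>A. real (e l) * ln (x l))"
    using A by (simp add: exp_sum)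
  also have "(\<Sum>l\<in>A. real (e l) * ln (x l)) = (\<Sum>l\<in>A. (real (e l) / real q) *\<^sub>R (real q * ln (x l)))"
    using q by (intro sum.cong refl) simp
  also have "exp \<dots> \<le> (\<Sum>l\<in>A. real (e l) / real q * exp (real q * ln (x l)))"
  proof (rule convex_on_sum[OF A \<open>A \<noteq> {}\<close> exp_convex])
    show "(\<Sum>l\<in>A. real (e l) / real q) = 1"
      using e q by (simp flip: sum_divide_distrib of_nat_sum)
  qed auto
  also have "\<dots> = (\<Sum>l\<in>A. real (e l) / real q * x l ^ q)"
    using x by (intro sum.cong refl) (simp add: exp_of_nat_mult)
  finally show ?thesis .
qed

text \<open>Dividing each \<open>h l\<close> by \<open>H l\<close> reduces the claim to the
  pointwise inequality between arithmetic and geometric means. \<open>H l\<close> need only be an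
  upper bound for the norm, which allows exponents \<open>e l = 0\<close> without a case
  distinction.\<close>

lemma (in sigma_finite_measure) nn_integral_holder:
  fixes h :: "'i \<Rightarrow> 'a \<Rightarrow> real"
  assumes A: "finite A" and e: "(\<Sum>l\<in>A. e l) = q" and q: "0 < q"
    and h [measurable]: "\<And>l. l \<in> A \<Longrightarrow> h l \<in> borel_measurable M"
    and pos: "\<And>l y. l \<in> A \<Longrightarrow> 0 < h l y" "\<And>l. l \<in> A \<Longrightarrow> 0 < H l"
    and int: "\<And>l. l \<in> A \<Longrightarrow> (\<integral>\<^sup>+y. ennreal (h l y ^ q) \<partial>M) \<le> ennreal (H l ^ q)"
  shows "(\<integral>\<^sup>+y. ennreal (\<Prod>l\<in>A. h l y ^ e l) \<partial>M) \<le> ennreal (\<Prod>l\<in>A. H l ^ e l)"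
proof -
  define P where "P = (\<Prod>l\<in>A. H l ^ e l)"
  have P: "0 < P" unfolding P_def using pos(2) by (intro prod_pos) auto
  define w where "w l = P * (real (e l) / real q) / H l ^ q" for l
  have w: "0 \<le> w l" if "l \<in> A" for l
    unfolding w_def using P pos(2)[OF that] q by (auto intro!: divide_nonneg_pos)
  have "(\<integral>\<^sup>+y. ennreal (\<Prod>l\<in>A. h l y ^ e l) \<partial>M) \<le> (\<integral>\<^sup>+y. (\<Sum>l\<in>A. ennreal (w l) * ennreal (h l y ^ q)) \<partial>M)"
  proof (rule nn_integral_mono)
    fix y
    have "(\<Prod>l\<in>A. h l y ^ e l) = P * (\<Prod>l\<in>A. (h l y / H l) ^ e l)"
      unfolding P_def prod.distrib[symmetric] using pos(2)
      by (intro prod.cong refl) (simp add: power_divide less_imp_neq[symmetric])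
    also have "\<dots> \<le> P * (\<Sum>l\<in>A. real (e l) / real q * (h l y / H l) ^ q)"
      using P pos by (intro mult_left_mono weighted_am_gm[OF A e q]) auto
    also have "\<dots> = (\<Sum>l\<in>A. w l * h l y ^ q)"
      unfolding sum_distrib_left w_def by (intro sum.cong refl) (simp add: power_divide)
    finally have "ennreal (\<Prod>l\<in>A. h l y ^ e l) \<le> ennreal (\<Sum>l\<in>A. w l * h l y ^ q)"
      by (rule ennreal_leI)
    also have "\<dots> = (\<Sum>l\<in>A. ennreal (w l) * ennreal (h l y ^ q))"
      using w pos(1) by (subst sum_ennreal[symmetric]) (auto simp: ennreal_mult less_imp_le intro!: mult_nonneg_nonneg)
    finally show "ennreal (\<Prod>l\<in>A. h l y ^ e l) \<le> (\<Sum>l\<in>A. ennreal (w l) * ennreal (h l y ^ q))" .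
  qed
  also have "\<dots> = (\<Sum>l\<in>A. ennreal (w l) * (\<integral>\<^sup>+y. ennreal (h l y ^ q) \<partial>M))"
    by (subst nn_integral_sum) (auto simp: nn_integral_cmult)
  also have "\<dots> \<le> (\<Sum>l\<in>A. ennreal (w l) * ennreal (H l ^ q))"
    by (intro sum_mono mult_left_mono int) auto
  also have "\<dots> = ennreal (\<Sum>l\<in>A. w l * H l ^ q)"
    using w pos(2) by (subst sum_ennreal[symmetric]) (auto simp: ennreal_mult less_imp_le intro!: mult_nonneg_nonneg)
  also have "(\<Sum>l\<in>A. w l * H l ^ q) = (\<Sum>l\<in>A. P * (real (e l) / real q))"
    unfolding w_def using pos(2) by (intro sum.cong refl) (auto simp: less_imp_neq[symmetric])
  also have "\<dots> = P"
    using e q by (simp flip: sum_distrib_left sum_divide_distrib of_nat_sum)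
  finally show ?thesis unfolding P_def .
qed

text \<open>This is also the number of perfect matchings of \<open>n\<close> points: the recursion
  chooses the partner of one of them.\<close>

fun gaussian_moment :: "nat \<Rightarrow> real" where
  "gaussian_moment 0 = 1"
| "gaussian_moment (Suc 0) = 0"
| "gaussian_moment (Suc (Suc n)) = real (Suc n) * gaussian_moment n"

lemma gaussian_moment_nonneg: "0 \<le> gaussian_moment n"
  by (induction n rule: gaussian_moment.induct) auto

lemma pairing_cong:
  assumes "\<And>i j. i \<in> set is \<Longrightarrow> j \<in> set is \<Longrightarrow> c i j = c' i j"
  shows "pairing q c is = pairing q c' is"
  using assms
proof (induction q c "is" rule: pairing.induct)
  case (2 q c i "is")
  have "pairing q c (remove1 j is) = pairing q c' (remove1 j is)" if "j \<in> set is" for j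
    using 2(1)[OF that] 2(2) notin_set_remove1 by (metis list.set_intros(2))
  with 2(2) show ?case by (auto intro!: sum.cong)
qed simp

lemma pairing_nonneg:
  assumes "\<And>i j. 0 \<le> c i j"
  shows "0 \<le> pairing q c is"
  using assms by (induction q c "is" rule: pairing.induct) (auto intro!: sum_nonneg)

text \<open>The bound \<open>B\<close> provides integrability. It is a parameter because kernels are
  later divided by a constant to reach unit energy.\<close>

locale positive_kernel = prob_space \<nu> for \<nu> :: "'u measure" +
  fixes k :: "'u \<Rightarrow> 'u \<Rightarrow> real" and B :: real
  assumes k_measurable [measurable]: "(\<lambda>(u, v). k u v) \<in> borel_measurable (\<nu> \<Otimes>\<^sub>M \<nu>)"
    and space_UNIV [simp]: "space \<nu> = UNIV"
    and k_pos: "0 < k u v"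
    and k_sym: "k u v = k v u"
    and k_le: "k u v \<le> B"
begin

lemma k_measurable' [measurable (raw)]:
  assumes "f \<in> measurable N \<nu>" "g \<in> measurable N \<nu>"
  shows "(\<lambda>x. k (f x) (g x)) \<in> borel_measurable N"
  using measurable_compose[OF measurable_Pair[OF assms] k_measurable] by simp

sublocale pr: product_sigma_finite "\<lambda>_. \<nu>"
  by unfold_locales

abbreviation prod_space :: "'i set \<Rightarrow> ('i \<Rightarrow> 'u) measure" where
  "prod_space I \<equiv> PiM I (\<lambda>_. \<nu>)"

lemma prob_space_prod_space: "prob_space (prod_space I)"
  by (rule prob_space_PiM) unfold_locales

lemma wick_measurable [measurable]:
  "set is \<subseteq> I \<Longrightarrow> (\<lambda>x. wick (\<lambda>i j. k (x i) (x j)) a is) \<in> borel_measurable (prod_space I)"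
proof (induction a "is" rule: wick_induct)
  case (pos a i "is")
  have [measurable]: "(\<lambda>x. x i) \<in> measurable (prod_space I) \<nu>"
    using pos.prems by (intro measurable_component_singleton) auto
  have [measurable]: "(\<lambda>x. x j) \<in> measurable (prod_space I) \<nu>" if "j \<in> set is" for j
    using pos.prems that by (intro measurable_component_singleton) auto
  show ?case
    unfolding wick_Cons_Suc[of a i, OF pos.hyps(1)] using pos.IH pos.prems by measurable
qed (auto simp: wick_Cons_0)

lemma pairing_measurable [measurable]:
  "set is \<subseteq> I \<Longrightarrow> (\<lambda>x. pairing q (\<lambda>i j. k (x i) (x j)) is) \<in> borel_measurable (prod_space I)"
proof (induction "length is" arbitrary: "is" rule: less_induct)
  case less
  show ?case
  proof (cases "is")
    case (Cons i js)
    have [measurable]: "(\<lambda>x. x i) \<in> measurable (prod_space I) \<nu>"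
      using less.prems Cons by (intro measurable_component_singleton) auto
    have [measurable]: "(\<lambda>x. x j) \<in> measurable (prod_space I) \<nu>" if "j \<in> set js" for j
      using less.prems Cons that by (intro measurable_component_singleton) auto
    have [measurable]: "(\<lambda>x. pairing q (\<lambda>i j. k (x i) (x j)) (remove1 j js)) \<in> borel_measurable (prod_space I)"
      if "j \<in> set js" for j
      using less.prems Cons that set_remove1_subset[of j js]
      by (intro less.hyps) (auto simp: length_remove1 less_Suc_eq_le)
    show ?thesis unfolding Cons pairing.simps by measurable
  qed simp
qed

lemma integrable_wick:
  assumes "set is \<subseteq> I"
  shows "integrable (prod_space I) (\<lambda>x. wick (\<lambda>i j. k (x i) (x j)) a is)"
proof -
  interpret I: prob_space "prod_space I" by (rule prob_space_prod_space)
  obtain N where N: "posynomial N (\<lambda>c. wick c a is)"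
    using posynomial_wick by (rule exE)
  show ?thesis
  proof (rule I.integrable_const_bound)
    have "norm (wick (\<lambda>i j. k (x i) (x j)) a is) \<le> max 1 B ^ N * wick (\<lambda>_ _. 1) a is" for x
      using posynomial_le[OF N, of "max 1 B" "\<lambda>i j. k (x i) (x j)" "\<lambda>_ _. 1"]
        wick_nonneg[of "is" "\<lambda>i j. k (x i) (x j)" a] k_pos k_le
      by (auto simp: less_imp_le le_max_iff_disj)
    then show "AE x in prod_space I. norm (wick (\<lambda>i j. k (x i) (x j)) a is) \<le> max 1 B ^ N * wick (\<lambda>_ _. 1) a is"
      by simp
  qed (use assms in measurable)
qed

definition energy :: "nat \<Rightarrow> real" where
  "energy q = (\<integral>u. \<integral>v. k v u ^ q \<partial>\<nu> \<partial>\<nu>)"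

definition row :: "nat \<Rightarrow> 'u \<Rightarrow> real" where
  "row q u = (\<integral>v. k v u ^ q \<partial>\<nu>)"

lemma row_measurable [measurable]: "row q \<in> borel_measurable \<nu>"
  unfolding row_def[abs_def] by measurable

lemma integrable_k_power: "integrable \<nu> (\<lambda>v. k v u ^ q)"
proof (rule integrable_const_bound[of _ "B ^ q"])
  show "AE v in \<nu>. norm (k v u ^ q) \<le> B ^ q"
    using k_pos k_le by (auto intro!: power_mono simp: less_imp_le)
qed measurable

lemma nn_integral_k_power: "(\<integral>\<^sup>+v. ennreal (k v u ^ q) \<partial>\<nu>) = ennreal (row q u)"
  unfolding row_def using k_pos
  by (intro nn_integral_eq_integral integrable_k_power) (auto simp: less_imp_le)

lemma row_pos: "0 < row q u"
  unfolding row_def using k_pos by (intro expectation_greater integrable_k_power) auto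

lemma row_le: "row q u \<le> B ^ q"
  unfolding row_def using k_pos k_le
  by (intro integral_le_const integrable_k_power) (auto intro!: power_mono simp: less_imp_le)

lemma integrable_row: "integrable \<nu> (row q)"
  using row_pos row_le by (intro integrable_const_bound[of _ "B ^ q"]) (auto simp: less_imp_le)

lemma energy_eq: "energy q = integral\<^sup>L \<nu> (row q)"
  unfolding energy_def row_def ..

lemma nn_integral_row: "(\<integral>\<^sup>+u. ennreal (row q u) \<partial>\<nu>) = ennreal (energy q)"
  unfolding energy_eq using row_pos
  by (intro nn_integral_eq_integral integrable_row) (auto simp: less_imp_le)

lemma energy_pos: "0 < energy q"
  unfolding energy_eq using row_pos by (intro expectation_greater integrable_row) auto

lemma wick_update:
  "i \<notin> set is \<Longrightarrow> wick (\<lambda>l j. k ((x(i := y)) l) ((x(i := y)) j)) a is = wick (\<lambda>l j. k (x l) (x j)) a is"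
  by (rule wick_cong) auto

lemma pairing_update:
  "i \<notin> set is \<Longrightarrow> pairing q (\<lambda>l j. k ((x(i := y)) l) ((x(i := y)) j)) is = pairing q (\<lambda>l j. k (x l) (x j)) is"
  by (rule pairing_cong) auto

text \<open>The pairs of a matching involve disjoint variables, so each contributes
  \<open>fact q * energy q\<close>, and \<open>gaussian_moment\<close> counts the matchings. The
  square root assigns one factor to each point instead of each pair; for an odd number of points
  both sides vanish.\<close>

lemma nn_integral_pairing:
  "distinct is \<Longrightarrow> (\<integral>\<^sup>+x. ennreal (pairing q (\<lambda>i j. k (x i) (x j)) is) \<partial>prod_space (set is)) =
     ennreal (gaussian_moment (length is) * sqrt (fact q * energy q) ^ length is)"
proof (induction "length is" arbitrary: "is" rule: less_induct)
  case less
  show ?case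
  proof (cases "is")
    case Nil
    then show ?thesis by (simp add: PiM_empty nn_integral_count_space_finite)
  next
    case (Cons i js)
    define J where "J = set js"
    define F where "F j x = pairing q (\<lambda>i j. k (x i) (x j)) (remove1 j js)" for j and x :: "'a \<Rightarrow> 'u"
    have ij: "i \<notin> J" "finite J" "distinct js" using less.prems Cons by (auto simp: J_def)
    have F0: "0 \<le> F j x" for j x
      unfolding F_def using k_pos by (intro pairing_nonneg) (auto simp: less_imp_le)
    have rem: "set (remove1 j js) = J - {j}" for j using ij by (simp add: J_def set_remove1_eq)
    have Fm [measurable]: "F j \<in> borel_measurable (prod_space I)" if "J - {j} \<subseteq> I" for I j
      unfolding F_def[abs_def] by (rule pairing_measurable) (use that rem in auto)
    have [measurable]: "(\<lambda>x. x j) \<in> measurable (prod_space I) \<nu>" if "j \<in> I" for j I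
      using that by (intro measurable_component_singleton)
    have Fm1 [measurable]: "F j \<in> borel_measurable (prod_space (insert i J))"
      and Fm2 [measurable]: "F j \<in> borel_measurable (prod_space (insert j (J - {j})))" for j
      by (auto intro!: Fm)
    have Fi: "F j (x(i := y)) = F j x" for j x y
      unfolding F_def by (rule pairing_update) (use ij rem in auto)
    have Fj: "F j (x(j := y)) = F j x" for j x y
      unfolding F_def by (rule pairing_update) (use rem in auto)
    \<comment> \<open>Integrating out \<open>x i\<close> leaves \<open>row q (x j)\<close>, and
      integrating out \<open>x j\<close> turns this into \<open>energy q\<close>; \<open>F j\<close>
      depends on neither variable.\<close>
    have one: "(\<integral>\<^sup>+x. ennreal (fact q * k (x i) (x j) ^ q * F j x) \<partial>prod_space (insert i J)) =
        ennreal (fact q * energy q) * ennreal (gaussian_moment (length js - 1) * sqrt (fact q * energy q) ^ (length js - 1))"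
      if j: "j \<in> J" for j
    proof -
      have J: "insert j (J - {j}) = J" using j by auto
      have "(\<integral>\<^sup>+x. ennreal (fact q * k (x i) (x j) ^ q * F j x) \<partial>prod_space (insert i J)) =
        (\<integral>\<^sup>+x. \<integral>\<^sup>+y. ennreal (fact q * k ((x(i := y)) i) ((x(i := y)) j) ^ q * F j (x(i := y))) \<partial>\<nu> \<partial>prod_space J)"
        using j ij by (intro pr.product_nn_integral_insert) (measurable, auto)
      also have "\<dots> = (\<integral>\<^sup>+x. \<integral>\<^sup>+y. ennreal (fact q * F j x) * ennreal (k y (x j) ^ q) \<partial>\<nu> \<partial>prod_space J)"
        using j ij F0 k_pos
        by (intro nn_integral_cong) (auto simp: Fi ennreal_mult'[symmetric] mult_ac)
      also have "\<dots> = (\<integral>\<^sup>+x. ennreal (fact q * F j x) * ennreal (row q (x j)) \<partial>prod_space J)"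
        by (intro nn_integral_cong) (simp add: nn_integral_cmult nn_integral_k_power)
      also have "\<dots> = (\<integral>\<^sup>+x. ennreal (fact q * F j x) * ennreal (row q (x j)) \<partial>prod_space (insert j (J - {j})))"
        by (simp only: J)
      also have "\<dots> = (\<integral>\<^sup>+x. \<integral>\<^sup>+y. ennreal (fact q * F j (x(j := y))) * ennreal (row q ((x(j := y)) j)) \<partial>\<nu> \<partial>prod_space (J - {j}))"
        using ij by (intro pr.product_nn_integral_insert; (simp; fail)?) measurable
      also have "\<dots> = (\<integral>\<^sup>+x. ennreal (fact q * energy q) * ennreal (F j x) \<partial>prod_space (J - {j}))"
      proof (intro nn_integral_cong)
        fix x
        have "(\<integral>\<^sup>+y. ennreal (fact q * F j (x(j := y))) * ennreal (row q ((x(j := y)) j)) \<partial>\<nu>) =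
            ennreal (fact q * F j x) * ennreal (energy q)"
          unfolding Fj fun_upd_same by (subst nn_integral_cmult) (auto simp: nn_integral_row)
        then show "(\<integral>\<^sup>+y. ennreal (fact q * F j (x(j := y))) * ennreal (row q ((x(j := y)) j)) \<partial>\<nu>) =
            ennreal (fact q * energy q) * ennreal (F j x)"
          using F0[of j x] energy_pos[of q] by (simp add: ennreal_mult[symmetric] mult_ac less_imp_le)
      qed
      also have "\<dots> = ennreal (fact q * energy q) * (\<integral>\<^sup>+x. ennreal (F j x) \<partial>prod_space (J - {j}))"
        by (rule nn_integral_cmult) measurable
      also have "(\<integral>\<^sup>+x. ennreal (F j x) \<partial>prod_space (J - {j})) =
          ennreal (gaussian_moment (length js - 1) * sqrt (fact q * energy q) ^ (length js - 1))"
        using less.hyps[of "remove1 j js"] ij j Cons unfolding F_def rem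
        by (auto simp: length_remove1 J_def)
      finally show ?thesis .
    qed
    have "(\<integral>\<^sup>+x. ennreal (pairing q (\<lambda>i j. k (x i) (x j)) is) \<partial>prod_space (set is)) =
       (\<integral>\<^sup>+x. (\<Sum>j\<in>J. ennreal (fact q * k (x i) (x j) ^ q * F j x)) \<partial>prod_space (insert i J))"
    proof -
      have "ennreal (pairing q (\<lambda>i j. k (x i) (x j)) is) = (\<Sum>j\<in>J. ennreal (fact q * k (x i) (x j) ^ q * F j x))" for x
        unfolding Cons pairing.simps F_def[symmetric] J_def[symmetric] using F0 k_pos
        by (subst sum_ennreal) (auto intro!: mult_nonneg_nonneg simp: less_imp_le)
      then show ?thesis by (simp add: Cons J_def)
    qed
    also have "\<dots> = (\<Sum>j\<in>J. \<integral>\<^sup>+x. ennreal (fact q * k (x i) (x j) ^ q * F j x) \<partial>prod_space (insert i J))"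
      using ij by (intro nn_integral_sum) (measurable, auto)
    also have "\<dots> = (\<Sum>j\<in>J. ennreal (fact q * energy q) * ennreal (gaussian_moment (length js - 1) * sqrt (fact q * energy q) ^ (length js - 1)))"
      using one by simp
    also have "\<dots> = ennreal (gaussian_moment (length is) * sqrt (fact q * energy q) ^ length is)"
    proof (cases js)
      case (Cons j js')
      define T where "T = sqrt (fact q * energy q)"
      have T: "0 \<le> T" "fact q * energy q = T * T"
        using energy_pos[of q] by (auto simp: T_def)
      define c where "c = gaussian_moment (length js') * T ^ length js'"
      have c: "0 \<le> c" unfolding c_def using T gaussian_moment_nonneg by simp
      have "(\<Sum>j\<in>J. ennreal (T * T) * ennreal c) = ennreal (\<Sum>j\<in>J. T * T * c)"
        using c T by (simp add: ennreal_mult[symmetric] sum_ennreal del: sum_constant)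
      also have "(\<Sum>j\<in>J. T * T * c) = gaussian_moment (length is) * T ^ length is"
        using \<open>is = i # js\<close> Cons ij by (simp add: c_def J_def distinct_card)
      finally show ?thesis
        unfolding T_def[symmetric] T(2) c_def using Cons T(1) by simp
    qed (simp add: Cons J_def)
    finally show ?thesis .
  qed
qed

text \<open>The vertices are integrated out one after the other. Among the \<open>q\<close> half-edges at a vertex \<open>j\<close>,
  \<open>a j\<close> are still to be contracted, \<open>n j\<close> are joined to the current vertex \<open>i\<close>, and \<open>b j\<close> are joined to
  vertices already integrated out; by Hoelder's inequality each of these last ones has left a
  factor \<open>root q (row q (x j))\<close>, whose \<open>q\<close>-th power has integral \<open>1\<close>.\<close>

lemma nn_integral_wick_le_aux:
  fixes a b n :: "'i \<Rightarrow> nat"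
  assumes energy: "energy q = 1" and q: "0 < q" and "distinct is"
    and "case is of [] \<Rightarrow> True | i # js \<Rightarrow>
      a i + b i + (\<Sum>j\<in>set js. n j) = q \<and> (\<forall>j\<in>set js. a j + b j + n j = q)"
  shows "case is of [] \<Rightarrow> True | i # js \<Rightarrow>
     (\<integral>\<^sup>+x. ennreal ((\<Prod>j\<in>set is. root q (row q (x j)) ^ b j) * (\<Prod>j\<in>set js. k (x i) (x j) ^ n j)
        * wick (\<lambda>i j. k (x i) (x j)) a is) \<partial>prod_space (set is)) \<le> ennreal (wick (\<lambda>_ _. 1) a is)"
  using assms(3,4)
proof (induction a "is" arbitrary: b n rule: wick_induct)
  case (zero a i js)
  define g where "g u = root q (row q u)" for u
  have g [measurable]: "g \<in> borel_measurable \<nu>" unfolding g_def[abs_def] by measurable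
  have g_pos: "0 < g u" and g_pow: "g u ^ q = row q u" for u
    unfolding g_def using q row_pos[of q u] by (auto simp: less_imp_le)
  have ij: "i \<notin> set js" "distinct js" using zero.prems by auto
  define R where "R b x = (\<Prod>j\<in>set js. g (x j) ^ b j) * wick (\<lambda>i j. k (x i) (x j)) a js" for b x
  have R0: "0 \<le> R b x" for b x unfolding R_def using g_pos k_pos
    by (intro mult_nonneg_nonneg prod_nonneg wick_nonneg) (auto simp: less_imp_le)
  have [measurable]: "(\<lambda>x. x j) \<in> measurable (prod_space I) \<nu>" if "j \<in> I" for j I
    using that by (intro measurable_component_singleton)
  have Rm [measurable]: "R b \<in> borel_measurable (prod_space (set js))" for b
    unfolding R_def[abs_def] by measurable
  \<comment> \<open>Hoelder's inequality in the variable \<open>x i\<close>: as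
    \<open>a i = 0\<close>, the exponents \<open>b i\<close> of \<open>g\<close> and
    \<open>n l\<close> of \<open>k y (x l)\<close> add up to \<open>q\<close>. The
    \<open>q\<close>-th norm of \<open>g\<close> is 1 by unit energy, and that of the kernel is
    \<open>g (x l)\<close>.\<close>
  let ?h = "\<lambda>x l y. if l = i then g y else k y (x l)"
  let ?H = "\<lambda>x l. if l = i then 1 else g (x l)"
  let ?e = "\<lambda>l. if l = i then b i else n l"
  have "(\<integral>\<^sup>+x. ennreal ((\<Prod>j\<in>set (i # js). g (x j) ^ b j) * (\<Prod>j\<in>set js. k (x i) (x j) ^ n j)
        * wick (\<lambda>i j. k (x i) (x j)) a (i # js)) \<partial>prod_space (insert i (set js))) =
     (\<integral>\<^sup>+x. \<integral>\<^sup>+y. ennreal ((\<Prod>j\<in>set (i # js). g ((x(i := y)) j) ^ b j) * (\<Prod>j\<in>set js. k ((x(i := y)) i) ((x(i := y)) j) ^ n j)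
        * wick (\<lambda>l j. k ((x(i := y)) l) ((x(i := y)) j)) a (i # js)) \<partial>\<nu> \<partial>prod_space (set js))"
  proof (rule pr.product_nn_integral_insert)
    have w: "(\<lambda>x. wick (\<lambda>i j. k (x i) (x j)) a (i # js)) \<in> borel_measurable (prod_space (insert i (set js)))"
      by (rule wick_measurable) simp
    show "(\<lambda>x. ennreal ((\<Prod>j\<in>set (i # js). g (x j) ^ b j) * (\<Prod>j\<in>set js. k (x i) (x j) ^ n j)
        * wick (\<lambda>i j. k (x i) (x j)) a (i # js))) \<in> borel_measurable (prod_space (insert i (set js)))"
      by (intro measurable_compose[OF _ measurable_ennreal] borel_measurable_times borel_measurable_prod
          borel_measurable_power w measurable_compose[OF _ g] k_measurable' measurable_component_singleton) auto
  qed (use ij in auto)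
  also have "\<dots> = (\<integral>\<^sup>+x. \<integral>\<^sup>+y. ennreal (R b x) * ennreal (\<Prod>l\<in>insert i (set js). ?h x l y ^ ?e l) \<partial>\<nu> \<partial>prod_space (set js))"
  proof (intro nn_integral_cong)
    fix x y
    have ne: "j \<noteq> i" if "j \<in> set js" for j using ij that by auto
    have "(\<Prod>j\<in>set (i # js). g ((x(i := y)) j) ^ b j) = g y ^ b i * (\<Prod>j\<in>set js. g (x j) ^ b j)"
      using ij by (simp add: ne cong: prod.cong)
    moreover have "(\<Prod>j\<in>set js. k ((x(i := y)) i) ((x(i := y)) j) ^ n j) = (\<Prod>j\<in>set js. k y (x j) ^ n j)"
      using ij by (simp add: ne cong: prod.cong)
    moreover have "(\<Prod>l\<in>insert i (set js). ?h x l y ^ ?e l) = g y ^ b i * (\<Prod>j\<in>set js. k y (x j) ^ n j)"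
      using ij by (simp add: ne cong: prod.cong)
    moreover have "wick (\<lambda>l j. k ((x(i := y)) l) ((x(i := y)) j)) a (i # js) = wick (\<lambda>l j. k (x l) (x j)) a js"
      unfolding wick_Cons_0[of a i, OF zero.hyps] using ij(1) by (rule wick_update)
    moreover have "0 \<le> g y ^ b i * (\<Prod>j\<in>set js. k y (x j) ^ n j)"
      using g_pos k_pos by (intro mult_nonneg_nonneg prod_nonneg) (auto simp: less_imp_le)
    ultimately show "ennreal ((\<Prod>j\<in>set (i # js). g ((x(i := y)) j) ^ b j) * (\<Prod>j\<in>set js. k ((x(i := y)) i) ((x(i := y)) j) ^ n j)
        * wick (\<lambda>l j. k ((x(i := y)) l) ((x(i := y)) j)) a (i # js)) =
       ennreal (R b x) * ennreal (\<Prod>l\<in>insert i (set js). ?h x l y ^ ?e l)"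
      using R0 by (simp only: ennreal_mult[symmetric] R_def) (simp add: mult_ac)
  qed
  also have "\<dots> = (\<integral>\<^sup>+x. ennreal (R b x) * (\<integral>\<^sup>+y. ennreal (\<Prod>l\<in>insert i (set js). ?h x l y ^ ?e l) \<partial>\<nu>) \<partial>prod_space (set js))"
    by (intro nn_integral_cong nn_integral_cmult) measurable
  also have "\<dots> \<le> (\<integral>\<^sup>+x. ennreal (R b x) * ennreal (\<Prod>l\<in>insert i (set js). ?H x l ^ ?e l) \<partial>prod_space (set js))"
  proof (intro nn_integral_mono mult_left_mono nn_integral_holder[OF _ _ q])
    show "(\<Sum>l\<in>insert i (set js). ?e l) = q"
    proof -
      have "(\<Sum>l\<in>set js. ?e l) = (\<Sum>l\<in>set js. n l)" using ij by (intro sum.cong) auto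
      then show ?thesis using zero.prems zero.hyps ij by simp
    qed
    fix x l
    show "(\<integral>\<^sup>+y. ennreal (?h x l y ^ q) \<partial>\<nu>) \<le> ennreal (?H x l ^ q)"
      using nn_integral_row[of q] nn_integral_k_power[of "x l" q] energy by (simp add: g_pow)
  qed (use g_pos k_pos in auto)
  \<comment> \<open>Every edge from \<open>i\<close> to \<open>j\<close> has left a factor
    \<open>g (x j)\<close>, so \<open>n j\<close> is added to \<open>b j\<close>; the next vertex
    starts with no edges.\<close>
  also have "\<dots> = (\<integral>\<^sup>+x. ennreal (R (\<lambda>j. b j + n j) x) \<partial>prod_space (set js))"
  proof (intro nn_integral_cong)
    fix x
    have "(\<Prod>l\<in>insert i (set js). ?H x l ^ ?e l) = (\<Prod>j\<in>set js. g (x j) ^ n j)"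
      using ij by (auto intro!: prod.cong)
    moreover have "0 \<le> (\<Prod>j\<in>set js. g (x j) ^ n j)"
      using g_pos by (intro prod_nonneg) (auto simp: less_imp_le)
    ultimately show "ennreal (R b x) * ennreal (\<Prod>l\<in>insert i (set js). ?H x l ^ ?e l) = ennreal (R (\<lambda>j. b j + n j) x)"
      using R0[of b x] by (simp add: ennreal_mult[symmetric]) (simp add: R_def power_add prod.distrib mult_ac)
  qed
  also have "\<dots> \<le> ennreal (wick (\<lambda>_ _. 1) a js)"
  proof (cases js)
    case Nil
    then show ?thesis
      by (simp add: R_def PiM_empty nn_integral_count_space_finite)
  next
    case (Cons j js')
    have "(\<integral>\<^sup>+x. ennreal ((\<Prod>j\<in>set js. root q (row q (x j)) ^ (b j + n j)) * (\<Prod>l\<in>set js'. k (x j) (x l) ^ 0)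
        * wick (\<lambda>i j. k (x i) (x j)) a js) \<partial>prod_space (set js)) \<le> ennreal (wick (\<lambda>_ _. 1) a js)"
      using zero.IH[of "\<lambda>j. b j + n j" "\<lambda>_. 0"] ij zero.prems unfolding Cons by (auto simp: add.assoc)
    then show ?thesis by (simp add: R_def g_def)
  qed
  finally show ?case
    using zero.hyps by (simp add: wick_Cons_0 g_def)
next
  case (pos a i js)
  have ij: "i \<notin> set js" "distinct js" using pos.prems by auto
  have cond: "a i + b i + (\<Sum>j\<in>set js. n j) = q" "\<And>j. j \<in> set js \<Longrightarrow> a j + b j + n j = q"
    using pos.prems by auto
  have [measurable]: "(\<lambda>x. x j) \<in> measurable (prod_space I) \<nu>" if "j \<in> I" for j I
    using that by (intro measurable_component_singleton)
  define F where "F n a x = (\<Prod>j\<in>set (i # js). root q (row q (x j)) ^ b j) * (\<Prod>j\<in>set js. k (x i) (x j) ^ n j)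
        * wick (\<lambda>i j. k (x i) (x j)) a (i # js)" for n :: "'i \<Rightarrow> nat" and a x
  have F0: "0 \<le> F n a x" for n a x
    unfolding F_def using row_pos[of q] k_pos
    by (intro mult_nonneg_nonneg prod_nonneg wick_nonneg ballI zero_le_power real_root_ge_zero) (auto simp: less_imp_le)
  have Fm [measurable]: "F n a \<in> borel_measurable (prod_space (set (i # js)))" for n a
    unfolding F_def[abs_def] by measurable
  have "F n a x = (\<Sum>j\<in>set js. real (a j) * F (n(j := Suc (n j))) (dec i (dec j a)) x)" for x
  proof -
    have "(\<Prod>l\<in>set js. k (x i) (x l) ^ (n(j := Suc (n j))) l) = k (x i) (x j) * (\<Prod>l\<in>set js. k (x i) (x l) ^ n l)"
      if "j \<in> set js" for j
    proof -
      have "(\<Prod>l\<in>set js - {j}. k (x i) (x l) ^ (n(j := Suc (n j))) l) = (\<Prod>l\<in>set js - {j}. k (x i) (x l) ^ n l)"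
        by (intro prod.cong) auto
      then show ?thesis using that by (simp add: prod.remove[of _ j])
    qed
    then show ?thesis
      unfolding F_def wick_Cons_Suc[of a i, OF pos.hyps(1)] sum_distrib_left
      by (intro sum.cong refl) (simp add: mult_ac)
  qed
  then have "(\<integral>\<^sup>+x. ennreal (F n a x) \<partial>prod_space (set (i # js))) =
      (\<integral>\<^sup>+x. (\<Sum>j\<in>set js. ennreal (real (a j)) * ennreal (F (n(j := Suc (n j))) (dec i (dec j a)) x)) \<partial>prod_space (set (i # js)))"
    using F0 by (intro nn_integral_cong) (simp add: sum_ennreal[symmetric] ennreal_mult del: sum_ennreal)
  also have "\<dots> = (\<Sum>j\<in>set js. ennreal (real (a j)) * (\<integral>\<^sup>+x. ennreal (F (n(j := Suc (n j))) (dec i (dec j a)) x) \<partial>prod_space (set (i # js))))"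
    by (subst nn_integral_sum) (auto simp: nn_integral_cmult simp del: list.set)
  also have "\<dots> \<le> (\<Sum>j\<in>set js. ennreal (real (a j)) * ennreal (wick (\<lambda>_ _. 1) (dec i (dec j a)) (i # js)))"
  proof (intro sum_mono)
    fix j assume j: "j \<in> set js"
    show "ennreal (real (a j)) * (\<integral>\<^sup>+x. ennreal (F (n(j := Suc (n j))) (dec i (dec j a)) x) \<partial>prod_space (set (i # js)))
        \<le> ennreal (real (a j)) * ennreal (wick (\<lambda>_ _. 1) (dec i (dec j a)) (i # js))"
    proof (cases "a j = 0")
      \<comment> \<open>The contraction moves one half-edge from \<open>a j\<close> to
        \<open>n j\<close>, and at \<open>i\<close> one from \<open>a i\<close> to the sum of the
        \<open>n j\<close>, so both balances remain equal to \<open>q\<close>.\<close>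
      case False
      have ne: "i \<noteq> j" using ij j by auto
      have "(\<Sum>l\<in>set js. (n(j := Suc (n j))) l) = Suc (\<Sum>l\<in>set js. n l)"
      proof -
        have "(\<Sum>l\<in>set js - {j}. (n(j := Suc (n j))) l) = (\<Sum>l\<in>set js - {j}. n l)"
          by (intro sum.cong) auto
        then show ?thesis using j by (simp add: sum.remove[of _ j])
      qed
      moreover have "dec i (dec j a) l + b l + (n(j := Suc (n j))) l = q" if "l \<in> set js" for l
        using cond(2)[OF that] False that ij(1) by (auto simp: dec_def)
      ultimately have "(\<integral>\<^sup>+x. ennreal (F (n(j := Suc (n j))) (dec i (dec j a)) x) \<partial>prod_space (set (i # js)))
          \<le> ennreal (wick (\<lambda>_ _. 1) (dec i (dec j a)) (i # js))"
        using pos.IH[OF j pos.prems(1), of b "n(j := Suc (n j))"] cond pos.hyps(1) ne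
        unfolding F_def by simp
      then show ?thesis by (intro mult_left_mono) auto
    qed simp
  qed
  also have "\<dots> = ennreal (wick (\<lambda>_ _. 1) a (i # js))"
    unfolding wick_Cons_Suc[of a i, OF pos.hyps(1)]
    by (subst sum_ennreal[symmetric]) (auto simp: ennreal_mult wick_nonneg)
  finally show ?case by (simp add: F_def)
qed simp

end

section \<open>Contractions other than pairings\<close>

definition remainder :: "nat \<Rightarrow> nat \<Rightarrow> (nat \<Rightarrow> nat \<Rightarrow> real) \<Rightarrow> real" where
  "remainder q m c = wick c (\<lambda>_. q) [0..<m] - pairing q c [0..<m]"

text \<open>One exponent depending on \<open>q\<close> and \<open>m\<close> alone, so that
  comparison constants do not vary with the kernel or the domain.\<close>

definition remainder_degree :: "nat \<Rightarrow> nat \<Rightarrow> nat" where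
  "remainder_degree q m = (LEAST N. posynomial N (remainder q m))"

lemma posynomial_remainder:
  assumes "0 < q"
  shows "posynomial (remainder_degree q m) (remainder q m)"
proof -
  obtain f N where f: "posynomial N f" "\<forall>c. wick c (\<lambda>_. q) [0..<m] = pairing q c [0..<m] + f c"
    using wick_eq_pairing_plus[of "[0..<m]" q] assms by auto
  have "remainder q m = f"
    using f(2) by (auto simp: remainder_def)
  with f(1) show ?thesis
    unfolding remainder_degree_def by (metis LeastI)
qed

lemma remainder_cong:
  assumes "\<And>i j. i < m \<Longrightarrow> j < m \<Longrightarrow> c i j = c' i j"
  shows "remainder q m c = remainder q m c'"
  unfolding remainder_def using assms
  by (intro arg_cong2[where f = minus] wick_cong pairing_cong) auto

context positive_kernel
begin

text \<open>This takes the place of hypercontractivity: moments of every order are controlled by the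
  variance. By homogeneity the kernel can be divided by
  \<open>r\<^sup>2 = root q (energy q)\<close>, which reduces the claim to unit energy; each vertex
  then carries the factor \<open>r ^ q = sqrt (energy q)\<close>.\<close>

lemma integral_wick_le:
  assumes q: "0 < q" and dist: "distinct is"
  shows "(\<integral>x. wick (\<lambda>i j. k (x i) (x j)) (\<lambda>_. q) is \<partial>prod_space (set is)) \<le>
    sqrt (energy q) ^ length is * wick (\<lambda>_ _. 1) (\<lambda>_. q) is"
proof -
  define r where "r = sqrt (root q (energy q))"
  have E: "0 < energy q" by (rule energy_pos)
  have r: "0 < r" unfolding r_def using q E by simp
  have r2: "r\<^sup>2 = root q (energy q)" unfolding r_def using q E by (simp add: less_imp_le)
  have rq: "r ^ q = sqrt (energy q)"
  proof -
    have "(r ^ q)\<^sup>2 = energy q"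
      using r2 q E by (simp add: power_mult[symmetric] mult.commute[of q]) (simp add: power_mult less_imp_le)
    then show ?thesis using r by (metis less_imp_le real_sqrt_unique zero_le_power)
  qed
  define k' where "k' u v = k u v / r\<^sup>2" for u v
  interpret k': positive_kernel \<nu> k' "B / r\<^sup>2"
  proof
    show "(\<lambda>(u, v). k' u v) \<in> borel_measurable (\<nu> \<Otimes>\<^sub>M \<nu>)"
      unfolding k'_def by measurable
  qed (use r k_pos k_sym k_le in \<open>auto simp: k'_def divide_right_mono\<close>)
  have "k'.energy q = energy q / (r\<^sup>2) ^ q"
    unfolding k'.energy_def energy_def k'_def power_divide by simp
  also have "\<dots> = 1" using q E unfolding r2 by (simp add: less_imp_le)
  finally have E': "k'.energy q = 1" .
  have "(\<integral>\<^sup>+x. ennreal (wick (\<lambda>i j. k' (x i) (x j)) (\<lambda>_. q) is) \<partial>prod_space (set is)) \<le> ennreal (wick (\<lambda>_ _. 1) (\<lambda>_. q) is)"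
  proof (cases "is")
    case Nil
    then show ?thesis by (simp add: PiM_empty nn_integral_count_space_finite)
  next
    case (Cons i js)
    then show ?thesis
      using k'.nn_integral_wick_le_aux[OF E' q dist, of "\<lambda>_. q" "\<lambda>_. 0" "\<lambda>_. 0"] by simp
  qed
  also have "(\<integral>\<^sup>+x. ennreal (wick (\<lambda>i j. k' (x i) (x j)) (\<lambda>_. q) is) \<partial>prod_space (set is)) =
      ennreal (\<integral>x. wick (\<lambda>i j. k' (x i) (x j)) (\<lambda>_. q) is \<partial>prod_space (set is))"
    using k'.k_pos by (intro nn_integral_eq_integral k'.integrable_wick AE_I2 wick_nonneg) (auto simp: less_imp_le)
  finally have "(\<integral>x. wick (\<lambda>i j. k' (x i) (x j)) (\<lambda>_. q) is \<partial>prod_space (set is)) \<le> wick (\<lambda>_ _. 1) (\<lambda>_. q) is"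
    by (simp add: ennreal_le_iff wick_nonneg)
  then have *: "r ^ (q * length is) * (\<integral>x. wick (\<lambda>i j. k' (x i) (x j)) (\<lambda>_. q) is \<partial>prod_space (set is)) \<le>
      r ^ (q * length is) * wick (\<lambda>_ _. 1) (\<lambda>_. q) is"
    using r by (intro mult_left_mono) auto
  have "wick (\<lambda>i j. k (x i) (x j)) (\<lambda>_. q) is = r ^ (q * length is) * wick (\<lambda>i j. k' (x i) (x j)) (\<lambda>_. q) is" for x
  proof -
    have "wick (\<lambda>i j. k (x i) (x j)) (\<lambda>_. q) is = wick (\<lambda>i j. r\<^sup>2 * k' (x i) (x j)) (\<lambda>_. q) is"
      using r by (intro wick_cong) (auto simp: k'_def)
    also have "\<dots> = r ^ (q * length is) * wick (\<lambda>i j. k' (x i) (x j)) (\<lambda>_. q) is"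
      using dist by (subst wick_homogeneous) (auto simp: distinct_card mult.commute)
    finally show ?thesis .
  qed
  then have "(\<integral>x. wick (\<lambda>i j. k (x i) (x j)) (\<lambda>_. q) is \<partial>prod_space (set is)) =
     r ^ (q * length is) * (\<integral>x. wick (\<lambda>i j. k' (x i) (x j)) (\<lambda>_. q) is \<partial>prod_space (set is))"
    by simp
  with * show ?thesis by (simp add: power_mult rq)
qed

text \<open>\<open>scale q\<close> is the standard deviation of the Hermite functional with covariance kernel \<open>k\<close>.\<close>

definition scale :: "nat \<Rightarrow> real" where
  "scale q = sqrt (fact q * energy q)"

lemma scale_pos: "0 < scale q"
  unfolding scale_def using energy_pos by simp

definition wick_moment :: "nat \<Rightarrow> nat \<Rightarrow> real" where
  "wick_moment q m = (\<integral>x. wick (\<lambda>i j. k (x i) (x j)) (\<lambda>_. q) [0..<m] \<partial>prod_space {0..<m})"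

definition remainder_moment :: "nat \<Rightarrow> nat \<Rightarrow> real" where
  "remainder_moment q m = (\<integral>x. remainder q m (\<lambda>i j. k (x i) (x j)) \<partial>prod_space {0..<m})"

lemma integral_pairing:
  "has_bochner_integral (prod_space {0..<m}) (\<lambda>x. pairing q (\<lambda>i j. k (x i) (x j)) [0..<m])
    (gaussian_moment m * scale q ^ m)"
proof (rule has_bochner_integral_nn_integral)
  have "(\<lambda>x. pairing q (\<lambda>i j. k (x i) (x j)) [0..<m]) \<in> borel_measurable (prod_space {0..<m})"
    by (rule pairing_measurable) simp
  then show "(\<lambda>x. pairing q (\<lambda>i j. k (x i) (x j)) [0..<m]) \<in> borel_measurable (prod_space {0..<m})" .
  show "AE x in prod_space {0..<m}. 0 \<le> pairing q (\<lambda>i j. k (x i) (x j)) [0..<m]"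
    using k_pos by (intro AE_I2 pairing_nonneg) (auto simp: less_imp_le)
  show "0 \<le> gaussian_moment m * scale q ^ m"
    using gaussian_moment_nonneg scale_pos by (simp add: less_imp_le)
  show "(\<integral>\<^sup>+x. ennreal (pairing q (\<lambda>i j. k (x i) (x j)) [0..<m]) \<partial>prod_space {0..<m}) = ennreal (gaussian_moment m * scale q ^ m)"
    using nn_integral_pairing[of "[0..<m]" q] by (simp add: scale_def)
qed

lemma integrable_remainder:
  "integrable (prod_space {0..<m}) (\<lambda>x. remainder q m (\<lambda>i j. k (x i) (x j)))"
  unfolding remainder_def using integrable_wick[of "[0..<m]" "{0..<m}"] integral_pairing
  by (intro Bochner_Integration.integrable_diff) (auto simp: has_bochner_integral_iff)

lemma wick_moment_eq: "wick_moment q m = gaussian_moment m * scale q ^ m + remainder_moment q m"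
  unfolding wick_moment_def remainder_moment_def remainder_def
  using integrable_wick[of "[0..<m]" "{0..<m}"] integral_pairing[of m q]
  by (simp add: has_bochner_integral_iff)

lemma wick_moment_le: "0 < q \<Longrightarrow> wick_moment q m \<le> wick (\<lambda>_ _. 1) (\<lambda>_. q) [0..<m] * scale q ^ m"
proof -
  assume q: "0 < q"
  have "energy q \<le> fact q * energy q"
    using energy_pos[of q] fact_ge_1[of q, where 'a = real] by simp
  then have "sqrt (energy q) ^ m \<le> scale q ^ m"
    unfolding scale_def using energy_pos[of q] by (intro power_mono) auto
  then have "sqrt (energy q) ^ m * wick (\<lambda>_ _. 1) (\<lambda>_. q) [0..<m] \<le> scale q ^ m * wick (\<lambda>_ _. 1) (\<lambda>_. q) [0..<m]"
    by (intro mult_right_mono wick_nonneg) auto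
  then show ?thesis
    using integral_wick_le[OF q, of "[0..<m]"] unfolding wick_moment_def by (simp add: mult.commute)
qed

lemma remainder_moment_nonneg:
  assumes "0 < q"
  shows "0 \<le> remainder_moment q m"
  unfolding remainder_moment_def
  using posynomial_nonneg[OF posynomial_remainder[OF assms]] k_pos
  by (intro integral_nonneg_AE AE_I2) (auto simp: less_imp_le)

lemma wick_moment_1: "0 < q \<Longrightarrow> wick_moment q 1 = 0"
  by (simp add: wick_moment_def wick_single)

text \<open>On two points every contraction is a pairing, so the variance has no remainder.\<close>

lemma wick_moment_2: "wick_moment q 2 = scale q ^ 2"
proof -
  have "[0..<2] = [0, Suc 0]" by (simp add: numeral_2_eq_2)
  moreover have "remainder q 2 c = 0" for c
    unfolding remainder_def calculation by (simp add: wick_pair)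
  then have "remainder_moment q 2 = 0"
    by (simp add: remainder_moment_def)
  ultimately show ?thesis by (simp add: wick_moment_eq numeral_2_eq_2)
qed

end

text \<open>The numerator is bounded through the pointwise domination along \<open>h\<close>, whose
  constant is raised to the degree of the remainder, the denominator through the energies. The two
  bounds are separate hypotheses because they may rest on different estimates of the kernel.\<close>

lemma remainder_moment_comparison:
  assumes "positive_kernel \<nu> k B" "positive_kernel \<nu>' k' B'"
    and h [measurable]: "h \<in> measurable \<nu> \<nu>'" and distr: "distr \<nu> \<nu>' h = \<nu>'"
    and A: "AE u in \<nu>. u \<in> A" and K: "1 \<le> K"
    and le: "\<And>u v. u \<in> A \<Longrightarrow> v \<in> A \<Longrightarrow> k u v \<le> K * k' (h u) (h v)"
    and c: "0 < c" and energy: "c * positive_kernel.energy \<nu>' k' q \<le> positive_kernel.energy \<nu> k q"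
    and q: "0 < q"
  shows "positive_kernel.remainder_moment \<nu> k q m / positive_kernel.scale \<nu> k q ^ m \<le>
    K ^ remainder_degree q m / sqrt c ^ m *
      (positive_kernel.remainder_moment \<nu>' k' q m / positive_kernel.scale \<nu>' k' q ^ m)"
proof -
  interpret k: positive_kernel \<nu> k B by fact
  interpret k': positive_kernel \<nu>' k' B' by fact
  let ?N = "remainder_degree q m" and ?I = "{0..<m}"
  note posy = posynomial_remainder[OF q, of m]
  have distr': "distr (PiM ?I (\<lambda>_. \<nu>)) (PiM ?I (\<lambda>_. \<nu>')) (compose ?I h) = PiM ?I (\<lambda>_. \<nu>')"
    using distr_PiM_finite_prob_space'[of ?I "\<lambda>_. \<nu>" "\<lambda>_. \<nu>'" h] k.prob_space_axioms k'.prob_space_axioms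
    by (simp add: distr)
  have comp: "compose ?I h \<in> measurable (PiM ?I (\<lambda>_. \<nu>)) (PiM ?I (\<lambda>_. \<nu>'))"
    unfolding compose_def by measurable
  have "AE x in PiM ?I (\<lambda>_. \<nu>). \<forall>i\<in>?I. x i \<in> A"
    using A by (intro AE_finite_allI AE_PiM_component) (auto intro: k.prob_space_axioms)
  then have AE_le: "AE x in PiM ?I (\<lambda>_. \<nu>). remainder q m (\<lambda>i j. k (x i) (x j)) \<le>
     K ^ ?N * remainder q m (\<lambda>i j. k' (compose ?I h x i) (compose ?I h x j))"
  proof eventually_elim
    fix x assume x: "\<forall>i\<in>?I. x i \<in> A"
    \<comment> \<open>\<open>posynomial_le\<close> asks for bounds at all pairs of indices, but they
      are known only below \<open>m\<close>, where \<open>compose\<close> is not undefined.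
      Elsewhere both matrices get the value 1, which is admissible since \<open>1 \<le> K\<close>
      and does not affect the remainder.\<close>
    define d where "d i j = (if i < m \<and> j < m then k (x i) (x j) else 1)" for i j
    define d' where "d' i j = (if i < m \<and> j < m then k' (compose ?I h x i) (compose ?I h x j) else 1)" for i j
    have "0 \<le> d i j" "d i j \<le> K * d' i j" for i j
      using x le K k.k_pos by (auto simp: d_def d'_def compose_def less_imp_le)
    then have "remainder q m d \<le> K ^ ?N * remainder q m d'"
      by (intro posynomial_le[OF posy K])
    moreover have "remainder q m d = remainder q m (\<lambda>i j. k (x i) (x j))"
      "remainder q m d' = remainder q m (\<lambda>i j. k' (compose ?I h x i) (compose ?I h x j))"
      by (intro remainder_cong; simp add: d_def d'_def)+
    ultimately show "remainder q m (\<lambda>i j. k (x i) (x j)) \<le>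
        K ^ ?N * remainder q m (\<lambda>i j. k' (compose ?I h x i) (compose ?I h x j))"
      by simp
  qed
  let ?f = "\<lambda>y. remainder q m (\<lambda>i j. k' (y i) (y j))"
  have f: "?f \<in> borel_measurable (PiM ?I (\<lambda>_. \<nu>'))"
    using k'.integrable_remainder by (rule borel_measurable_integrable)
  have "integrable (distr (PiM ?I (\<lambda>_. \<nu>)) (PiM ?I (\<lambda>_. \<nu>')) (compose ?I h)) ?f"
    unfolding distr' by (rule k'.integrable_remainder)
  then have int: "integrable (PiM ?I (\<lambda>_. \<nu>)) (\<lambda>x. ?f (compose ?I h x))"
    by (rule integrable_distr[OF comp])
  have "k.remainder_moment q m \<le> (\<integral>x. K ^ ?N * ?f (compose ?I h x) \<partial>PiM ?I (\<lambda>_. \<nu>))"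
    unfolding k.remainder_moment_def
    by (intro integral_mono_AE k.integrable_remainder AE_le Bochner_Integration.integrable_mult_right int)
  also have "\<dots> = K ^ ?N * (\<integral>y. ?f y \<partial>distr (PiM ?I (\<lambda>_. \<nu>)) (PiM ?I (\<lambda>_. \<nu>')) (compose ?I h))"
    using integral_distr[OF comp f] by simp
  also have "\<dots> = K ^ ?N * k'.remainder_moment q m"
    unfolding distr' k'.remainder_moment_def ..
  finally have R: "k.remainder_moment q m \<le> K ^ ?N * k'.remainder_moment q m" .
  have "sqrt c * k'.scale q \<le> k.scale q"
    unfolding k.scale_def k'.scale_def real_sqrt_mult[symmetric] using energy
    by (auto simp: mult_ac)
  then have T: "(sqrt c * k'.scale q) ^ m \<le> k.scale q ^ m"
    using c k'.scale_pos[of q] by (intro power_mono) (auto simp: less_imp_le)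
  have "k.remainder_moment q m / k.scale q ^ m \<le> (K ^ ?N * k'.remainder_moment q m) / (sqrt c * k'.scale q) ^ m"
    using R T c k'.scale_pos[of q] k.remainder_moment_nonneg[OF q, of m]
    by (intro frac_le) (auto intro: order_trans)
  also have "\<dots> = K ^ ?N / sqrt c ^ m * (k'.remainder_moment q m / k'.scale q ^ m)"
    by (simp add: power_mult_distrib)
  finally show ?thesis .
qed

lemma hermite_measurable [measurable]: "hermite n \<in> borel_measurable borel"
  by (induction n rule: induct_nat_012) (auto simp: hermite.simps[abs_def] cong: measurable_cong)

section \<open>Hermite functionals\<close>

locale gaussian_functional =
  centered_gaussian_space M V + kernel: positive_kernel \<nu> k B
  for M :: "'w measure" and V and \<nu> :: "'u measure" and k B +
  fixes X :: "'u \<Rightarrow> 'w \<Rightarrow> real" and q :: nat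
  assumes X_in_V: "X u \<in> V"
    and cov_X: "cov (X u) (X v) = k u v"
    and k_diag: "k u u = 1"
    and X_measurable [measurable]: "(\<lambda>(u, w). X u w) \<in> borel_measurable (\<nu> \<Otimes>\<^sub>M M)"
    and q_pos: "0 < q"
begin

definition Y :: "'w \<Rightarrow> real" where
  "Y w = (\<integral>u. hermite q (X u w) \<partial>\<nu>)"

abbreviation points :: "nat \<Rightarrow> (nat \<Rightarrow> 'u) measure" where
  "points m \<equiv> kernel.prod_space {0..<m}"

definition G :: "nat \<Rightarrow> (nat \<Rightarrow> 'u) \<Rightarrow> 'w \<Rightarrow> real" where
  "G m x w = (\<Prod>i\<in>{0..<m}. hermite q (X (x i) w))"

lemma G_measurable [measurable]: "(\<lambda>(x, w). G m x w) \<in> borel_measurable (points m \<Otimes>\<^sub>M M)"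
proof -
  have [measurable]: "(\<lambda>z. (fst z) i) \<in> measurable (points m \<Otimes>\<^sub>M M) \<nu>" if "i \<in> {0..<m}" for i
    using that by measurable
  have "(\<lambda>z. X (fst z i) (snd z)) \<in> borel_measurable (points m \<Otimes>\<^sub>M M)" if "i \<in> {0..<m}" for i
    using measurable_compose[OF measurable_Pair[of "\<lambda>z. fst z i" "points m \<Otimes>\<^sub>M M" \<nu> snd M] X_measurable] that
    by simp
  then show ?thesis
    unfolding G_def[abs_def] case_prod_beta by measurable
qed

lemma Y_measurable [measurable]: "Y \<in> borel_measurable M"
  unfolding Y_def[abs_def]
proof (rule kernel.borel_measurable_lebesgue_integral)
  have [measurable]: "(\<lambda>z. X (snd z) (fst z)) \<in> borel_measurable (M \<Otimes>\<^sub>M \<nu>)"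
    using measurable_compose[OF measurable_pair_swap' X_measurable] by (simp add: case_prod_beta)
  show "(\<lambda>(w, u). hermite q (X u w)) \<in> borel_measurable (M \<Otimes>\<^sub>M \<nu>)"
    unfolding case_prod_beta by measurable
qed

lemma expectation_G: "expectation (G m x) = wick (\<lambda>i j. k (x i) (x j)) (\<lambda>_. q) [0..<m]"
  using expectation_prod_hermite[of "[0..<m]" "\<lambda>i. X (x i)" "\<lambda>_. q"]
  by (simp add: G_def[abs_def] X_in_V cov_X k_diag)

lemma integrable_G: "integrable M (G m x)"
  unfolding G_def[abs_def] by (intro integrable_prod_hermite X_in_V) auto

text \<open>Doubling each index by a Boolean label makes the square again a product over distinct
  indices, so Wick's formula applies to it. The resulting bound is uniform in the points and will
  justify Fubini's theorem.\<close>

lemma G_square: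
  "integrable M (\<lambda>w. (G m x w)\<^sup>2)" "\<exists>C. \<forall>x. expectation (\<lambda>w. (G m x w)\<^sup>2) \<le> C"
proof -
  obtain ps where ps: "set ps = {0..<m} \<times> (UNIV :: bool set)" "distinct ps"
    using finite_distinct_list[of "{0..<m} \<times> (UNIV :: bool set)"] by auto
  have sq: "(G m x w)\<^sup>2 = (\<Prod>p\<in>set ps. hermite q (X (x (fst p)) w))" for x w
  proof -
    have "(\<Prod>p\<in>set ps. hermite q (X (x (fst p)) w)) = (\<Prod>i\<in>{0..<m}. \<Prod>b\<in>(UNIV :: bool set). hermite q (X (x i) w))"
      unfolding ps(1) by (subst prod.cartesian_product) (simp add: case_prod_beta)
    then show ?thesis by (simp add: G_def power2_eq_square prod.distrib UNIV_bool)
  qed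
  show "integrable M (\<lambda>w. (G m x w)\<^sup>2)"
    unfolding sq by (intro integrable_prod_hermite X_in_V) auto
  obtain N where N: "posynomial N (\<lambda>c. wick c (\<lambda>_. q) ps)"
    using posynomial_wick by (rule exE)
  show "\<exists>C. \<forall>x. expectation (\<lambda>w. (G m x w)\<^sup>2) \<le> C"
  proof (intro exI allI)
    fix x
    have "expectation (\<lambda>w. (G m x w)\<^sup>2) = wick (\<lambda>p p'. k (x (fst p)) (x (fst p'))) (\<lambda>_. q) ps"
      unfolding sq using expectation_prod_hermite[of ps "\<lambda>p. X (x (fst p))" "\<lambda>_. q"] ps(2)
      by (simp add: X_in_V cov_X k_diag)
    also have "\<dots> \<le> max 1 B ^ N * wick (\<lambda>_ _. 1) (\<lambda>_. q) ps"
      using kernel.k_pos kernel.k_le by (intro posynomial_le[OF N]) (auto simp: less_imp_le le_max_iff_disj)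
    finally show "expectation (\<lambda>w. (G m x w)\<^sup>2) \<le> max 1 B ^ N * wick (\<lambda>_ _. 1) (\<lambda>_. q) ps" .
  qed
qed

lemma integrable_G_product: "integrable (points m \<Otimes>\<^sub>M M) (\<lambda>(x, w). G m x w)"
proof -
  interpret P: prob_space "points m" by (rule kernel.prob_space_prod_space)
  interpret PM: pair_sigma_finite "points m" M ..
  obtain C where C: "\<And>x. expectation (\<lambda>w. (G m x w)\<^sup>2) \<le> C"
    using G_square(2) by blast
  show ?thesis
  proof (rule PM.Fubini_integrable)
    show "integrable (points m) (\<lambda>x. \<integral>w. norm (case (x, w) of (x, w) \<Rightarrow> G m x w) \<partial>M)"
    proof (rule P.integrable_const_bound)
      have "expectation (\<lambda>w. \<bar>G m x w\<bar>) \<le> 1 + C" for x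
      proof -
        have "expectation (\<lambda>w. \<bar>G m x w\<bar>) \<le> expectation (\<lambda>w. 1 + (G m x w)\<^sup>2)"
        proof (intro integral_mono integrable_abs integrable_G Bochner_Integration.integrable_add G_square(1))
          fix w
          have "0 \<le> (\<bar>G m x w\<bar> - 1)\<^sup>2 + \<bar>G m x w\<bar>" by simp
          then show "\<bar>G m x w\<bar> \<le> 1 + (G m x w)\<^sup>2" by (simp add: power2_diff)
        qed simp
        also have "\<dots> = 1 + expectation (\<lambda>w. (G m x w)\<^sup>2)"
          using G_square(1)[of m x] by (simp add: prob_space)
        finally show ?thesis using C[of x] by simp
      qed
      then show "AE x in points m. norm (\<integral>w. norm (case (x, w) of (x, w) \<Rightarrow> G m x w) \<partial>M) \<le> 1 + C"
        by simp
      show "(\<lambda>x. \<integral>w. norm (case (x, w) of (x, w) \<Rightarrow> G m x w) \<partial>M) \<in> borel_measurable (points m)"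
        by (rule borel_measurable_lebesgue_integral) measurable
    qed
    show "AE x in points m. integrable M (\<lambda>w. case (x, w) of (x, w) \<Rightarrow> G m x w)"
      using integrable_G by simp
  qed measurable
qed

lemma AE_integrable_hermite: "AE w in M. integrable \<nu> (\<lambda>u. hermite q (X u w))"
proof -
  interpret P: prob_space "points 1" by (rule kernel.prob_space_prod_space)
  interpret PM: pair_sigma_finite "points 1" M ..
  have "AE w in M. integrable (points 1) (\<lambda>x. G 1 x w)"
    using integrable_G_product by (rule PM.AE_integrable_snd)
  then show ?thesis
  proof (rule AE_mp, intro AE_I2 impI)
    fix w assume w: "w \<in> space M" and int: "integrable (points 1) (\<lambda>x. G 1 x w)"
    have Xw: "(\<lambda>u. hermite q (X u w)) \<in> borel_measurable \<nu>"
      using measurable_compose[OF measurable_compose[OF measurable_Pair2'[OF w] X_measurable] hermite_measurable] by simp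
    have "distr (points 1) \<nu> (\<lambda>x. x 0) = \<nu>"
      by (rule distr_PiM_component) (auto intro: kernel.prob_space_axioms)
    moreover have "integrable (distr (points 1) \<nu> (\<lambda>x. x 0)) (\<lambda>u. hermite q (X u w))"
      using int Xw by (subst integrable_distr_eq) (auto simp: G_def)
    ultimately show "integrable \<nu> (\<lambda>u. hermite q (X u w))" by simp
  qed
qed

text \<open>The power of an integral is an integral over the product space as soon as the inner
  function is integrable, which is known for almost every \<open>w\<close> only.\<close>

lemma AE_Y_power: "AE w in M. (\<integral>x. G m x w \<partial>points m) = Y w ^ m"
  using AE_integrable_hermite
proof eventually_elim
  fix w assume "integrable \<nu> (\<lambda>u. hermite q (X u w))"
  then have "(\<integral>x. (\<Prod>i\<in>{0..<m}. hermite q (X (x i) w)) \<partial>points m) = (\<Prod>i\<in>{0..<m}. Y w)"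
    unfolding Y_def by (subst kernel.pr.product_integral_prod) auto
  then show "(\<integral>x. G m x w \<partial>points m) = Y w ^ m"
    by (simp add: G_def)
qed

theorem moment_Y:
  "integrable M (\<lambda>w. Y w ^ m)" "expectation (\<lambda>w. Y w ^ m) = kernel.wick_moment q m"
proof -
  interpret P: prob_space "points m" by (rule kernel.prob_space_prod_space)
  interpret PM: pair_sigma_finite "points m" M ..
  have int: "integrable M (\<lambda>w. \<integral>x. G m x w \<partial>points m)"
    using integrable_G_product by (rule PM.integrable_snd)
  show "integrable M (\<lambda>w. Y w ^ m)"
    using int AE_Y_power[of m] by (subst integrable_cong_AE[symmetric]) auto
  have "expectation (\<lambda>w. Y w ^ m) = expectation (\<lambda>w. \<integral>x. G m x w \<partial>points m)"
    using int AE_Y_power[of m] by (intro integral_cong_AE) auto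
  also have "\<dots> = (\<integral>x. expectation (G m x) \<partial>points m)"
    using PM.Fubini_integral[OF integrable_G_product] by simp
  also have "\<dots> = kernel.wick_moment q m"
    by (simp add: expectation_G kernel.wick_moment_def)
  finally show "expectation (\<lambda>w. Y w ^ m) = kernel.wick_moment q m" .
qed

lemma expectation_Y: "expectation Y = 0"
  using moment_Y(2)[of 1] kernel.wick_moment_1[OF q_pos] by simp

lemma standardize_Y: "standardize M Y = (\<lambda>w. Y w / kernel.scale q)"
proof -
  have "variance_of M Y = (kernel.scale q)\<^sup>2"
    unfolding variance_of_def expectation_Y using moment_Y(2)[of 2] kernel.wick_moment_2 by simp
  then show ?thesis
    using kernel.scale_pos[of q] by (simp add: standardize_def expectation_Y less_imp_le)
qed

lemma moment_standardize:
  "integrable M (\<lambda>w. standardize M Y w ^ m)"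
  "expectation (\<lambda>w. standardize M Y w ^ m) =
     gaussian_moment m + kernel.remainder_moment q m / kernel.scale q ^ m"
  "expectation (\<lambda>w. standardize M Y w ^ m) \<le> wick (\<lambda>_ _. 1) (\<lambda>_. q) [0..<m]"
proof -
  show "integrable M (\<lambda>w. standardize M Y w ^ m)"
    unfolding standardize_Y power_divide using moment_Y(1) by simp
  have "expectation (\<lambda>w. standardize M Y w ^ m) = kernel.wick_moment q m / kernel.scale q ^ m"
    unfolding standardize_Y power_divide by (simp add: moment_Y(2))
  moreover have "kernel.wick_moment q m / kernel.scale q ^ m =
      gaussian_moment m + kernel.remainder_moment q m / kernel.scale q ^ m"
    using kernel.scale_pos[of q] by (simp add: kernel.wick_moment_eq add_divide_distrib)
  moreover have "kernel.wick_moment q m / kernel.scale q ^ m \<le> wick (\<lambda>_ _. 1) (\<lambda>_. q) [0..<m]"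
    using kernel.scale_pos[of q] kernel.wick_moment_le[OF q_pos, of m] by (simp add: divide_le_eq)
  ultimately show "expectation (\<lambda>w. standardize M Y w ^ m) =
     gaussian_moment m + kernel.remainder_moment q m / kernel.scale q ^ m"
    "expectation (\<lambda>w. standardize M Y w ^ m) \<le> wick (\<lambda>_ _. 1) (\<lambda>_. q) [0..<m]"
    by simp_all
qed

lemma standardize_Y_measurable [measurable]: "standardize M Y \<in> borel_measurable M"
  unfolding standardize_Y by measurable

end

section \<open>The method of moments\<close>

lemma gaussian_moment_even: "gaussian_moment (2 * k) = fact (2 * k) / (2 ^ k * fact k)"
proof (induction k)
  case (Suc k)
  have "gaussian_moment (2 * Suc k) = real (Suc (2 * k)) * (fact (2 * k) / (2 ^ k * fact k))"
    using Suc by simp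
  also have "\<dots> = (2 * real (Suc k) * (real (Suc (2 * k)) * fact (2 * k))) / (2 * real (Suc k) * (2 ^ k * fact k))"
    by (simp del: of_nat_Suc)
  also have "\<dots> = fact (2 * Suc k) / (2 ^ Suc k * fact (Suc k))"
    by (intro arg_cong2[where f = "(/)"]) (simp_all add: algebra_simps)
  finally show ?case .
qed simp

lemma gaussian_moment_odd: "gaussian_moment (2 * k + 1) = 0"
  by (induction k) auto

lemma std_normal_moment:
  "has_bochner_integral std_normal_distribution (\<lambda>x. x ^ n) (gaussian_moment n)"
proof -
  have "has_bochner_integral lborel (\<lambda>x. std_normal_density x * x ^ n) (gaussian_moment n)"
  proof (cases "even n")
    case True
    then obtain k where "n = 2 * k" by (elim evenE)
    then show ?thesis using std_normal_moment_even[of k] gaussian_moment_even[of k] by simp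
  next
    case False
    then obtain k where "n = 2 * k + 1" by (elim oddE)
    then show ?thesis using std_normal_moment_odd[of k] gaussian_moment_odd[of k] by simp
  qed
  then show ?thesis
    by (intro has_bochner_integral_density) (auto simp: real_scaleR_def)
qed

text \<open>There is no error up to \<open>T\<close>. Beyond \<open>T\<close> both terms on the left
  are at most \<open>\<bar>x\<bar> ^ m\<close>, and one more factor
  \<open>\<bar>x\<bar> ^ m / T ^ m \<ge> 1\<close> is affordable.\<close>

lemma clamp_power_error:
  fixes x T :: real
  assumes T: "0 < T"
  shows "\<bar>x ^ m - (max (- T) (min T x)) ^ m\<bar> \<le> 2 * (x ^ (2 * m) / T ^ m)"
proof (cases "\<bar>x\<bar> \<le> T")
  case True
  then have "max (- T) (min T x) = x" by auto
  then show ?thesis using T by (simp add: power_mult)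
next
  case False
  have "\<bar>max (- T) (min T x)\<bar> = T" using False T by auto
  then have "\<bar>x ^ m - (max (- T) (min T x)) ^ m\<bar> \<le> \<bar>x\<bar> ^ m + T ^ m"
    using abs_triangle_ineq4[of "x ^ m" "(max (- T) (min T x)) ^ m"] by (simp add: power_abs)
  also have "\<dots> \<le> 2 * \<bar>x\<bar> ^ m" using False T power_mono[of T "\<bar>x\<bar>" m] by simp
  also have "\<bar>x\<bar> ^ m \<le> x ^ (2 * m) / T ^ m"
  proof -
    have "T ^ m * \<bar>x\<bar> ^ m \<le> \<bar>x\<bar> ^ m * \<bar>x\<bar> ^ m"
      using False T by (intro mult_right_mono power_mono) auto
    also have "\<dots> = x ^ (2 * m)" by (simp add: power_mult power2_eq_square flip: power_mult_distrib)
    finally show ?thesis using T by (simp add: le_divide_eq mult.commute)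
  qed
  finally show ?thesis by simp
qed

lemma real_distribution_clamp_error:
  fixes N :: "real measure"
  assumes N: "real_distribution N" and int: "integrable N (\<lambda>x. x ^ m)" "integrable N (\<lambda>x. x ^ (2 * m))" and T: "0 < T"
  shows "\<bar>(\<integral>x. x ^ m \<partial>N) - (\<integral>x. (max (- T) (min T x)) ^ m \<partial>N)\<bar> \<le> 2 * ((\<integral>x. x ^ (2 * m) \<partial>N) / T ^ m)"
proof -
  interpret real_distribution N by fact
  have bdd: "integrable N (\<lambda>x. (max (- T) (min T x)) ^ m)"
    using T by (intro integrable_const_bound[of _ "T ^ m"]) (auto simp: power_abs intro!: power_mono)
  have "\<bar>(\<integral>x. x ^ m \<partial>N) - (\<integral>x. (max (- T) (min T x)) ^ m \<partial>N)\<bar> = \<bar>\<integral>x. x ^ m - (max (- T) (min T x)) ^ m \<partial>N\<bar>"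
    using int(1) bdd by simp
  also have "\<dots> \<le> (\<integral>x. \<bar>x ^ m - (max (- T) (min T x)) ^ m\<bar> \<partial>N)"
    by (rule integral_abs_bound)
  also have "\<dots> \<le> (\<integral>x. 2 * (x ^ (2 * m) / T ^ m) \<partial>N)"
    using int bdd by (intro integral_mono clamp_power_error T) auto
  also have "\<dots> = 2 * ((\<integral>x. x ^ (2 * m) \<partial>N) / T ^ m)" by simp
  finally show ?thesis .
qed

lemma weak_conv_imp_moments:
  fixes N :: "nat \<Rightarrow> real measure"
  assumes N: "\<And>n. real_distribution (N n)"
    and int: "\<And>n m. integrable (N n) (\<lambda>x. x ^ m)"
    and bound: "\<And>n. (\<integral>x. x ^ (2 * m) \<partial>N n) \<le> C"
    and conv: "weak_conv_m N std_normal_distribution"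
  shows "(\<lambda>n. \<integral>x. x ^ m \<partial>N n) \<longlonglongrightarrow> gaussian_moment m"
proof (cases "m = 0")
  case True
  have "prob_space (N n)" for n using N[of n] by (simp add: real_distribution_def)
  then show ?thesis using True by (simp add: prob_space.prob_space)
next
  case False
  define D where "D = max 0 (max C (gaussian_moment (2 * m)))"
  have D: "0 \<le> D" "C \<le> D" "gaussian_moment (2 * m) \<le> D" by (auto simp: D_def)
  show ?thesis
  proof (rule LIMSEQ_I)
    fix e :: real assume e: "0 < e"
    \<comment> \<open>\<open>D\<close> dominates the moments of order \<open>2 * m\<close> of all
      the laws, the limit included. As \<open>m\<close> is positive, \<open>T ^ m \<ge> T\<close>,
      and this \<open>T\<close> brings the truncation error \<open>2 * D / T\<close> below
      \<open>e / 3\<close>. For \<open>m = 0\<close> a larger \<open>T\<close> would gain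
      nothing.\<close>
    define T where "T = 1 + 6 * D / e"
    have "0 \<le> 6 * D / e" using e D by simp
    then have T: "1 \<le> T" "0 < T" by (auto simp: T_def)
    have "T ^ 1 \<le> T ^ m" using T(1) False by (intro power_increasing) auto
    then have "2 * (D / T ^ m) \<le> 2 * (D / T)"
      using D T by (intro mult_left_mono divide_left_mono) auto
    also have "\<dots> < e / 3" using e T D by (simp add: T_def field_simps)
    finally have small: "2 * (D / T ^ m) < e / 3" .
    define f where "f x = (max (- T) (min T x)) ^ m" for x
    have err: "\<bar>(\<integral>x. x ^ m \<partial>N n) - integral\<^sup>L (N n) f\<bar> < e / 3" for n
    proof -
      have "\<bar>(\<integral>x. x ^ m \<partial>N n) - integral\<^sup>L (N n) f\<bar> \<le> 2 * ((\<integral>x. x ^ (2 * m) \<partial>N n) / T ^ m)"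
        unfolding f_def[abs_def] by (intro real_distribution_clamp_error N int T)
      also have "\<dots> \<le> 2 * (D / T ^ m)"
        using bound[of n] D T by (intro mult_left_mono divide_right_mono) auto
      finally show ?thesis using small by simp
    qed
    have err': "\<bar>gaussian_moment m - integral\<^sup>L std_normal_distribution f\<bar> < e / 3"
    proof -
      have "\<bar>gaussian_moment m - integral\<^sup>L std_normal_distribution f\<bar> \<le> 2 * (gaussian_moment (2 * m) / T ^ m)"
        using real_distribution_clamp_error[OF real_dist_normal_dist, of m T] std_normal_moment[of m]
          std_normal_moment[of "2 * m"] T unfolding f_def[abs_def]
        by (simp add: has_bochner_integral_iff)
      also have "\<dots> \<le> 2 * (D / T ^ m)"
        using D T by (intro mult_left_mono divide_right_mono) auto
      finally show ?thesis using small by simp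
    qed
    have "(\<lambda>n. integral\<^sup>L (N n) f) \<longlonglongrightarrow> integral\<^sup>L std_normal_distribution f"
    proof (rule weak_conv_imp_integral_bdd_continuous_conv[OF N real_dist_normal_dist conv])
      show "isCont f x" for x unfolding f_def[abs_def] by (intro continuous_intros)
      show "norm (f x) \<le> T ^ m" for x
        unfolding f_def real_norm_def power_abs using T by (intro power_mono) auto
    qed
    then obtain n0 where n0: "\<And>n. n \<ge> n0 \<Longrightarrow> \<bar>integral\<^sup>L (N n) f - integral\<^sup>L std_normal_distribution f\<bar> < e / 3"
      using e unfolding LIMSEQ_iff by (metis divide_pos_pos real_norm_def zero_less_numeral)
    show "\<exists>n0. \<forall>n\<ge>n0. norm ((\<integral>x. x ^ m \<partial>N n) - gaussian_moment m) < e"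
    proof (intro exI allI impI)
      fix n assume "n0 \<le> n"
      from n0[OF this] err[of n] err' show "norm ((\<integral>x. x ^ m \<partial>N n) - gaussian_moment m) < e"
        unfolding real_norm_def by linarith
    qed
  qed
qed

text \<open>This is why the normal law is determined by its moments: the factorial in
  \<open>gaussian_moment_even\<close> cancels the one from the Taylor expansion and leaves a term of
  an exponential series.\<close>

lemma gaussian_taylor_remainder_tendsto_0:
  "(\<lambda>p. 2 * \<bar>t\<bar> ^ (2 * p) / fact (2 * p) * gaussian_moment (2 * p)) \<longlonglongrightarrow> 0"
proof -
  have "2 * \<bar>t\<bar> ^ (2 * p) / fact (2 * p) * gaussian_moment (2 * p) = 2 * (inverse (fact p) * (t\<^sup>2 / 2) ^ p)" for p
  proof -
    have "\<bar>t\<bar> ^ (2 * p) = (t\<^sup>2) ^ p" by (simp add: power_mult)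
    then show ?thesis
      unfolding gaussian_moment_even by (simp add: power_divide field_simps)
  qed
  moreover have "(\<lambda>p. 2 * (inverse (fact p) * (t\<^sup>2 / 2) ^ p)) \<longlonglongrightarrow> 2 * 0"
    by (intro tendsto_mult_left summable_LIMSEQ_zero summable_exp)
  ultimately show ?thesis by simp
qed

text \<open>By Levy's theorem it suffices to treat characteristic functions, which are expanded to
  order \<open>2 * p\<close>. The order is chosen from the Gaussian moments alone; afterwards only
  finitely many moments have to converge, including the one that controls the Taylor
  remainder.\<close>

lemma moments_imp_weak_conv:
  fixes N :: "nat \<Rightarrow> real measure"
  assumes N: "\<And>n. real_distribution (N n)"
    and int: "\<And>n m. integrable (N n) (\<lambda>x. x ^ m)"
    and conv: "\<And>m. (\<lambda>n. \<integral>x. x ^ m \<partial>N n) \<longlonglongrightarrow> gaussian_moment m"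
  shows "weak_conv_m N std_normal_distribution"
proof (rule levy_continuity[OF N real_dist_normal_dist])
  fix t :: real
  let ?N = "std_normal_distribution"
  have Nint: "integrable ?N (\<lambda>x. x ^ m)" "(\<integral>x. x ^ m \<partial>?N) = gaussian_moment m" for m
    using std_normal_moment[of m] by (auto simp: has_bochner_integral_iff)
  show "(\<lambda>n. char (N n) t) \<longlonglongrightarrow> char ?N t"
  proof (rule LIMSEQ_I)
    fix e :: real assume e: "0 < e"
    have "eventually (\<lambda>p. 2 * \<bar>t\<bar> ^ (2 * p) / fact (2 * p) * gaussian_moment (2 * p) < e / 4) sequentially"
      using e by (intro order_tendstoD(2)[OF gaussian_taylor_remainder_tendsto_0]) auto
    then obtain p where p: "2 * \<bar>t\<bar> ^ (2 * p) / fact (2 * p) * gaussian_moment (2 * p) < e / 4"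
      by (auto simp: eventually_sequentially)
    define c where "c = 2 * \<bar>t\<bar> ^ (2 * p) / fact (2 * p)"
    define a where "a m = ((\<i> * t) ^ m / fact m :: complex)" for m
    have approx: "cmod (char L t - (\<Sum>m\<le>2 * p. a m * (\<integral>x. x ^ m \<partial>L))) \<le> c * (\<integral>x. x ^ (2 * p) \<partial>L)"
      if "real_distribution L" "\<And>m. integrable L (\<lambda>x. x ^ m)" for L
      using real_distribution.char_approx1[OF that, where n = "2 * p" and t = t]
      by (simp add: a_def c_def power_even_abs mult.commute)
    define bd where "bd n = c * (\<integral>x. x ^ (2 * p) \<partial>N n) +
      (\<Sum>m\<le>2 * p. cmod (a m) * \<bar>(\<integral>x. x ^ m \<partial>N n) - gaussian_moment m\<bar>) + c * gaussian_moment (2 * p)" for n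
    have "bd \<longlonglongrightarrow> c * gaussian_moment (2 * p) +
        (\<Sum>m\<le>2 * p. cmod (a m) * \<bar>gaussian_moment m - gaussian_moment m\<bar>) + c * gaussian_moment (2 * p)"
      unfolding bd_def by (intro tendsto_intros conv)
    moreover have "c * gaussian_moment (2 * p) +
        (\<Sum>m\<le>2 * p. cmod (a m) * \<bar>gaussian_moment m - gaussian_moment m\<bar>) + c * gaussian_moment (2 * p) < e"
      using p e unfolding c_def[symmetric] by simp
    ultimately have "eventually (\<lambda>n. bd n < e) sequentially"
      by (rule order_tendstoD(2))
    moreover have "norm (char (N n) t - char ?N t) \<le> bd n" for n
    proof -
      let ?S = "\<lambda>L. \<Sum>m\<le>2 * p. a m * complex_of_real (\<integral>x. x ^ m \<partial>L)"
      have "?S (N n) - ?S ?N = (\<Sum>m\<le>2 * p. a m * complex_of_real ((\<integral>x. x ^ m \<partial>N n) - gaussian_moment m))"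
        by (simp add: Nint algebra_simps sum_subtractf)
      then have "cmod (?S (N n) - ?S ?N) \<le> (\<Sum>m\<le>2 * p. cmod (a m) * \<bar>(\<integral>x. x ^ m \<partial>N n) - gaussian_moment m\<bar>)"
        by (simp only:) (rule order_trans[OF norm_sum], simp only: norm_mult norm_of_real order_refl)
      moreover have "cmod (char (N n) t - ?S (N n)) \<le> c * (\<integral>x. x ^ (2 * p) \<partial>N n)"
        by (intro approx N int)
      moreover have "cmod (char ?N t - ?S ?N) \<le> c * gaussian_moment (2 * p)"
        using approx[OF real_dist_normal_dist Nint(1)] by (simp add: Nint(2))
      moreover have "char (N n) t - char ?N t =
          (char (N n) t - ?S (N n)) + (?S (N n) - ?S ?N) - (char ?N t - ?S ?N)" by simp
      then have "cmod (char (N n) t - char ?N t) \<le>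
          cmod (char (N n) t - ?S (N n)) + cmod (?S (N n) - ?S ?N) + cmod (char ?N t - ?S ?N)"
        by (smt (verit) norm_triangle_ineq norm_triangle_ineq4)
      ultimately show ?thesis unfolding bd_def by linarith
    qed
    ultimately have "eventually (\<lambda>n. norm (char (N n) t - char ?N t) < e) sequentially"
      by (elim eventually_mono) (rule order.strict_trans1)
    then show "\<exists>n0. \<forall>n\<ge>n0. norm (char (N n) t - char ?N t) < e"
      by (simp add: eventually_sequentially)
  qed
qed

section \<open>Convergence in law along a real parameter\<close>

lemma converges_in_distribution_iff_sequentially:
  "converges_in_distribution M Z N \<longleftrightarrow>
     (\<forall>T :: nat \<Rightarrow> real. filterlim T at_top sequentially \<longrightarrow> weak_conv_m (\<lambda>n. distr M borel (Z (T n))) N)"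
  (is "?l \<longleftrightarrow> ?r")
proof
  assume ?l
  then show ?r
    unfolding converges_in_distribution_def weak_conv_m_def weak_conv_def
    by (auto intro: filterlim_compose)
next
  assume ?r
  then show ?l
    unfolding converges_in_distribution_def weak_conv_m_def weak_conv_def
    by (intro allI impI tendsto_at_topI_sequentially) auto
qed

lemma weak_conv_m_cong_eventually:
  assumes "eventually (\<lambda>n. N n = N' n) sequentially" "weak_conv_m N L"
  shows "weak_conv_m N' L"
  unfolding weak_conv_m_def weak_conv_def
proof (intro allI impI)
  fix x assume "isCont (cdf L) x"
  then have "(\<lambda>n. cdf (N n) x) \<longlonglongrightarrow> cdf L x"
    using assms(2) by (simp add: weak_conv_m_def weak_conv_def)
  then show "(\<lambda>n. cdf (N' n) x) \<longlonglongrightarrow> cdf L x"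
    by (rule Lim_transform_eventually) (use assms(1) in eventually_elim, simp)
qed

theorem (in prob_space) converges_in_distribution_iff_moments:
  assumes Z [measurable]: "\<And>t. 0 < t \<Longrightarrow> Z t \<in> borel_measurable M"
    and int: "\<And>t m. 0 < t \<Longrightarrow> integrable M (\<lambda>\<omega>. Z t \<omega> ^ m)"
    and bound: "\<And>t m. 0 < t \<Longrightarrow> expectation (\<lambda>\<omega>. Z t \<omega> ^ m) \<le> C m"
  shows "converges_in_distribution M Z std_normal_distribution \<longleftrightarrow>
    (\<forall>m. ((\<lambda>t. expectation (\<lambda>\<omega>. Z t \<omega> ^ m)) \<longlongrightarrow> gaussian_moment m) at_top)"
proof -
  have distr: "real_distribution (distr M borel (Z t))"
    "integrable (distr M borel (Z t)) (\<lambda>x. x ^ m)"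
    "(\<integral>x. x ^ m \<partial>distr M borel (Z t)) = expectation (\<lambda>\<omega>. Z t \<omega> ^ m)" if "0 < t" for t m
    using that Z[OF that] int[OF that] by (auto simp: integrable_distr_eq integral_distr)
  \<comment> \<open>The hypotheses concern positive parameters only, whereas the sequential results
    need them at every index. A sequence tending to infinity eventually equals its maximum with
    1.\<close>
  have ev: "eventually (\<lambda>n. T n = max 1 (T n)) sequentially" if "filterlim T at_top sequentially" for T :: "nat \<Rightarrow> real"
    using filterlim_at_top[THEN iffD1, OF that, THEN spec, of 1] by eventually_elim simp
  show ?thesis
    unfolding converges_in_distribution_iff_sequentially
  proof (intro iffI allI impI)
    fix m assume L: "\<forall>T. filterlim T at_top sequentially \<longrightarrow> weak_conv_m (\<lambda>n. distr M borel (Z (T n))) std_normal_distribution"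
    show "((\<lambda>t. expectation (\<lambda>\<omega>. Z t \<omega> ^ m)) \<longlongrightarrow> gaussian_moment m) at_top"
    proof (rule tendsto_at_topI_sequentially)
      fix T :: "nat \<Rightarrow> real" assume T: "filterlim T at_top sequentially"
      have "weak_conv_m (\<lambda>n. distr M borel (Z (max 1 (T n)))) std_normal_distribution"
        by (rule weak_conv_m_cong_eventually[OF _ L[rule_format, OF T]]) (use ev[OF T] in eventually_elim, simp)
      then have "(\<lambda>n. \<integral>x. x ^ m \<partial>distr M borel (Z (max 1 (T n)))) \<longlonglongrightarrow> gaussian_moment m"
        using distr bound by (intro weak_conv_imp_moments[where C = "C (2 * m)"]) auto
      then have "(\<lambda>n. expectation (\<lambda>\<omega>. Z (max 1 (T n)) \<omega> ^ m)) \<longlonglongrightarrow> gaussian_moment m"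
        by (simp add: distr)
      then show "(\<lambda>n. expectation (\<lambda>\<omega>. Z (T n) \<omega> ^ m)) \<longlonglongrightarrow> gaussian_moment m"
        by (rule Lim_transform_eventually) (use ev[OF T] in eventually_elim, simp)
    qed
  next
    fix T :: "nat \<Rightarrow> real"
    assume R: "\<forall>m. ((\<lambda>t. expectation (\<lambda>\<omega>. Z t \<omega> ^ m)) \<longlongrightarrow> gaussian_moment m) at_top"
      and T: "filterlim T at_top sequentially"
    have "weak_conv_m (\<lambda>n. distr M borel (Z (max 1 (T n)))) std_normal_distribution"
    proof (rule moments_imp_weak_conv)
      fix m
      have "(\<lambda>n. expectation (\<lambda>\<omega>. Z (T n) \<omega> ^ m)) \<longlonglongrightarrow> gaussian_moment m"
        using R T by (auto intro: filterlim_compose)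
      then have "(\<lambda>n. expectation (\<lambda>\<omega>. Z (max 1 (T n)) \<omega> ^ m)) \<longlonglongrightarrow> gaussian_moment m"
        by (rule Lim_transform_eventually) (use ev[OF T] in eventually_elim, simp)
      then show "(\<lambda>n. \<integral>x. x ^ m \<partial>distr M borel (Z (max 1 (T n)))) \<longlonglongrightarrow> gaussian_moment m"
        by (simp add: distr)
    qed (auto intro: distr)
    then show "weak_conv_m (\<lambda>n. distr M borel (Z (T n))) std_normal_distribution"
      by (rule weak_conv_m_cong_eventually[rotated]) (use ev[OF T] in eventually_elim, simp)
  qed
qed

section \<open>Continuous Gaussian fields\<close>

lemma gaussian_rv_integrable:
  assumes "gaussian_rv M X"
  shows "integrable M X"
proof -
  obtain m s where X: "X \<in> borel_measurable M"
    and distr: "distr M borel X = distr std_normal_distribution borel (\<lambda>z. m + s * z)"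
    using assms unfolding gaussian_rv_def by blast
  have "has_bochner_integral lborel (\<lambda>z. m * std_normal_density z + s * (std_normal_density z * z)) (m * 1 + s * 0)"
    by (intro has_bochner_integral_add has_bochner_integral_mult_right std_normal_first_moments)
  then have "integrable lborel (\<lambda>z. std_normal_density z * (m + s * z))"
    by (simp add: algebra_simps has_bochner_integral_iff)
  with integrable_gaussian_iff[OF X distr, of "\<lambda>x. x"] show ?thesis by simp
qed

lemma gaussian_field_reindex:
  fixes g :: "'y \<Rightarrow> 'x"
  assumes "gaussian_field M B" "inj g"
  shows "gaussian_field M (\<lambda>x. B (g x))"
  unfolding gaussian_field_def
proof (intro allI impI)
  fix F :: "'y set" and a :: "'y \<Rightarrow> real" assume F: "finite F"
  have inj: "inj_on g F" using assms(2) by (rule inj_on_subset) simp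
  have "(\<Sum>y\<in>g ` F. a (inv g y) * B y w) = (\<Sum>x\<in>F. a x * B (g x) w)" for w
    by (simp add: sum.reindex[OF inj] inv_f_f[OF assms(2)])
  moreover have "gaussian_rv M (\<lambda>w. \<Sum>y\<in>g ` F. a (inv g y) * B y w)"
    using assms(1)[unfolded gaussian_field_def, rule_format, of "g ` F" "\<lambda>y. a (inv g y)"] F by simp
  ultimately show "gaussian_rv M (\<lambda>w. \<Sum>x\<in>F. a x * B (g x) w)" by simp
qed

text \<open>The point \<open>x\<close> is approximated by simple functions of itself. Along each of
  them \<open>f\<close> is a finite sum of products of measurable functions, and continuity in
  \<open>x\<close> gives the limit.\<close>

lemma caratheodory_measurable:
  fixes f :: "'x::euclidean_space \<Rightarrow> 'w \<Rightarrow> real"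
  assumes meas [measurable]: "\<And>x. f x \<in> borel_measurable M"
    and cont: "\<And>w. w \<in> space M \<Longrightarrow> continuous_on UNIV (\<lambda>x. f x w)"
  shows "(\<lambda>(x, w). f x w) \<in> borel_measurable (borel \<Otimes>\<^sub>M M)"
proof -
  obtain F :: "nat \<Rightarrow> 'x \<Rightarrow> 'x" where F: "\<And>i. simple_function borel (F i)"
    and lim: "\<And>x. (\<lambda>i. F i x) \<longlonglongrightarrow> x"
    using borel_measurable_implies_sequence_metric[of "\<lambda>x :: 'x. x" borel 0] by auto
  show ?thesis
  proof (rule borel_measurable_LIMSEQ_real)
    fix z assume z: "z \<in> space ((borel :: 'x measure) \<Otimes>\<^sub>M M)"
    then have "snd z \<in> space M" by (auto simp: space_pair_measure)
    then have "isCont (\<lambda>x. f x (snd z)) (fst z)"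
      using cont by (simp add: continuous_on_eq_continuous_at)
    then show "(\<lambda>i. f (F i (fst z)) (snd z)) \<longlonglongrightarrow> (case z of (x, w) \<Rightarrow> f x w)"
      using isCont_tendsto_compose[OF _ lim[of "fst z"], of "\<lambda>x. f x (snd z)"] by (simp add: case_prod_beta)
  next
    fix i
    have fin: "finite (range (F i))"
      using F[of i] by (simp add: simple_function_def)
    have [measurable]: "F i -` {y} \<in> sets borel" for y
      using measurable_sets[OF measurable_simple_function[OF F[of i]], of "{y}"] by simp
    have "f (F i (fst z)) (snd z) = (\<Sum>y\<in>range (F i). indicator (F i -` {y}) (fst z) * f y (snd z))" for z
    proof -
      have "(\<Sum>y\<in>range (F i). indicator (F i -` {y}) (fst z) * f y (snd z)) =
         (\<Sum>y\<in>range (F i). if y = F i (fst z) then f y (snd z) else 0)"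
        by (intro sum.cong) (auto simp: indicator_def)
      then show ?thesis using fin by simp
    qed
    then show "(\<lambda>z. f (F i (fst z)) (snd z)) \<in> borel_measurable (borel \<Otimes>\<^sub>M M)"
      by simp measurable
  qed
qed

text \<open>Averages replace integrals over \<open>S\<close>: the volume is a positive constant,
  which standardization removes, and the kernel estimates are set on probability spaces.\<close>

definition uniform_on :: "'x::euclidean_space set \<Rightarrow> 'x measure" where
  "uniform_on S = uniform_measure lborel S"

lemma sets_uniform_on [measurable_cong, simp]: "sets (uniform_on S) = sets borel"
  and space_uniform_on [simp]: "space (uniform_on S) = UNIV"
  by (simp_all add: uniform_on_def)

lemma emeasure_lborel_compact_pos:
  assumes "compact (S :: 'x::euclidean_space set)" "0 < measure lborel S"
  shows "emeasure lborel S = ennreal (measure lborel S)" "S \<in> sets borel"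
    "emeasure lborel S \<noteq> 0" "emeasure lborel S \<noteq> \<infinity>"
proof -
  show fin: "emeasure lborel S \<noteq> \<infinity>"
    using emeasure_compact_finite[OF assms(1)] by simp
  then show "emeasure lborel S = ennreal (measure lborel S)"
    by (simp add: emeasure_eq_ennreal_measure)
  with assms(2) show "emeasure lborel S \<noteq> 0" by simp
  show "S \<in> sets borel" using assms(1) by (simp add: borel_compact)
qed

lemma prob_space_uniform_on:
  assumes "compact S" "0 < measure lborel S"
  shows "prob_space (uniform_on S)"
  unfolding uniform_on_def using emeasure_lborel_compact_pos[OF assms]
  by (intro prob_space_uniform_measure) auto

lemma AE_uniform_on:
  assumes "compact S" "0 < measure lborel S"
  shows "AE x in uniform_on S. x \<in> S"
  unfolding uniform_on_def using emeasure_lborel_compact_pos[OF assms]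
  by (intro AE_uniform_measureI) auto

lemma integral_uniform_on:
  fixes f :: "'x::euclidean_space \<Rightarrow> real"
  assumes S: "compact S" "0 < measure lborel S" and f: "f \<in> borel_measurable borel"
  shows "(LINT x:S|lborel. f x) = measure lborel S * integral\<^sup>L (uniform_on S) f"
proof -
  note S' = emeasure_lborel_compact_pos[OF S]
  have "uniform_on S = density lborel (\<lambda>x. ennreal (indicator S x / measure lborel S))"
    unfolding uniform_on_def uniform_measure_def S'(1) using S(2)
    by (intro arg_cong2[where f = density] refl ext)
      (auto simp: indicator_def divide_ennreal[symmetric] simp flip: ennreal_1)
  then have "integral\<^sup>L (uniform_on S) f = (\<integral>x. (indicator S x / measure lborel S) * f x \<partial>lborel)"
    using f S'(2) by (simp add: integral_density)
  also have "\<dots> = (\<integral>x. indicator S x * f x / measure lborel S \<partial>lborel)"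
    by simp
  also have "\<dots> = (LINT x:S|lborel. f x) / measure lborel S"
    by (simp add: set_lebesgue_integral_def)
  finally show ?thesis using S(2) by simp
qed

lemma standardize_scale:
  assumes "0 < c"
  shows "standardize M (\<lambda>w. c * Z w) = standardize M Z"
proof -
  have "variance_of M (\<lambda>w. c * Z w) = c\<^sup>2 * variance_of M Z"
  proof -
    have "variance_of M (\<lambda>w. c * Z w) = (\<integral>w. c\<^sup>2 * (Z w - (\<integral>w'. Z w' \<partial>M))\<^sup>2 \<partial>M)"
      unfolding variance_of_def by (simp add: power_mult_distrib[symmetric] right_diff_distrib)
    then show ?thesis by (simp add: variance_of_def)
  qed
  then have "sqrt (variance_of M (\<lambda>w. c * Z w)) = c * sqrt (variance_of M Z)"
    using assms by (simp add: real_sqrt_mult)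
  then show ?thesis
    using assms by (simp add: standardize_def right_diff_distrib[symmetric])
qed

lemma standardize_cong:
  assumes "\<And>w. w \<in> space M \<Longrightarrow> Z w = Z' w" "w \<in> space M"
  shows "standardize M Z w = standardize M Z' w"
proof -
  have "integral\<^sup>L M Z = integral\<^sup>L M Z'"
    using assms(1) by (intro Bochner_Integration.integral_cong) auto
  moreover from this have "variance_of M Z = variance_of M Z'"
    unfolding variance_of_def using assms(1) by (intro Bochner_Integration.integral_cong) auto
  ultimately show ?thesis using assms by (simp add: standardize_def)
qed

lemma converges_in_distribution_cong:
  assumes "\<And>t w. 0 < t \<Longrightarrow> w \<in> space M \<Longrightarrow> Z t w = Z' t w"
  shows "converges_in_distribution M Z N \<longleftrightarrow> converges_in_distribution M Z' N"
proof -
  have "eventually (\<lambda>t. cdf (distr M borel (Z t)) x = cdf (distr M borel (Z' t)) x) at_top" for x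
    using eventually_gt_at_top[of 0]
  proof eventually_elim
    fix t :: real assume "0 < t"
    then have "distr M borel (Z t) = distr M borel (Z' t)"
      using assms by (intro distr_cong) auto
    then show "cdf (distr M borel (Z t)) x = cdf (distr M borel (Z' t)) x" by simp
  qed
  then show ?thesis
    unfolding converges_in_distribution_def by (auto intro!: all_cong imp_cong tendsto_cong)
qed

locale continuous_gaussian_field = prob_space M for M :: "'w measure" +
  fixes B :: "'x::euclidean_space \<Rightarrow> 'w \<Rightarrow> real" and C :: "'x \<Rightarrow> real" and q :: nat
  assumes gaussian: "gaussian_field M B"
    and continuous: "\<And>w. w \<in> space M \<Longrightarrow> continuous_on UNIV (\<lambda>x. B x w)"
    and centered: "\<And>x. expectation (B x) = 0"
    and covariance: "\<And>x y. covariance_of M (B x) (B y) = C (x - y)"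
    and C_pos: "\<And>x. 0 < C x" and C_le_1: "\<And>x. C x \<le> 1" and C_0: "C 0 = 1"
    and q_pos: "0 < q"
begin

definition V :: "('w \<Rightarrow> real) set" where
  "V = {\<lambda>w. \<Sum>x\<in>F. a x * B x w | F a. finite F}"

lemma B_in_V: "B x \<in> V"
  unfolding V_def by (rule CollectI, rule exI[of _ "{x}"], rule exI[of _ "\<lambda>_. 1"]) auto

lemma gaussian_V: "S \<in> V \<Longrightarrow> gaussian_rv M S"
  unfolding V_def using gaussian[unfolded gaussian_field_def, rule_format] by auto

lemma integrable_B: "integrable M (B x)"
  by (rule gaussian_rv_integrable[OF gaussian_V[OF B_in_V]])

lemma B_measurable [measurable]: "B x \<in> borel_measurable M"
  by (rule borel_measurable_integrable[OF integrable_B])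

sublocale centered_gaussian_space M V
proof
  fix S T assume "S \<in> V" "T \<in> V"
  then obtain F a G b where S: "S = (\<lambda>w. \<Sum>x\<in>F. a x * B x w)" "finite F"
    and T: "T = (\<lambda>w. \<Sum>x\<in>G. b x * B x w)" "finite G"
    unfolding V_def by blast
  define c where "c x = (if x \<in> F then a x else 0) + (if x \<in> G then b x else 0)" for x
  have "S w + T w = (\<Sum>x\<in>F \<union> G. c x * B x w)" for w
  proof -
    have "S w = (\<Sum>x\<in>F \<union> G. (if x \<in> F then a x else 0) * B x w)"
      unfolding S(1) using S(2) T(2) by (intro sum.mono_neutral_cong_left) auto
    moreover have "T w = (\<Sum>x\<in>F \<union> G. (if x \<in> G then b x else 0) * B x w)"
      unfolding T(1) using S(2) T(2) by (intro sum.mono_neutral_cong_left) auto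
    ultimately show ?thesis by (simp add: c_def distrib_right sum.distrib)
  qed
  then show "(\<lambda>w. S w + T w) \<in> V"
    unfolding V_def using S(2) T(2) by auto
next
  fix S c assume "S \<in> V"
  then obtain F a where S: "S = (\<lambda>w. \<Sum>x\<in>F. a x * B x w)" "finite F"
    unfolding V_def by blast
  have "(\<lambda>w. c * S w) = (\<lambda>w. \<Sum>x\<in>F. (c * a x) * B x w)"
    by (simp add: S(1) sum_distrib_left mult.assoc)
  then show "(\<lambda>w. c * S w) \<in> V"
    unfolding V_def using S(2) by auto
next
  fix S assume "S \<in> V"
  then show "gaussian_rv M S" by (rule gaussian_V)
  from \<open>S \<in> V\<close> obtain F a where S: "S = (\<lambda>w. \<Sum>x\<in>F. a x * B x w)" "finite F"
    unfolding V_def by blast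
  then show "expectation S = 0"
    using integrable_B by (simp add: centered)
qed

lemma cov_B: "cov (B x) (B y) = C (x - y)"
  using covariance[of x y] by (simp add: covariance_of_def cov_def centered)

lemma C_sym: "C (x - y) = C (y - x)"
  unfolding cov_B[symmetric] by (simp add: cov_def mult.commute)

lemma B_joint_measurable [measurable]: "(\<lambda>(x, w). B x w) \<in> borel_measurable (borel \<Otimes>\<^sub>M M)"
  by (rule caratheodory_measurable) (use continuous in auto)

text \<open>The covariance is the expectation of a product of values of a jointly measurable field,
  so its measurability comes from integrating out the randomness.\<close>

lemma C_measurable [measurable]: "(\<lambda>(x, y). C (x - y)) \<in> borel_measurable (borel \<Otimes>\<^sub>M borel)"
proof -
  have 1: "(\<lambda>z. B (fst (fst z)) (snd z)) \<in> borel_measurable ((borel \<Otimes>\<^sub>M borel) \<Otimes>\<^sub>M M)"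
    using measurable_compose[OF measurable_Pair[of "\<lambda>z. fst (fst z)" "(borel \<Otimes>\<^sub>M borel) \<Otimes>\<^sub>M M" borel snd M] B_joint_measurable]
    by simp
  have 2: "(\<lambda>z. B (snd (fst z)) (snd z)) \<in> borel_measurable ((borel \<Otimes>\<^sub>M borel) \<Otimes>\<^sub>M M)"
    using measurable_compose[OF measurable_Pair[of "\<lambda>z. snd (fst z)" "(borel \<Otimes>\<^sub>M borel) \<Otimes>\<^sub>M M" borel snd M] B_joint_measurable]
    by simp
  have "(\<lambda>z. expectation (\<lambda>w. B (fst z) w * B (snd z) w)) \<in> borel_measurable (borel \<Otimes>\<^sub>M borel)"
    by (rule borel_measurable_lebesgue_integral) (use 1 2 in \<open>simp add: case_prod_beta\<close>)
  then show ?thesis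
    by (simp add: case_prod_beta cov_B[symmetric] cov_def)
qed

abbreviation kernel :: "'x \<Rightarrow> 'x \<Rightarrow> real" where
  "kernel x y \<equiv> C (x - y)"

lemma positive_kernel:
  assumes "compact S" "0 < measure lborel S"
  shows "positive_kernel (uniform_on S) kernel 1"
proof -
  interpret U: prob_space "uniform_on S" using assms by (rule prob_space_uniform_on)
  have "sets (uniform_on S \<Otimes>\<^sub>M uniform_on S) = sets (borel \<Otimes>\<^sub>M borel)"
    by (intro sets_pair_measure_cong) auto
  then show ?thesis
    using C_measurable C_sym C_pos C_le_1
    by unfold_locales (auto cong: measurable_cong_sets)
qed

lemma gaussian_functional:
  assumes "compact S" "0 < measure lborel S"
  shows "gaussian_functional M V (uniform_on S) kernel 1 B q"
proof -
  interpret U: positive_kernel "uniform_on S" kernel 1 using assms by (rule positive_kernel)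
  have "sets (uniform_on S \<Otimes>\<^sub>M M) = sets (borel \<Otimes>\<^sub>M M)"
    by (intro sets_pair_measure_cong) auto
  then have "(\<lambda>(x, w). B x w) \<in> borel_measurable (uniform_on S \<Otimes>\<^sub>M M)"
    using B_joint_measurable by (simp cong: measurable_cong_sets)
  then show ?thesis
    using B_in_V cov_B C_0 q_pos by unfold_locales auto
qed

text \<open>The amount by which the standardized \<open>m\<close>-th moment of the functional over
  \<open>S\<close> exceeds that of the standard normal law.\<close>

definition defect :: "nat \<Rightarrow> 'x set \<Rightarrow> real" where
  "defect m S = positive_kernel.remainder_moment (uniform_on S) kernel q m / positive_kernel.scale (uniform_on S) kernel q ^ m"

lemma defect_nonneg:
  assumes "compact S" "0 < measure lborel S"
  shows "0 \<le> defect m S"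
proof -
  interpret U: positive_kernel "uniform_on S" kernel 1 using assms by (rule positive_kernel)
  show ?thesis
    unfolding defect_def using U.remainder_moment_nonneg[OF q_pos] U.scale_pos by (simp add: less_imp_le)
qed

theorem converges_iff_defect:
  assumes S: "\<And>t. 0 < t \<Longrightarrow> compact (S t)" "\<And>t. 0 < t \<Longrightarrow> 0 < measure lborel (S t)"
  shows "converges_in_distribution M (\<lambda>t. standardize M (hermite_functional B q (S t))) std_normal_distribution \<longleftrightarrow>
    (\<forall>m. ((\<lambda>t. defect m (S t)) \<longlongrightarrow> 0) at_top)"
proof -
  define Z where "Z t = gaussian_functional.Y (uniform_on (S t)) B q" for t
  have "standardize M (hermite_functional B q (S t)) w = standardize M (Z t) w" if t: "0 < t" and w: "w \<in> space M" for t w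
  proof -
    interpret F: gaussian_functional M V "uniform_on (S t)" kernel 1 B q
      using S[OF t] by (rule gaussian_functional)
    have "hermite_functional B q (S t) w = measure lborel (S t) * Z t w" if "w \<in> space M" for w
    proof -
      have "(\<lambda>x. B x w) \<in> borel_measurable borel"
        using continuous[OF that] by (rule borel_measurable_continuous_onI)
      then have "(\<lambda>x. hermite q (B x w)) \<in> borel_measurable borel" by measurable
      then show ?thesis
        unfolding hermite_functional_def Z_def F.Y_def by (rule integral_uniform_on[OF S[OF t]])
    qed
    then have "standardize M (hermite_functional B q (S t)) w = standardize M (\<lambda>w. measure lborel (S t) * Z t w) w"
      using w by (rule standardize_cong)
    then show ?thesis by (simp only: standardize_scale[OF S(2)[OF t]])
  qed
  then have "converges_in_distribution M (\<lambda>t. standardize M (hermite_functional B q (S t))) std_normal_distribution \<longleftrightarrow>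
      converges_in_distribution M (\<lambda>t. standardize M (Z t)) std_normal_distribution"
    by (rule converges_in_distribution_cong)
  also have "\<dots> \<longleftrightarrow> (\<forall>m. ((\<lambda>t. expectation (\<lambda>w. standardize M (Z t) w ^ m)) \<longlongrightarrow> gaussian_moment m) at_top)"
  proof (rule converges_in_distribution_iff_moments)
    fix t m assume t: "0 < (t :: real)"
    interpret F: gaussian_functional M V "uniform_on (S t)" kernel 1 B q
      using S[OF t] by (rule gaussian_functional)
    show "standardize M (Z t) \<in> borel_measurable M" "integrable M (\<lambda>w. standardize M (Z t) w ^ m)"
      "expectation (\<lambda>w. standardize M (Z t) w ^ m) \<le> wick (\<lambda>_ _. 1) (\<lambda>_. q) [0..<m]"
      unfolding Z_def by (rule F.standardize_Y_measurable F.moment_standardize)+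
  qed
  also have "\<dots> \<longleftrightarrow> (\<forall>m. ((\<lambda>t. defect m (S t)) \<longlongrightarrow> 0) at_top)"
  proof (intro all_cong1)
    fix m
    have "eventually (\<lambda>t. expectation (\<lambda>w. standardize M (Z t) w ^ m) = gaussian_moment m + defect m (S t)) at_top"
      using eventually_gt_at_top[of 0]
    proof eventually_elim
      fix t :: real assume t: "0 < t"
      interpret F: gaussian_functional M V "uniform_on (S t)" kernel 1 B q
        using S[OF t] by (rule gaussian_functional)
      show "expectation (\<lambda>w. standardize M (Z t) w ^ m) = gaussian_moment m + defect m (S t)"
        unfolding Z_def defect_def by (rule F.moment_standardize)
    qed
    then have "((\<lambda>t. expectation (\<lambda>w. standardize M (Z t) w ^ m)) \<longlongrightarrow> gaussian_moment m) at_top \<longleftrightarrow>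
      ((\<lambda>t. gaussian_moment m + defect m (S t)) \<longlongrightarrow> gaussian_moment m + 0) at_top"
      by (simp add: tendsto_cong)
    also have "\<dots> \<longleftrightarrow> ((\<lambda>t. defect m (S t)) \<longlongrightarrow> 0) at_top"
      by (rule tendsto_add_const_iff)
    finally show "((\<lambda>t. expectation (\<lambda>w. standardize M (Z t) w ^ m)) \<longlongrightarrow> gaussian_moment m) at_top \<longleftrightarrow>
      ((\<lambda>t. defect m (S t)) \<longlongrightarrow> 0) at_top" .
  qed
  finally show ?thesis .
qed

end

section \<open>Uniform measures and doubling\<close>

text \<open>As \<open>h\<close> transports \<open>\<nu>\<close> to \<open>\<nu>'\<close>, the energy
  of \<open>k'\<close> is a double integral over \<open>\<nu>\<close> of \<open>k'\<close> along
  \<open>h\<close>, where the kernels can be compared pointwise.\<close>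

lemma energy_lower_bound:
  assumes "positive_kernel \<nu> k B" "positive_kernel \<nu>' k' B'"
    and h [measurable]: "h \<in> measurable \<nu> \<nu>'" and distr: "distr \<nu> \<nu>' h = \<nu>'"
    and A: "AE u in \<nu>. u \<in> A" and c: "0 \<le> c"
    and le: "\<And>u v. u \<in> A \<Longrightarrow> v \<in> A \<Longrightarrow> c * k' (h u) (h v) \<le> k u v"
  shows "c ^ q * positive_kernel.energy \<nu>' k' q \<le> positive_kernel.energy \<nu> k q"
proof -
  interpret k: positive_kernel \<nu> k B by fact
  interpret k': positive_kernel \<nu>' k' B' by fact
  have row': "k'.row q u' = (\<integral>v. k' (h v) u' ^ q \<partial>\<nu>)" for u'
    unfolding k'.row_def by (subst distr[symmetric], subst integral_distr) auto
  have int_distr: "integrable (distr \<nu> \<nu>' h) (\<lambda>v. k' v u' ^ q)" for u'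
    unfolding distr by (rule k'.integrable_k_power)
  have int': "integrable \<nu> (\<lambda>v. k' (h v) u' ^ q)" for u'
    by (rule integrable_distr[OF h int_distr])
  have row_le: "AE u in \<nu>. c ^ q * k'.row q (h u) \<le> k.row q u"
    using A
  proof eventually_elim
    fix u assume u: "u \<in> A"
    have "c ^ q * k'.row q (h u) = (\<integral>v. (c * k' (h v) (h u)) ^ q \<partial>\<nu>)"
      by (simp add: row' power_mult_distrib)
    also have "\<dots> \<le> k.row q u"
      unfolding k.row_def
    proof (rule integral_mono_AE)
      show "integrable \<nu> (\<lambda>v. (c * k' (h v) (h u)) ^ q)"
        using int' by (simp add: power_mult_distrib)
      show "AE v in \<nu>. (c * k' (h v) (h u)) ^ q \<le> k v u ^ q"
        using A by eventually_elim (use u c le k'.k_pos in \<open>auto intro!: power_mono simp: less_imp_le\<close>)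
    qed (rule k.integrable_k_power)
    finally show "c ^ q * k'.row q (h u) \<le> k.row q u" .
  qed
  have int_row: "integrable \<nu> (\<lambda>u. k'.row q (h u))"
    using integrable_distr[OF h, of "k'.row q"] k'.integrable_row by (simp add: distr)
  have "c ^ q * k'.energy q = (\<integral>u. c ^ q * k'.row q (h u) \<partial>\<nu>)"
    unfolding k'.energy_eq by (subst distr[symmetric], subst integral_distr) auto
  also have "\<dots> \<le> k.energy q"
    unfolding k.energy_eq using int_row by (intro integral_mono_AE row_le k.integrable_row) auto
  finally show ?thesis .
qed

section \<open>Uniform measures under projections and dilations\<close>

lemma emeasure_lborel_Times:
  assumes "A \<in> sets borel" "B \<in> sets borel"
  shows "emeasure lborel ((A :: 'a::euclidean_space set) \<times> (B :: 'b::euclidean_space set)) = emeasure lborel A * emeasure lborel B"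
  using assms unfolding lborel_prod[symmetric] by (simp add: lborel.emeasure_pair_measure_Times)

lemma measure_lborel_Times_pos:
  assumes "compact A" "0 < measure lborel A" "compact B" "0 < measure lborel B"
  shows "0 < measure lborel ((A :: 'a::euclidean_space set) \<times> (B :: 'b::euclidean_space set))"
  using emeasure_lborel_compact_pos(2)[OF assms(1,2)] emeasure_lborel_compact_pos(2)[OF assms(3,4)] assms(2,4)
  unfolding measure_def by (simp add: emeasure_lborel_Times enn2real_mult)

lemma ennreal_divide_mult_left:
  fixes a x y :: ennreal
  shows "a \<noteq> 0 \<Longrightarrow> a \<noteq> \<infinity> \<Longrightarrow> (a * x) / (a * y) = x / y"
  unfolding mult.commute[of a] by (rule divide_mult_eq)

lemma distr_uniform_on_Times:
  fixes A :: "'a::euclidean_space set" and B :: "'b::euclidean_space set"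
  assumes A: "compact A" "0 < measure lborel A" and B: "compact B" "0 < measure lborel B"
  shows "distr (uniform_on (A \<times> B)) (uniform_on A) fst = uniform_on A"
    and "distr (uniform_on (A \<times> B)) (uniform_on B) snd = uniform_on B"
proof -
  note A' = emeasure_lborel_compact_pos[OF A] and B' = emeasure_lborel_compact_pos[OF B]
  have AB: "A \<times> B \<in> sets borel"
    using A(1) B(1) by (intro borel_compact compact_Times)
  have fst: "fst \<in> measurable (uniform_on (A \<times> B)) (uniform_on A)"
    and snd: "snd \<in> measurable (uniform_on (A \<times> B)) (uniform_on B)"
    by (simp_all add: borel_measurable_continuous_onI continuous_on_fst continuous_on_snd cong: measurable_cong_sets)
  show "distr (uniform_on (A \<times> B)) (uniform_on A) fst = uniform_on A"
  proof (rule measure_eqI)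
    fix X assume "X \<in> sets (distr (uniform_on (A \<times> B)) (uniform_on A) fst)"
    then have X [measurable]: "X \<in> sets borel" by simp
    have "fst -` X \<in> sets (borel :: ('a \<times> 'b) measure)"
      using measurable_sets[OF fst, of X] X by simp
    moreover have "(A \<times> B) \<inter> fst -` X = (A \<inter> X) \<times> B" by auto
    moreover have "emeasure lborel ((A \<inter> X) \<times> B) / emeasure lborel (A \<times> B) = emeasure lborel (A \<inter> X) / emeasure lborel A"
    proof -
      have "emeasure lborel ((A \<inter> X) \<times> B) = emeasure lborel B * emeasure lborel (A \<inter> X)"
        "emeasure lborel (A \<times> B) = emeasure lborel B * emeasure lborel A"
        using A' B' X by (auto simp: emeasure_lborel_Times intro: mult.commute)
      then show ?thesis using B'(3,4) by (simp add: ennreal_divide_mult_left)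
    qed
    ultimately show "emeasure (distr (uniform_on (A \<times> B)) (uniform_on A) fst) X = emeasure (uniform_on A) X"
      using fst X A' AB by (simp add: emeasure_distr uniform_on_def)
  qed simp
  show "distr (uniform_on (A \<times> B)) (uniform_on B) snd = uniform_on B"
  proof (rule measure_eqI)
    fix X assume "X \<in> sets (distr (uniform_on (A \<times> B)) (uniform_on B) snd)"
    then have X [measurable]: "X \<in> sets borel" by simp
    have "snd -` X \<in> sets (borel :: ('a \<times> 'b) measure)"
      using measurable_sets[OF snd, of X] X by simp
    moreover have "(A \<times> B) \<inter> snd -` X = A \<times> (B \<inter> X)" by auto
    moreover have "emeasure lborel (A \<times> (B \<inter> X)) / emeasure lborel (A \<times> B) = emeasure lborel (B \<inter> X) / emeasure lborel B"
    proof -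
      have "emeasure lborel (A \<times> (B \<inter> X)) = emeasure lborel A * emeasure lborel (B \<inter> X)"
        "emeasure lborel (A \<times> B) = emeasure lborel A * emeasure lborel B"
        using A' B' X by (auto simp: emeasure_lborel_Times)
      then show ?thesis using A'(3,4) by (simp add: ennreal_divide_mult_left)
    qed
    ultimately show "emeasure (distr (uniform_on (A \<times> B)) (uniform_on B) snd) X = emeasure (uniform_on B) X"
      using snd X B' AB by (simp add: emeasure_distr uniform_on_def)
  qed simp
qed

lemma nn_integral_lborel_scaleR:
  fixes g :: "'a::euclidean_space \<Rightarrow> ennreal"
  assumes "0 < s" and [measurable]: "g \<in> borel_measurable borel"
  shows "(\<integral>\<^sup>+x. g x \<partial>lborel) = ennreal (s ^ DIM('a)) * (\<integral>\<^sup>+x. g (s *\<^sub>R x) \<partial>lborel)"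
proof -
  have "(lborel :: 'a measure) = density (distr lborel borel (\<lambda>x. s *\<^sub>R x)) (\<lambda>_. ennreal (s ^ DIM('a)))"
    using lborel_affine[of s 0] assms(1) by simp
  then have "(\<integral>\<^sup>+x. g x \<partial>lborel) = (\<integral>\<^sup>+x. g x \<partial>density (distr lborel borel (\<lambda>x. s *\<^sub>R x)) (\<lambda>_. ennreal (s ^ DIM('a))))"
    by (rule arg_cong)
  also have "\<dots> = ennreal (s ^ DIM('a)) * (\<integral>\<^sup>+x. g x \<partial>distr lborel borel (\<lambda>x. s *\<^sub>R x))"
    by (simp add: nn_integral_density nn_integral_cmult)
  also have "\<dots> = ennreal (s ^ DIM('a)) * (\<integral>\<^sup>+x. g (s *\<^sub>R x) \<partial>lborel)"
    by (subst nn_integral_distr) auto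
  finally show ?thesis .
qed

lemma nn_integral_lborel_translate:
  fixes g :: "'a::euclidean_space \<Rightarrow> ennreal"
  assumes [measurable]: "g \<in> borel_measurable borel"
  shows "(\<integral>\<^sup>+x. g x \<partial>lborel) = (\<integral>\<^sup>+x. g (u + x) \<partial>lborel)"
  by (subst lborel_distr_plus[of u, symmetric], subst nn_integral_distr) auto

lemma emeasure_lborel_scaleR:
  fixes D :: "'a::euclidean_space set"
  assumes "0 < s" "D \<in> sets borel"
  shows "(\<lambda>x. s *\<^sub>R x) ` D \<in> sets borel"
    and "emeasure lborel ((\<lambda>x. s *\<^sub>R x) ` D) = ennreal (s ^ DIM('a)) * emeasure lborel D"
proof -
  have eq: "(\<lambda>x. s *\<^sub>R x) ` D = (\<lambda>x. (1 / s) *\<^sub>R x) -` D \<inter> space borel"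
  proof (intro equalityI subsetI)
    fix y assume "y \<in> (\<lambda>x. (1 / s) *\<^sub>R x) -` D \<inter> space borel"
    then have "(1 / s) *\<^sub>R y \<in> D" "y = s *\<^sub>R ((1 / s) *\<^sub>R y)" using assms(1) by auto
    then show "y \<in> (\<lambda>x. s *\<^sub>R x) ` D" by (rule rev_image_eqI)
  qed (use assms(1) in auto)
  have m: "(\<lambda>x. (1 / s) *\<^sub>R x) \<in> borel_measurable (borel :: 'a measure)" by measurable
  show sets: "(\<lambda>x. s *\<^sub>R x) ` D \<in> sets borel"
    unfolding eq by (rule measurable_sets[OF m assms(2)])
  have "indicator ((\<lambda>x. s *\<^sub>R x) ` D) (s *\<^sub>R x) = (indicator D x :: ennreal)" for x
    using assms(1) by (auto simp: indicator_def)
  then show "emeasure lborel ((\<lambda>x. s *\<^sub>R x) ` D) = ennreal (s ^ DIM('a)) * emeasure lborel D"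
    using nn_integral_lborel_scaleR[OF assms(1), of "indicator ((\<lambda>x. s *\<^sub>R x) ` D)"] sets assms(2)
    by simp
qed

lemma scaleR_compact_pos:
  fixes D :: "'a::euclidean_space set"
  assumes "0 < s" "compact D" "0 < measure lborel D"
  shows "compact ((\<lambda>x. s *\<^sub>R x) ` D)" "0 < measure lborel ((\<lambda>x. s *\<^sub>R x) ` D)"
proof -
  show "compact ((\<lambda>x. s *\<^sub>R x) ` D)" using assms(2) by (rule compact_scaling)
  show "0 < measure lborel ((\<lambda>x. s *\<^sub>R x) ` D)"
    using emeasure_lborel_scaleR(2)[OF assms(1) emeasure_lborel_compact_pos(2)[OF assms(2,3)]] assms
    unfolding measure_def by (simp add: enn2real_mult)
qed

lemma distr_uniform_on_scaleR:
  fixes D :: "'a::euclidean_space set"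
  assumes s: "0 < s" and D: "compact D" "0 < measure lborel D"
  shows "distr (uniform_on D) (uniform_on ((\<lambda>x. s *\<^sub>R x) ` D)) (\<lambda>x. s *\<^sub>R x) = uniform_on ((\<lambda>x. s *\<^sub>R x) ` D)"
proof (rule measure_eqI)
  note D' = emeasure_lborel_compact_pos[OF D]
  note sD = emeasure_lborel_scaleR[OF s D'(2)]
  have "(\<lambda>x. s *\<^sub>R x) \<in> borel_measurable (borel :: 'a measure)" by measurable
  then have m: "(\<lambda>x. s *\<^sub>R x) \<in> measurable (uniform_on D) (uniform_on ((\<lambda>x. s *\<^sub>R x) ` D))"
    by (simp only: measurable_cong_sets[OF sets_uniform_on sets_uniform_on])
  fix X assume "X \<in> sets (distr (uniform_on D) (uniform_on ((\<lambda>x. s *\<^sub>R x) ` D)) (\<lambda>x. s *\<^sub>R x))"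
  then have X: "X \<in> sets borel" by simp
  have pre: "(\<lambda>x. s *\<^sub>R x) -` X \<in> sets borel"
    using measurable_sets[OF m, of X] X by simp
  have img: "(\<lambda>x. s *\<^sub>R x) ` (D \<inter> (\<lambda>x. s *\<^sub>R x) -` X) = (\<lambda>x. s *\<^sub>R x) ` D \<inter> X" by auto
  from pre have "D \<inter> (\<lambda>x. s *\<^sub>R x) -` X \<in> sets borel" using D' by auto
  from emeasure_lborel_scaleR(2)[OF s this]
  have "emeasure lborel ((\<lambda>x. s *\<^sub>R x) ` D \<inter> X) = ennreal (s ^ DIM('a)) * emeasure lborel (D \<inter> (\<lambda>x. s *\<^sub>R x) -` X)"
    using img by simp
  then have "emeasure lborel ((\<lambda>x. s *\<^sub>R x) ` D \<inter> X) / emeasure lborel ((\<lambda>x. s *\<^sub>R x) ` D) =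
      emeasure lborel (D \<inter> (\<lambda>x. s *\<^sub>R x) -` X) / emeasure lborel D"
    unfolding sD(2) using s by (simp only:) (intro ennreal_divide_mult_left, auto)
  moreover have "emeasure (distr (uniform_on D) (uniform_on ((\<lambda>x. s *\<^sub>R x) ` D)) (\<lambda>x. s *\<^sub>R x)) X =
      emeasure (uniform_on D) ((\<lambda>x. s *\<^sub>R x) -` X)"
    using X by (subst emeasure_distr[OF m]) auto
  ultimately show "emeasure (distr (uniform_on D) (uniform_on ((\<lambda>x. s *\<^sub>R x) ` D)) (\<lambda>x. s *\<^sub>R x)) X =
      emeasure (uniform_on ((\<lambda>x. s *\<^sub>R x) ` D)) X"
    using X pre D'(2) sD(1) unfolding uniform_on_def by (simp only: emeasure_uniform_measure sets_lborel)
qed simp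

text \<open>By outer regularity \<open>D\<close> lies in an open \<open>U\<close> that exceeds it by
  less than half its volume. Small translates of the compact \<open>D\<close> stay inside
  \<open>U\<close>, so less than half of each lies outside \<open>D\<close>.\<close>

lemma translate_overlap:
  fixes D :: "'a::euclidean_space set"
  assumes D: "compact D" "0 < measure lborel D"
  shows "\<exists>\<delta>>0. \<forall>w. norm w \<le> \<delta> \<longrightarrow> ennreal (measure lborel D / 2) \<le> emeasure lborel {u \<in> D. u + w \<in> D}"
proof -
  note D' = emeasure_lborel_compact_pos[OF D]
  obtain U where U: "open U" "D \<subseteq> U" "emeasure lborel (U - D) < ennreal (measure lborel D / 2)"
    using outer_regular_lborel[OF D'(2), of "measure lborel D / 2"] D(2) by auto
  obtain \<epsilon> where \<epsilon>: "0 < \<epsilon>" "(\<Union>x\<in>D. ball x \<epsilon>) \<subseteq> U"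
    using compact_subset_open_imp_ball_epsilon_subset[OF D(1) U(1,2)] .
  show ?thesis
  proof (intro exI[of _ "\<epsilon> / 2"] conjI allI impI)
    show "0 < \<epsilon> / 2" using \<epsilon> by simp
    fix w :: 'a assume w: "norm w \<le> \<epsilon> / 2"
    define E where "E = {u. u + w \<in> D}"
    have E: "E \<in> sets borel"
    proof -
      have eq: "E = (\<lambda>u. u + w) -` D \<inter> space borel" by (auto simp: E_def)
      have m: "(\<lambda>u. u + w) \<in> borel_measurable (borel :: 'a measure)" by measurable
      show ?thesis unfolding eq by (rule measurable_sets[OF m D'(2)])
    qed
    have EU: "E \<subseteq> U"
    proof
      fix u assume "u \<in> E"
      then have "u + w \<in> D" by (simp add: E_def)
      moreover have "u \<in> ball (u + w) \<epsilon>" using w \<epsilon> by (simp add: dist_norm)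
      ultimately show "u \<in> U" using \<epsilon>(2) by blast
    qed
    have "emeasure lborel D = (\<integral>\<^sup>+x. indicator D x \<partial>lborel)" using D' by simp
    also have "\<dots> = (\<integral>\<^sup>+x. indicator D (w + x) \<partial>lborel)"
      using D' by (intro nn_integral_lborel_translate) auto
    also have "\<dots> = (\<integral>\<^sup>+x. indicator E x \<partial>lborel)"
      by (intro nn_integral_cong) (auto simp: E_def indicator_def add.commute)
    also have "\<dots> = emeasure lborel E" using E by simp
    also have "\<dots> \<le> emeasure lborel ({u \<in> D. u + w \<in> D} \<union> (U - D))"
      using EU E D' U(1) by (intro emeasure_mono) (auto simp: E_def[symmetric] Collect_conj_eq)
    also have "\<dots> \<le> emeasure lborel {u \<in> D. u + w \<in> D} + emeasure lborel (U - D)"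
      using E D' U(1) by (intro emeasure_subadditive) (auto simp: E_def[symmetric] Collect_conj_eq)
    also have "\<dots> \<le> emeasure lborel {u \<in> D. u + w \<in> D} + ennreal (measure lborel D / 2)"
      using U(3) by (intro add_left_mono) auto
    finally have "ennreal (measure lborel D / 2) + ennreal (measure lborel D / 2) \<le>
        emeasure lborel {u \<in> D. u + w \<in> D} + ennreal (measure lborel D / 2)"
      using D(2) D'(1) by (simp add: ennreal_plus[symmetric] del: ennreal_plus)
    then show "ennreal (measure lborel D / 2) \<le> emeasure lborel {u \<in> D. u + w \<in> D}"
      by (simp add: ennreal_add_left_cancel_le add.commute)
  qed
qed

definition pair_energy :: "('a::euclidean_space \<Rightarrow> ennreal) \<Rightarrow> 'a set \<Rightarrow> ennreal" where
  "pair_energy F S = (\<integral>\<^sup>+u. \<integral>\<^sup>+v. F (v - u) \<partial>uniform_on S \<partial>uniform_on S)"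

text \<open>Up to the factor \<open>\<bar>D\<bar>\<^sup>-\<^sup>2\<close> the energy of \<open>t D\<close> is the integral of \<open>F (t w)\<close> against the
  overlap \<open>\<bar>D \<inter> (D - w)\<bar>\<close>.\<close>

lemma pair_energy_scaleR:
  fixes F :: "'a::euclidean_space \<Rightarrow> ennreal"
  assumes t: "0 < t" and D: "compact D" "0 < measure lborel D" and F [measurable]: "F \<in> borel_measurable borel"
  shows "pair_energy F ((\<lambda>x. t *\<^sub>R x) ` D) =
    (\<integral>\<^sup>+w. F (t *\<^sub>R w) * emeasure lborel {u \<in> D. u + w \<in> D} \<partial>lborel) / emeasure lborel D / emeasure lborel D"
proof -
  note D' = emeasure_lborel_compact_pos[OF D]
  note [measurable] = D'(2)
  let ?U = "uniform_on D" and ?tU = "uniform_on ((\<lambda>x. t *\<^sub>R x) ` D)"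
  have m: "(\<lambda>x. t *\<^sub>R x) \<in> measurable ?U ?tU"
    unfolding measurable_cong_sets[OF sets_uniform_on sets_uniform_on] by measurable
  have pull: "(\<integral>\<^sup>+x. g x \<partial>?tU) = (\<integral>\<^sup>+x. g (t *\<^sub>R x) \<partial>?U)" if "g \<in> borel_measurable borel" for g :: "'a \<Rightarrow> ennreal"
  proof -
    have "g \<in> borel_measurable (distr ?U ?tU (\<lambda>x. t *\<^sub>R x))"
      using that by (simp only: measurable_cong_sets[OF trans[OF sets_distr sets_uniform_on] refl])
    from nn_integral_distr[OF m this] show ?thesis
      unfolding distr_uniform_on_scaleR[OF t D] by simp
  qed
  have unif: "(\<integral>\<^sup>+x. g x \<partial>?U) = (\<integral>\<^sup>+x. g x * indicator D x \<partial>lborel) / emeasure lborel D"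
    if "g \<in> borel_measurable borel" for g :: "'a \<Rightarrow> ennreal"
    unfolding uniform_on_def using that by (intro nn_integral_uniform_measure) auto
  define I where "I u = (\<integral>\<^sup>+v. F (t *\<^sub>R (v - u)) * indicator D v \<partial>lborel)" for u
  have inner: "(\<integral>\<^sup>+v. F (v - u) \<partial>?tU) = (\<integral>\<^sup>+v. F (t *\<^sub>R v - u) * indicator D v \<partial>lborel) / emeasure lborel D" for u
    by (subst pull, measurable, subst unif) auto
  have I_eq: "I u = (\<integral>\<^sup>+w. F (t *\<^sub>R w) * indicator D (u + w) \<partial>lborel)" for u
    unfolding I_def by (subst nn_integral_lborel_translate[of _ u]) (auto simp: algebra_simps)
  have Im [measurable]: "I \<in> borel_measurable borel"
    unfolding I_def[abs_def] by measurable
  have "pair_energy F ((\<lambda>x. t *\<^sub>R x) ` D) =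
      (\<integral>\<^sup>+u. (\<integral>\<^sup>+v. F (t *\<^sub>R v - u) * indicator D v \<partial>lborel) / emeasure lborel D \<partial>?tU)"
    unfolding pair_energy_def inner ..
  also have "\<dots> = (\<integral>\<^sup>+u. I u / emeasure lborel D \<partial>?U)"
    by (subst pull) (measurable, simp add: I_def scaleR_diff_right)
  also have "\<dots> = (\<integral>\<^sup>+u. I u * indicator D u / emeasure lborel D \<partial>lborel) / emeasure lborel D"
    by (subst unif) (measurable, simp add: divide_ennreal_def mult_ac)
  also have "(\<integral>\<^sup>+u. I u * indicator D u / emeasure lborel D \<partial>lborel) = (\<integral>\<^sup>+u. I u * indicator D u \<partial>lborel) / emeasure lborel D"
    by (intro nn_integral_divide) measurable
  also have "(\<integral>\<^sup>+u. I u * indicator D u \<partial>lborel) = (\<integral>\<^sup>+u. \<integral>\<^sup>+w. F (t *\<^sub>R w) * (indicator D (u + w) * indicator D u) \<partial>lborel \<partial>lborel)"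
    unfolding I_eq by (simp add: nn_integral_multc[symmetric] mult.assoc)
  also have "\<dots> = (\<integral>\<^sup>+w. \<integral>\<^sup>+u. F (t *\<^sub>R w) * (indicator D (u + w) * indicator D u) \<partial>lborel \<partial>lborel)"
    by (rule lborel_pair.Fubini'[symmetric]) measurable
  also have "\<dots> = (\<integral>\<^sup>+w. F (t *\<^sub>R w) * emeasure lborel {u \<in> D. u + w \<in> D} \<partial>lborel)"
  proof (intro nn_integral_cong)
    fix w
    have "(\<integral>\<^sup>+u. F (t *\<^sub>R w) * (indicator D (u + w) * indicator D u) \<partial>lborel) =
       F (t *\<^sub>R w) * (\<integral>\<^sup>+u. indicator {u \<in> D. u + w \<in> D} u \<partial>lborel)"
      by (subst nn_integral_cmult[symmetric]) (measurable, auto intro!: nn_integral_cong simp: indicator_def)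
    also have "(\<integral>\<^sup>+u. indicator {u \<in> D. u + w \<in> D} u \<partial>lborel) = emeasure lborel {u \<in> D. u + w \<in> D}"
      by (intro nn_integral_indicator) measurable
    finally show "(\<integral>\<^sup>+u. F (t *\<^sub>R w) * (indicator D (u + w) * indicator D u) \<partial>lborel) =
       F (t *\<^sub>R w) * emeasure lborel {u \<in> D. u + w \<in> D}" .
  qed
  finally show ?thesis .
qed

text \<open>By \<open>pair_energy_scaleR\<close> a dilation acts on \<open>F\<close> but not on the
  overlap \<open>g\<close>. With \<open>a\<close> the volume of \<open>D\<close>, \<open>g\<close>
  is at most \<open>a\<close> and supported in the ball of radius \<open>R\<close>, and at least
  \<open>a / 2\<close> on the ball of radius \<open>\<delta>\<close>. Substituting
  \<open>s *\<^sub>R w\<close> with \<open>s \<ge> R / \<delta>\<close> brings the large ball into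
  the small one, and \<open>s \<ge> l\<close> makes the argument of \<open>F\<close> at least as
  long as \<open>t *\<^sub>R w\<close>, so monotonicity applies. The Jacobian and the ratio 2 of the
  overlap bounds give the constant \<open>1 / (2 * s ^ DIM('a))\<close>.\<close>

lemma pair_energy_doubling:
  fixes F :: "'a::euclidean_space \<Rightarrow> ennreal"
  assumes D: "compact D" "0 < measure lborel D" and F [measurable]: "F \<in> borel_measurable borel"
    and mono: "\<And>x y. norm x \<le> norm y \<Longrightarrow> F y \<le> F x" and l: "1 \<le> l"
  shows "\<exists>c>0. \<forall>t>0. ennreal c * pair_energy F ((\<lambda>x. (t / l) *\<^sub>R x) ` D) \<le> pair_energy F ((\<lambda>x. t *\<^sub>R x) ` D)"
proof -
  note D' = emeasure_lborel_compact_pos[OF D]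
  note [measurable] = D'(2)
  define g where "g w = emeasure lborel {u \<in> D. u + w \<in> D}" for w
  define a where "a = measure lborel D"
  have a: "0 < a" "emeasure lborel D = ennreal a" using D D' by (auto simp: a_def)
  obtain \<delta> where \<delta>: "0 < \<delta>" "\<And>w. norm w \<le> \<delta> \<Longrightarrow> ennreal (a / 2) \<le> g w"
    using translate_overlap[OF D] unfolding g_def a_def by blast
  obtain R0 where R0: "\<And>u. u \<in> D \<Longrightarrow> norm u \<le> R0"
    using compact_imp_bounded[OF D(1)] unfolding bounded_iff by blast
  define R where "R = max 1 (2 * R0)"
  have g_le: "g w \<le> ennreal a * indicator (cball 0 R) w" for w
  proof (cases "\<exists>u. u \<in> D \<and> u + w \<in> D")
    case True
    then obtain u where u: "u \<in> D" "u + w \<in> D" by blast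
    have "norm w \<le> norm (u + w) + norm u" using norm_triangle_ineq4[of "u + w" u] by simp
    then have "w \<in> cball 0 R" using R0[OF u(1)] R0[OF u(2)] by (simp add: R_def)
    moreover have "g w \<le> emeasure lborel D" unfolding g_def by (intro emeasure_mono) auto
    ultimately show ?thesis using a by simp
  next
    case False
    then have e: "{u \<in> D. u + w \<in> D} = {}" by blast
    show ?thesis unfolding g_def e by simp
  qed
  have [measurable]: "cball (0 :: 'a) R \<in> sets borel" by (simp add: borel_closed)
  define s where "s = max l (R / \<delta>)"
  have s: "l \<le> s" "R / s \<le> \<delta>" "0 < s"
  proof -
    show "l \<le> s" "0 < s" using l by (auto simp: s_def)
    have "R / \<delta> \<le> s" by (simp add: s_def)
    then show "R / s \<le> \<delta>" using \<delta>(1) \<open>0 < s\<close> by (simp add: field_simps)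
  qed
  have main: "(\<integral>\<^sup>+w. F ((t / l) *\<^sub>R w) * g w \<partial>lborel) \<le> ennreal (2 * s ^ DIM('a)) * (\<integral>\<^sup>+w. F (t *\<^sub>R w) * g w \<partial>lborel)"
    if t: "0 < t" for t
  proof -
    have "(\<integral>\<^sup>+w. F ((t / l) *\<^sub>R w) * g w \<partial>lborel) \<le> (\<integral>\<^sup>+w. ennreal a * (F ((t / l) *\<^sub>R w) * indicator (cball 0 R) w) \<partial>lborel)"
    proof (intro nn_integral_mono)
      fix w
      have "F ((t / l) *\<^sub>R w) * g w \<le> F ((t / l) *\<^sub>R w) * (ennreal a * indicator (cball 0 R) w)"
        by (intro mult_left_mono g_le) auto
      then show "F ((t / l) *\<^sub>R w) * g w \<le> ennreal a * (F ((t / l) *\<^sub>R w) * indicator (cball 0 R) w)"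
        by (simp add: mult_ac)
    qed
    also have "\<dots> = ennreal (s ^ DIM('a)) * (\<integral>\<^sup>+w. ennreal a * (F ((t / l) *\<^sub>R (s *\<^sub>R w)) * indicator (cball 0 R) (s *\<^sub>R w)) \<partial>lborel)"
      by (rule nn_integral_lborel_scaleR[OF s(3)]) measurable
    also have "\<dots> \<le> ennreal (s ^ DIM('a)) * (\<integral>\<^sup>+w. 2 * (F (t *\<^sub>R w) * g w) \<partial>lborel)"
    proof (intro mult_left_mono nn_integral_mono)
      fix w
      show "ennreal a * (F ((t / l) *\<^sub>R (s *\<^sub>R w)) * indicator (cball 0 R) (s *\<^sub>R w)) \<le> 2 * (F (t *\<^sub>R w) * g w)"
      proof (cases "s *\<^sub>R w \<in> cball 0 R")
        case True
        then have "norm w \<le> R / s" using s(3) by (simp add: field_simps)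
        then have "ennreal (a / 2) \<le> g w" using s(2) by (intro \<delta>(2)) simp
        then have "2 * ennreal (a / 2) \<le> 2 * g w" by (intro mult_left_mono) auto
        moreover have "2 * ennreal (a / 2) = ennreal a"
          using a(1) by (subst ennreal_numeral[symmetric], subst ennreal_mult[symmetric]) auto
        ultimately have ga: "ennreal a \<le> 2 * g w" by simp
        have "1 \<le> s / l" using s l by (simp add: le_divide_eq)
        from mult_right_mono[OF this, of "norm w"]
        have "norm w \<le> norm ((s / l) *\<^sub>R w)" using s l by simp
        then have "t * norm w \<le> t * norm ((s / l) *\<^sub>R w)" using t by (intro mult_left_mono) auto
        then have "F ((t / l) *\<^sub>R (s *\<^sub>R w)) \<le> F (t *\<^sub>R w)"
          using t l s by (intro mono) (simp add: field_simps)
        then have "ennreal a * F ((t / l) *\<^sub>R (s *\<^sub>R w)) \<le> (2 * g w) * F (t *\<^sub>R w)"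
          using ga by (intro mult_mono) auto
        then show ?thesis using True by (simp add: mult_ac)
      qed simp
    qed simp
    also have "\<dots> = ennreal (2 * s ^ DIM('a)) * (\<integral>\<^sup>+w. F (t *\<^sub>R w) * g w \<partial>lborel)"
    proof -
      have [measurable]: "g \<in> borel_measurable borel"
      proof -
        have "(\<lambda>w. \<integral>\<^sup>+u. indicator D u * indicator D (u + w) \<partial>lborel) \<in> borel_measurable borel" by measurable
        moreover have "g w = (\<integral>\<^sup>+u. indicator D u * indicator D (u + w) \<partial>lborel)" for w
        proof -
          have "(\<integral>\<^sup>+u. indicator D u * indicator D (u + w) \<partial>lborel) = (\<integral>\<^sup>+u. indicator {u \<in> D. u + w \<in> D} u \<partial>lborel)"
            by (intro nn_integral_cong) (simp split: split_indicator)
          also have "\<dots> = g w"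
            unfolding g_def by (intro nn_integral_indicator) measurable
          finally show ?thesis by simp
        qed
        ultimately show ?thesis by (simp cong: measurable_cong)
      qed
      have "ennreal (2 * s ^ DIM('a)) = ennreal (s ^ DIM('a)) * 2"
        using s by (subst ennreal_mult) (auto simp: mult.commute)
      then show ?thesis by (subst nn_integral_cmult) (auto simp: mult_ac)
    qed
    finally show ?thesis .
  qed
  define c where "c = 1 / (2 * s ^ DIM('a))"
  show ?thesis
  proof (intro exI[of _ c] conjI allI impI)
    show "0 < c" using s by (simp add: c_def)
    fix t :: real assume t: "0 < t"
    have tl: "0 < t / l" using t l by simp
    have "ennreal c * (\<integral>\<^sup>+w. F ((t / l) *\<^sub>R w) * g w \<partial>lborel) \<le> ennreal c * (ennreal (2 * s ^ DIM('a)) * (\<integral>\<^sup>+w. F (t *\<^sub>R w) * g w \<partial>lborel))"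
      by (intro mult_left_mono main t) simp
    also have "\<dots> = (\<integral>\<^sup>+w. F (t *\<^sub>R w) * g w \<partial>lborel)"
      unfolding mult.assoc[symmetric] using s by (subst ennreal_mult[symmetric]) (auto simp: c_def)
    finally have "ennreal c * (\<integral>\<^sup>+w. F ((t / l) *\<^sub>R w) * g w \<partial>lborel) / emeasure lborel D / emeasure lborel D \<le>
        (\<integral>\<^sup>+w. F (t *\<^sub>R w) * g w \<partial>lborel) / emeasure lborel D / emeasure lborel D"
      by (intro divide_right_mono_ennreal)
    then show "ennreal c * pair_energy F ((\<lambda>x. (t / l) *\<^sub>R x) ` D) \<le> pair_energy F ((\<lambda>x. t *\<^sub>R x) ` D)"
      unfolding pair_energy_scaleR[OF t D F] pair_energy_scaleR[OF tl D F] g_def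
      by (simp add: ennreal_times_divide)
  qed
qed

section \<open>Monotonicity of \<phi> and \<psi>\<close>

lemma nondecreasing_on_nonneg:
  fixes f :: "real \<Rightarrow> real"
  assumes f: "\<And>t. 0 \<le> t \<Longrightarrow> (f has_real_derivative f' t) (at t within {0..})"
    and f': "\<And>t. 0 \<le> t \<Longrightarrow> 0 \<le> f' t" and st: "0 \<le> s" "s \<le> t"
  shows "f s \<le> f t"
proof (rule DERIV_nonneg_imp_increasing_open[OF st(2)])
  fix x assume x: "s < x" "x < t"
  then have int: "x \<in> interior {0..}" and x0: "0 \<le> x" using st by auto
  have "(f has_real_derivative f' x) (at x)"
    using f[OF x0] unfolding at_within_interior[OF int] .
  then show "\<exists>y. (f has_real_derivative y) (at x) \<and> 0 \<le> y"
    using f'[of x] x st by (intro exI[of _ "f' x"]) simp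
next
  have "continuous_on {0..} f"
    by (rule DERIV_continuous_on[of _ _ f']) (rule f, simp)
  then show "continuous_on {s..t} f"
    by (rule continuous_on_subset) (use st in auto)
qed

lemma completely_monotone_antimono:
  assumes "completely_monotone f" "0 \<le> s" "s \<le> t"
  shows "f t \<le> f s"
proof -
  obtain D where D: "(\<forall>t\<ge>0. D 0 t = f t) \<and>
      (\<forall>n. \<forall>t\<ge>0. (D n has_real_derivative D (Suc n) t) (at t within {0..})) \<and>
      (\<forall>n. \<forall>t\<ge>0. (-1) ^ n * D n t \<ge> 0)"
    using assms(1)[unfolded completely_monotone_def] by (rule exE)
  note D0 = D[THEN conjunct1] and D1 = D[THEN conjunct2, THEN conjunct1] and D2 = D[THEN conjunct2, THEN conjunct2]
  have "- D 0 s \<le> - D 0 t"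
  proof (rule nondecreasing_on_nonneg[OF _ _ assms(2,3)])
    fix x :: real assume x: "0 \<le> x"
    show "((\<lambda>x. - D 0 x) has_real_derivative - D 1 x) (at x within {0..})"
      using D1[rule_format, OF x, of 0] by (auto intro!: derivative_eq_intros)
    show "0 \<le> - D 1 x" using D2[rule_format, OF x, of 1] by simp
  qed
  then show ?thesis using D0[rule_format, of s] D0[rule_format, of t] assms by simp
qed

lemma has_completely_monotone_derivative_mono:
  assumes "has_completely_monotone_derivative f" "0 \<le> s" "s \<le> t"
  shows "f s \<le> f t"
proof -
  obtain f' where f': "(\<forall>t\<ge>0. (f has_real_derivative f' t) (at t within {0..})) \<and> completely_monotone f'"
    using assms(1)[unfolded has_completely_monotone_derivative_def] by (rule exE)
  obtain D where D: "(\<forall>t\<ge>0. D 0 t = f' t) \<and>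
      (\<forall>n. \<forall>t\<ge>0. (D n has_real_derivative D (Suc n) t) (at t within {0..})) \<and>
      (\<forall>n. \<forall>t\<ge>0. (-1) ^ n * D n t \<ge> 0)"
    using f'[THEN conjunct2, unfolded completely_monotone_def] by (rule exE)
  note D0 = D[THEN conjunct1] and D2 = D[THEN conjunct2, THEN conjunct2]
  have "0 \<le> f' t" if "0 \<le> t" for t
    using D0[rule_format, OF that] D2[rule_format, OF that, of 0] by simp
  then show ?thesis
    using f'[THEN conjunct1, rule_format] assms(2,3) by (intro nondecreasing_on_nonneg[of f f'])
qed

section \<open>Gneiting covariances\<close>

context continuous_gaussian_field
begin

lemma C_measurable' [measurable]: "C \<in> borel_measurable borel"
  using measurable_compose[OF measurable_Pair1'[of 0 borel borel] measurable_compose[OF measurable_pair_swap' C_measurable]]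
  by simp

lemma ennreal_energy:
  assumes "compact S" "0 < measure lborel S"
  shows "ennreal (positive_kernel.energy (uniform_on S) kernel q) = pair_energy (\<lambda>z. ennreal (C z ^ q)) S"
proof -
  interpret U: positive_kernel "uniform_on S" kernel 1 using assms by (rule positive_kernel)
  show ?thesis
    unfolding pair_energy_def U.nn_integral_row[symmetric] U.nn_integral_k_power[symmetric] ..
qed

lemma energy_doubling:
  assumes D: "compact D" "0 < measure lborel D"
    and mono: "\<And>x y. norm x \<le> norm y \<Longrightarrow> C y \<le> C x" and l: "1 \<le> l"
  shows "\<exists>c>0. \<forall>t>0. c * positive_kernel.energy (uniform_on ((\<lambda>x. (t / l) *\<^sub>R x) ` D)) kernel q \<le>
    positive_kernel.energy (uniform_on ((\<lambda>x. t *\<^sub>R x) ` D)) kernel q"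
proof -
  have "(\<lambda>z. ennreal (C z ^ q)) \<in> borel_measurable borel" by measurable
  moreover have "ennreal (C y ^ q) \<le> ennreal (C x ^ q)" if "norm x \<le> norm y" for x y
    using mono[OF that] C_pos[of y] by (intro ennreal_leI power_mono) (auto simp: less_imp_le)
  ultimately obtain c where c: "0 < c" "\<And>t. 0 < t \<Longrightarrow>
      ennreal c * pair_energy (\<lambda>z. ennreal (C z ^ q)) ((\<lambda>x. (t / l) *\<^sub>R x) ` D) \<le>
      pair_energy (\<lambda>z. ennreal (C z ^ q)) ((\<lambda>x. t *\<^sub>R x) ` D)"
    using pair_energy_doubling[OF D _ _ l, of "\<lambda>z. ennreal (C z ^ q)"] by blast
  show ?thesis
  proof (intro exI[of _ c] conjI allI impI)
    fix t :: real assume t: "0 < t"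
    have tl: "0 < t / l" using t l by simp
    note S = scaleR_compact_pos[OF t D] and S' = scaleR_compact_pos[OF tl D]
    interpret U: positive_kernel "uniform_on ((\<lambda>x. t *\<^sub>R x) ` D)" kernel 1 using S by (rule positive_kernel)
    interpret U': positive_kernel "uniform_on ((\<lambda>x. (t / l) *\<^sub>R x) ` D)" kernel 1 using S' by (rule positive_kernel)
    have "ennreal (c * U'.energy q) \<le> ennreal (U.energy q)"
      using c(2)[OF t] c(1) U'.energy_pos[of q]
      by (simp add: ennreal_mult less_imp_le ennreal_energy[OF S] ennreal_energy[OF S'])
    then show "c * U'.energy q \<le> U.energy q"
      using U.energy_pos[of q] by (simp add: ennreal_le_iff less_imp_le)
  qed (rule c(1))
qed

end

text \<open>The case \<open>K = 1\<close>: the upper bounds on Gneiting covariances by their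
  marginals hold without a constant, so the only loss comes from the energies.\<close>

lemma defect_comparison:
  assumes F: "continuous_gaussian_field M B C q" and F': "continuous_gaussian_field M B' C' q"
    and S: "compact S" "0 < measure lborel S" and S': "compact S'" "0 < measure lborel S'"
    and h: "h \<in> borel_measurable borel" and distr: "distr (uniform_on S) (uniform_on S') h = uniform_on S'"
    and le: "\<And>u v. u \<in> S \<Longrightarrow> v \<in> S \<Longrightarrow> C (u - v) \<le> C' (h u - h v)"
    and c: "0 < c" and energy: "c * positive_kernel.energy (uniform_on S') (\<lambda>x y. C' (x - y)) q \<le>
      positive_kernel.energy (uniform_on S) (\<lambda>x y. C (x - y)) q"
  shows "continuous_gaussian_field.defect C q m S \<le> 1 / sqrt c ^ m * continuous_gaussian_field.defect C' q m S'"
proof -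
  interpret F: continuous_gaussian_field M B C q by fact
  interpret F': continuous_gaussian_field M B' C' q by fact
  have "h \<in> measurable (uniform_on S) (uniform_on S')"
    using h by (simp only: measurable_cong_sets[OF sets_uniform_on sets_uniform_on])
  then show ?thesis
    unfolding F.defect_def F'.defect_def
    using remainder_moment_comparison[OF F.positive_kernel[OF S] F'.positive_kernel[OF S'] _ distr
        AE_uniform_on[OF S], of 1 c q m] le c energy F.q_pos by simp
qed

lemma tendsto_defect_comparison:
  assumes F: "continuous_gaussian_field M B C q" and F': "continuous_gaussian_field M B' C' q"
    and S: "\<And>t. 0 < t \<Longrightarrow> compact (S t)" "\<And>t. 0 < t \<Longrightarrow> 0 < measure lborel (S t)"
    and le: "\<And>t. 0 < t \<Longrightarrow> continuous_gaussian_field.defect C q m (S t) \<le> K * d t"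
    and d: "(d \<longlongrightarrow> 0) at_top"
  shows "((\<lambda>t. continuous_gaussian_field.defect C q m (S t)) \<longlongrightarrow> 0) (at_top :: real filter)"
proof (rule tendsto_sandwich[of "\<lambda>_. 0" _ _ "\<lambda>t. K * d t"])
  interpret F: continuous_gaussian_field M B C q by fact
  show "eventually (\<lambda>t. 0 \<le> F.defect m (S t)) at_top"
    using eventually_gt_at_top[of 0] by eventually_elim (use S F.defect_nonneg in auto)
  show "eventually (\<lambda>t. F.defect m (S t) \<le> K * d t) at_top"
    using eventually_gt_at_top[of 0] by eventually_elim (rule le)
  show "((\<lambda>t. K * d t) \<longlongrightarrow> 0) at_top"
    using tendsto_mult_left[OF d, of K] by simp
qed simp

lemma compact_diff_bounded:
  fixes S :: "'a::real_normed_vector set"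
  assumes "compact S"
  obtains R where "0 \<le> R" "\<And>u v. u \<in> S \<Longrightarrow> v \<in> S \<Longrightarrow> norm (u - v) \<le> R"
proof -
  obtain r where r: "\<And>u. u \<in> S \<Longrightarrow> norm u \<le> r"
    using compact_imp_bounded[OF assms] unfolding bounded_iff by blast
  show thesis
  proof (rule that[of "max 0 (2 * r)"])
    fix u v assume "u \<in> S" "v \<in> S"
    with r[of u] r[of v] show "norm (u - v) \<le> max 0 (2 * r)"
      using norm_triangle_ineq4[of u v] by simp
  qed simp
qed

section \<open>Two-sided bounds by the marginal covariances\<close>

locale gneiting =
  fixes \<phi> \<psi> :: "real \<Rightarrow> real" and C :: "'a::euclidean_space \<times> 'b::euclidean_space \<Rightarrow> real"
  assumes gneiting: "gneiting_covariance \<phi> \<psi> C"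
begin

lemma phi_pos: "0 \<le> t \<Longrightarrow> 0 < \<phi> t"
  and psi_pos: "0 \<le> t \<Longrightarrow> 0 < \<psi> t"
  and phi_0: "\<phi> 0 = 1" and psi_0: "\<psi> 0 = 1"
  and C_eq: "C (x1, x2) = \<psi> ((norm x2)\<^sup>2) powr (- real DIM('a) / 2) * \<phi> ((norm x1)\<^sup>2 / \<psi> ((norm x2)\<^sup>2))"
  using gneiting unfolding gneiting_covariance_def by (elim conjE; simp)+

lemma phi_antimono: "0 \<le> s \<Longrightarrow> s \<le> t \<Longrightarrow> \<phi> t \<le> \<phi> s"
  using gneiting completely_monotone_antimono unfolding gneiting_covariance_def by (elim conjE)

lemma psi_mono: "0 \<le> s \<Longrightarrow> s \<le> t \<Longrightarrow> \<psi> s \<le> \<psi> t"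
  using gneiting has_completely_monotone_derivative_mono unfolding gneiting_covariance_def by (elim conjE)

lemma psi_ge_1: "0 \<le> t \<Longrightarrow> 1 \<le> \<psi> t"
  using psi_mono[of 0 t] psi_0 by simp

lemma C_pos: "0 < C x"
proof (cases x)
  case (Pair x1 x2)
  have "0 < \<psi> ((norm x2)\<^sup>2)" by (rule psi_pos) simp
  moreover from this have "0 < \<phi> ((norm x1)\<^sup>2 / \<psi> ((norm x2)\<^sup>2))" by (intro phi_pos) simp
  ultimately show ?thesis by (simp add: Pair C_eq)
qed

lemma C_time: "C (0, x2) = \<psi> ((norm x2)\<^sup>2) powr (- real DIM('a) / 2)"
  by (simp add: C_eq phi_0)

lemma C_space: "C (x1, 0) = \<phi> ((norm x1)\<^sup>2)"
  by (simp add: C_eq psi_0)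

lemma C_0: "C 0 = 1"
  using C_space[of 0] phi_0 by (simp add: zero_prod_def)

lemma C_le_time: "C (x1, x2) \<le> C (0, x2)"
proof -
  have "0 < \<psi> ((norm x2)\<^sup>2)" by (rule psi_pos) simp
  then have "\<phi> ((norm x1)\<^sup>2 / \<psi> ((norm x2)\<^sup>2)) \<le> \<phi> 0" by (intro phi_antimono) auto
  then show ?thesis
    unfolding C_time unfolding C_eq phi_0 by (intro mult_left_le) auto
qed

lemma time_factor_le_1: "\<psi> ((norm x2)\<^sup>2) powr (- real DIM('a) / 2) \<le> 1"
  using powr_mono[of "- real DIM('a) / 2" 0 "\<psi> ((norm x2)\<^sup>2)"] psi_ge_1[of "(norm x2)\<^sup>2"] by simp

lemma C_le_1: "C x \<le> 1"
proof (cases x)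
  case (Pair x1 x2)
  show ?thesis using C_le_time[of x1 x2] time_factor_le_1[of x2] by (simp add: Pair C_time)
qed

text \<open>Dividing by \<open>\<psi> \<ge> 1\<close> only moves the argument of the decreasing
  function \<phi> towards 0, hence a lower bound uniform in \<open>x2\<close>.\<close>

lemma C_ge_time:
  assumes "norm x1 \<le> R"
  shows "\<phi> (R\<^sup>2) * C (0, x2) \<le> C (x1, x2)"
proof -
  have P: "1 \<le> \<psi> ((norm x2)\<^sup>2)" by (rule psi_ge_1) simp
  have "(norm x1)\<^sup>2 / \<psi> ((norm x2)\<^sup>2) \<le> (norm x1)\<^sup>2 / 1"
    using P by (intro divide_left_mono) auto
  also have "\<dots> \<le> R\<^sup>2" using assms by (simp add: power_mono)
  finally have "\<phi> (R\<^sup>2) \<le> \<phi> ((norm x1)\<^sup>2 / \<psi> ((norm x2)\<^sup>2))"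
    using P by (intro phi_antimono) auto
  then show ?thesis
    unfolding C_time unfolding C_eq by (simp add: mult.commute[of "\<phi> (R\<^sup>2)"] mult_left_mono)
qed

text \<open>The prefactor is at most 1, and \<psi> is at most \<open>\<psi> (R\<^sup>2)\<close> on
  the ball. The division inside \<phi> is kept as a dilation of \<open>x1\<close>, since in general
  no constant can replace it.\<close>

lemma C_le_space:
  assumes "norm x2 \<le> R"
  shows "C (x1, x2) \<le> C ((1 / sqrt (\<psi> (R\<^sup>2))) *\<^sub>R x1, 0)"
proof -
  define P where "P = \<psi> ((norm x2)\<^sup>2)"
  define L where "L = \<psi> (R\<^sup>2)"
  have P: "1 \<le> P" unfolding P_def by (rule psi_ge_1) simp
  have PL: "P \<le> L" unfolding P_def L_def using assms by (intro psi_mono power_mono) auto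
  have "(norm x1)\<^sup>2 / L \<le> (norm x1)\<^sup>2 / P"
    using P PL by (intro divide_left_mono) auto
  then have "\<phi> ((norm x1)\<^sup>2 / P) \<le> \<phi> ((norm x1)\<^sup>2 / L)"
    using P PL by (intro phi_antimono) auto
  moreover have "C (x1, x2) \<le> 1 * \<phi> ((norm x1)\<^sup>2 / P)"
    unfolding C_eq P_def[symmetric]
    using time_factor_le_1[of x2] P phi_pos[of "(norm x1)\<^sup>2 / P"] unfolding P_def[symmetric]
    by (intro mult_right_mono) (auto simp: less_imp_le)
  moreover have "(norm ((1 / sqrt L) *\<^sub>R x1))\<^sup>2 = (norm x1)\<^sup>2 / L"
    using P PL by (simp add: power_divide)
  ultimately show ?thesis
    unfolding C_space L_def[symmetric] by simp
qed

text \<open>Here no dilation appears: the division by \<open>\<psi> \<ge> 1\<close> increases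
  \<phi>, and only the prefactor has to be bounded from below.\<close>

lemma C_ge_space:
  assumes "norm x2 \<le> R"
  shows "\<psi> (R\<^sup>2) powr (- real DIM('a) / 2) * C (x1, 0) \<le> C (x1, x2)"
proof -
  define P where "P = \<psi> ((norm x2)\<^sup>2)"
  have P: "1 \<le> P" unfolding P_def by (rule psi_ge_1) simp
  have PL: "P \<le> \<psi> (R\<^sup>2)" unfolding P_def using assms by (intro psi_mono power_mono) auto
  have "\<psi> (R\<^sup>2) powr (- real DIM('a) / 2) \<le> P powr (- real DIM('a) / 2)"
    using P PL by (intro powr_mono2') auto
  moreover have "\<phi> ((norm x1)\<^sup>2) \<le> \<phi> ((norm x1)\<^sup>2 / P)"
    using P by (intro phi_antimono) (auto simp: divide_le_eq mult_le_cancel_left1)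
  moreover have "0 < \<phi> ((norm x1)\<^sup>2)" by (rule phi_pos) simp
  ultimately show ?thesis
    unfolding C_space unfolding C_eq P_def[symmetric] by (intro mult_mono) auto
qed

lemma C_space_antimono: "norm x \<le> norm y \<Longrightarrow> C (y, 0) \<le> C (x, 0)"
  unfolding C_space by (intro phi_antimono power_mono) auto

end

section \<open>From the marginal functional to the product domain\<close>

lemma scaleR_Times_compact_pos:
  fixes D1 :: "'a::euclidean_space set" and D2 :: "'b::euclidean_space set"
  assumes "0 < s" "0 < t" "compact D1" "0 < measure lborel D1" "compact D2" "0 < measure lborel D2"
  shows "compact (((*\<^sub>R) s ` D1) \<times> ((*\<^sub>R) t ` D2))" "0 < measure lborel (((*\<^sub>R) s ` D1) \<times> ((*\<^sub>R) t ` D2))"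
  using scaleR_compact_pos[OF assms(1,3,4)] scaleR_compact_pos[OF assms(2,5,6)]
  by (auto intro: compact_Times measure_lborel_Times_pos)

theorem theorem17:
  fixes M :: "'w measure"
    and B :: "'a::euclidean_space \<times> 'b::euclidean_space \<Rightarrow> 'w \<Rightarrow> real"
    and C :: "'a \<times> 'b \<Rightarrow> real"
    and \<phi> \<psi> :: "real \<Rightarrow> real"
    and D1 :: "'a set" and D2 :: "'b set"
    and q :: nat
  defines "Y \<equiv> \<lambda>t1 t2. hermite_functional B q (((*\<^sub>R) t1 ` D1) \<times> ((*\<^sub>R) t2 ` D2))"
    and "Y1 \<equiv> \<lambda>t1. hermite_functional (\<lambda>x1. B (x1, 0)) q ((*\<^sub>R) t1 ` D1)"
    and "Y2 \<equiv> \<lambda>t2. hermite_functional (\<lambda>x2. B (0, x2)) q ((*\<^sub>R) t2 ` D2)"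
  assumes "prob_space M"
    and "gaussian_field M B"
    and "\<And>\<omega>. \<omega> \<in> space M \<Longrightarrow> continuous_on UNIV (\<lambda>x. B x \<omega>)"
    and "\<And>x. (\<integral>\<omega>. B x \<omega> \<partial>M) = 0"
    and "\<And>x. variance_of M (B x) = 1"
    and "stationary_field M B"
    and "\<And>x y. covariance_of M (B x) (B y) = C (x - y)"
    and "gneiting_covariance \<phi> \<psi> C"
    and "compact D1" and "measure lborel D1 > 0"
    and "compact D2" and "measure lborel D2 > 0"
    and "q \<ge> 1"
  shows "(converges_in_distribution M (\<lambda>t1. standardize M (Y1 t1)) std_normal_distribution \<longrightarrow>
            (\<forall>t2>0. converges_in_distribution M (\<lambda>t1. standardize M (Y t1 t2)) std_normal_distribution))
       \<and> (converges_in_distribution M (\<lambda>t2. standardize M (Y2 t2)) std_normal_distribution \<longrightarrow>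
            (\<forall>t1>0. converges_in_distribution M (\<lambda>t2. standardize M (Y t1 t2)) std_normal_distribution))"
proof -
  let ?D1 = "\<lambda>t. (*\<^sub>R) t ` D1" and ?D2 = "\<lambda>t. (*\<^sub>R) t ` D2"
  interpret prob_space M by fact
  interpret gneiting \<phi> \<psi> C by unfold_locales fact
  have q: "0 < q" using assms(16) by simp
  have F: "continuous_gaussian_field M B C q"
    using assms(5-7,10) C_pos C_le_1 C_0 q by unfold_locales auto
  have cov: "covariance_of M (B x) (B y) = C (x - y)" for x y by fact
  have inj: "inj (\<lambda>x :: 'a. (x, 0 :: 'b))" "inj (\<lambda>x :: 'b. (0 :: 'a, x))" by (auto simp: inj_def)
  \<comment> \<open>The marginal fields are of the same kind, with slices of \<open>C\<close> as
    covariances, so the criterion by defects applies to them as well.\<close>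
  have F1: "continuous_gaussian_field M (\<lambda>x1. B (x1, 0)) (\<lambda>x1. C (x1, 0)) q"
  proof
    show "gaussian_field M (\<lambda>x1. B (x1, 0))" using assms(5) inj(1) by (rule gaussian_field_reindex)
    show "continuous_on UNIV (\<lambda>x1. B (x1, 0) \<omega>)" if "\<omega> \<in> space M" for \<omega>
      by (rule continuous_on_compose2[OF assms(6)[OF that]]) (auto intro!: continuous_intros)
    show "C (0, 0) = 1" using C_0 by (simp add: zero_prod_def)
  qed (use assms(7) C_pos C_le_1 q in \<open>simp_all add: cov\<close>)
  have F2: "continuous_gaussian_field M (\<lambda>x2. B (0, x2)) (\<lambda>x2. C (0, x2)) q"
  proof
    show "gaussian_field M (\<lambda>x2. B (0, x2))" using assms(5) inj(2) by (rule gaussian_field_reindex)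
    show "continuous_on UNIV (\<lambda>x2. B (0, x2) \<omega>)" if "\<omega> \<in> space M" for \<omega>
      by (rule continuous_on_compose2[OF assms(6)[OF that]]) (auto intro!: continuous_intros)
    show "C (0, 0) = 1" using C_0 by (simp add: zero_prod_def)
  qed (use assms(7) C_pos C_le_1 q in \<open>simp_all add: cov\<close>)
  interpret F: continuous_gaussian_field M B C q by fact
  interpret F1: continuous_gaussian_field M "\<lambda>x1. B (x1, 0)" "\<lambda>x1. C (x1, 0)" q by fact
  interpret F2: continuous_gaussian_field M "\<lambda>x2. B (0, x2)" "\<lambda>x2. C (0, x2)" q by fact
  note D1 = assms(12,13) and D2 = assms(14,15)
  have S: "compact (?D1 s \<times> ?D2 t)" "0 < measure lborel (?D1 s \<times> ?D2 t)"
    if "0 < s" "0 < t" for s t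
    using scaleR_Times_compact_pos[OF that D1 D2] by auto
  have scaled: "compact (?D1 t)" "0 < measure lborel (?D1 t)"
    "compact (?D2 t)" "0 < measure lborel (?D2 t)" if "0 < t" for t
    using scaleR_compact_pos[OF that D1] scaleR_compact_pos[OF that D2] by auto
  show ?thesis
    unfolding Y_def Y1_def Y2_def
  proof (intro conjI impI allI)
    fix t2 :: real assume t2: "0 < t2"
    assume "converges_in_distribution M
      (\<lambda>t1. standardize M (hermite_functional (\<lambda>x1. B (x1, 0)) q (?D1 t1))) std_normal_distribution"
    then have lim: "((\<lambda>t1. F1.defect m (?D1 t1)) \<longlongrightarrow> 0) at_top" for m
      using F1.converges_iff_defect[of "\<lambda>t. ?D1 t"] scaled by simp
    obtain R where R: "0 \<le> R" "\<And>u v. u \<in> ?D2 t2 \<Longrightarrow> v \<in> ?D2 t2 \<Longrightarrow> norm (u - v) \<le> R"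
      using compact_diff_bounded[OF scaled(3)[OF t2]] by blast
    txt \<open>Over \<open>t\<^sub>2 D\<^sub>2\<close> the function \<open>\<psi>\<close> varies between \<open>1\<close> and \<open>L\<close>, so that \<open>C\<close> is dominated by the marginal
      covariance at the scale \<open>sqrt L\<close>; doubling shows that this rescaling does not change the order of
      the variance.\<close>
    define L where "L = \<psi> (R\<^sup>2)"
    define l where "l = sqrt L"
    have L: "1 \<le> L" "1 \<le> l" unfolding l_def L_def using psi_ge_1[of "R\<^sup>2"] by auto
    define c0 where "c0 = L powr (- real DIM('a) / 2)"
    have c0: "0 < c0" using L by (simp add: c0_def)
    obtain c1 where c1: "0 < c1" "\<And>t. 0 < t \<Longrightarrow>
        c1 * positive_kernel.energy (uniform_on ((\<lambda>x. (t / l) *\<^sub>R x) ` D1)) (\<lambda>x y. C (x - y, 0)) q \<le>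
        positive_kernel.energy (uniform_on ((\<lambda>x. t *\<^sub>R x) ` D1)) (\<lambda>x y. C (x - y, 0)) q"
      using F1.energy_doubling[OF D1 C_space_antimono L(2)] by blast
    have "((\<lambda>t1. F.defect m (?D1 t1 \<times> ?D2 t2)) \<longlongrightarrow> 0) at_top" for m
    proof (rule tendsto_defect_comparison[OF F F1 S[OF _ t2]])
      \<comment> \<open>The marginal defect will be used at \<open>t1 / l\<close>, which tends to
        infinity together with \<open>t1\<close>.\<close>
      have "filterlim (\<lambda>t. t * (1 / l)) at_top at_top"
        using L by (intro filterlim_tendsto_pos_mult_at_top[OF tendsto_const] filterlim_ident
            filterlim_at_top_mult_tendsto_pos[OF tendsto_const]) auto
      then have "filterlim (\<lambda>t. t / l) at_top at_top" by simp
      then show "((\<lambda>t1. F1.defect m (?D1 (t1 / l))) \<longlongrightarrow> 0) at_top"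
        by (rule filterlim_compose[OF lim])
      fix t1 :: real assume t1: "0 < t1"
      have tl: "0 < t1 / l" using t1 L by simp
      let ?S = "?D1 t1 \<times> ?D2 t2"
      \<comment> \<open>Projection to space followed by the dilation of \<open>C_le_space\<close>:
        it carries the uniform measure of the product to that of the shrunk marginal domain.\<close>
      let ?h = "\<lambda>x :: 'a \<times> 'b. (1 / l) *\<^sub>R fst x"
      note unif = distr_uniform_on_Times[OF scaled(1,2)[OF t1] scaled(3,4)[OF t2]]
      have fst: "fst \<in> measurable (uniform_on ?S) (uniform_on (?D1 t1))"
        by (simp only: measurable_cong_sets[OF sets_uniform_on sets_uniform_on])
          (intro borel_measurable_continuous_onI continuous_intros)
      have img: "(*\<^sub>R) (1 / l) ` ?D1 t1 = ?D1 (t1 / l)"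
        by (simp add: image_image)
      have h: "distr (uniform_on ?S) (uniform_on (?D1 (t1 / l))) ?h = uniform_on (?D1 (t1 / l))"
      proof -
        have sc: "(*\<^sub>R) (1 / l) \<in> measurable (uniform_on (?D1 t1)) (uniform_on (?D1 (t1 / l)))"
          by (simp only: measurable_cong_sets[OF sets_uniform_on sets_uniform_on]) measurable
        have "distr (uniform_on (?D1 t1)) (uniform_on (?D1 (t1 / l))) ((*\<^sub>R) (1 / l)) =
            uniform_on (?D1 (t1 / l))"
          using distr_uniform_on_scaleR[OF _ scaled(1,2)[OF t1], of "1 / l"] L unfolding img by simp
        then show ?thesis
          using distr_distr[OF sc fst] unfolding unif(1) by (simp add: comp_def)
      qed
      \<comment> \<open>The lower covariance bound, with constant \<open>c0 ^ q\<close>, leads to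
        the marginal energy at the original size \<open>t1\<close>; doubling, with constant
        \<open>c1\<close>, leads from there to \<open>t1 / l\<close>.\<close>
      have energy: "c0 ^ q * c1 * positive_kernel.energy (uniform_on (?D1 (t1 / l))) (\<lambda>x y. C (x - y, 0)) q
          \<le> positive_kernel.energy (uniform_on ?S) (\<lambda>x y. C (x - y)) q"
      proof -
        have "c0 ^ q * (c1 * positive_kernel.energy (uniform_on (?D1 (t1 / l))) (\<lambda>x y. C (x - y, 0)) q) \<le>
            c0 ^ q * positive_kernel.energy (uniform_on (?D1 t1)) (\<lambda>x y. C (x - y, 0)) q"
          using c0 c1(2)[OF t1] by (intro mult_left_mono) auto
        also have "\<dots> \<le> positive_kernel.energy (uniform_on ?S) (\<lambda>x y. C (x - y)) q"
        proof (rule energy_lower_bound[OF F.positive_kernel[OF S[OF t1 t2]] F1.positive_kernel[OF scaled(1,2)[OF t1]]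
              fst unif(1) AE_uniform_on[OF S[OF t1 t2]]])
          fix u v assume "u \<in> ?S" "v \<in> ?S"
          then have "norm (snd u - snd v) \<le> R" by (intro R(2)) auto
          from C_ge_space[OF this, of "fst u - fst v"]
          show "c0 * C (fst u - fst v, 0) \<le> C (u - v)"
            unfolding c0_def L_def by (cases u; cases v) simp
        qed (use c0 in simp)
        finally show ?thesis by (simp add: mult.assoc)
      qed
      show "F.defect m ?S \<le> 1 / sqrt (c0 ^ q * c1) ^ m * F1.defect m (?D1 (t1 / l))"
      proof (rule defect_comparison[OF F F1 S[OF t1 t2] scaled(1,2)[OF tl] _ h _ _ energy])
        show "?h \<in> borel_measurable borel"
          by (intro borel_measurable_continuous_onI continuous_intros)
        show "0 < c0 ^ q * c1" using c0 c1 by simp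
        fix u v assume "u \<in> ?S" "v \<in> ?S"
        then have "norm (snd u - snd v) \<le> R" by (intro R(2)) auto
        from C_le_space[OF this, of "fst u - fst v"]
        show "C (u - v) \<le> C (?h u - ?h v, 0)"
          unfolding L_def[symmetric] l_def[symmetric] by (cases u; cases v) (simp add: scaleR_diff_right)
      qed
    qed
    then show "converges_in_distribution M
      (\<lambda>t1. standardize M (hermite_functional B q (?D1 t1 \<times> ?D2 t2))) std_normal_distribution"
      using F.converges_iff_defect[of "\<lambda>t1. ?D1 t1 \<times> ?D2 t2"] S[OF _ t2] by simp
  next
    fix t1 :: real assume t1: "0 < t1"
    assume "converges_in_distribution M
      (\<lambda>t2. standardize M (hermite_functional (\<lambda>x2. B (0, x2)) q (?D2 t2))) std_normal_distribution"
    then have lim: "((\<lambda>t2. F2.defect m (?D2 t2)) \<longlongrightarrow> 0) at_top" for m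
      using F2.converges_iff_defect[of "\<lambda>t. ?D2 t"] scaled by simp
    obtain R where R: "0 \<le> R" "\<And>u v. u \<in> ?D1 t1 \<Longrightarrow> v \<in> ?D1 t1 \<Longrightarrow> norm (u - v) \<le> R"
      using compact_diff_bounded[OF scaled(1)[OF t1]] by blast
    \<comment> \<open>In this direction the upper and lower bounds involve the same function
      \<open>C (0, x2)\<close>, so the projection alone serves for both and no doubling is
      required.\<close>
    define c where "c = \<phi> (R\<^sup>2)"
    have c: "0 < c" unfolding c_def by (rule phi_pos) simp
    have "((\<lambda>t2. F.defect m (?D1 t1 \<times> ?D2 t2)) \<longlongrightarrow> 0) at_top" for m
    proof (rule tendsto_defect_comparison[OF F F2 S[OF t1] _ lim])
      fix t2 :: real assume t2: "0 < t2"
      let ?S = "?D1 t1 \<times> ?D2 t2"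
      note unif = distr_uniform_on_Times[OF scaled(1,2)[OF t1] scaled(3,4)[OF t2]]
      have snd: "snd \<in> measurable (uniform_on ?S) (uniform_on (?D2 t2))"
        by (simp only: measurable_cong_sets[OF sets_uniform_on sets_uniform_on])
          (intro borel_measurable_continuous_onI continuous_intros)
      have energy: "c ^ q * positive_kernel.energy (uniform_on (?D2 t2)) (\<lambda>x y. C (0, x - y)) q
          \<le> positive_kernel.energy (uniform_on ?S) (\<lambda>x y. C (x - y)) q"
      proof (rule energy_lower_bound[OF F.positive_kernel[OF S[OF t1 t2]] F2.positive_kernel[OF scaled(3,4)[OF t2]]
            snd unif(2) AE_uniform_on[OF S[OF t1 t2]]])
        fix u v assume "u \<in> ?S" "v \<in> ?S"
        then have "norm (fst u - fst v) \<le> R" by (intro R(2)) auto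
        from C_ge_time[OF this, of "snd u - snd v"]
        show "c * C (0, snd u - snd v) \<le> C (u - v)"
          unfolding c_def by (cases u; cases v) simp
      qed (use c in simp)
      show "F.defect m ?S \<le> 1 / sqrt (c ^ q) ^ m * F2.defect m (?D2 t2)"
      proof (rule defect_comparison[OF F F2 S[OF t1 t2] scaled(3,4)[OF t2] _ unif(2) _ _ energy])
        show "snd \<in> borel_measurable borel"
          by (intro borel_measurable_continuous_onI continuous_intros)
        show "0 < c ^ q" using c by simp
        show "C (u - v) \<le> C (0, snd u - snd v)" for u v
          using C_le_time[of "fst u - fst v" "snd u - snd v"] by (cases u; cases v) simp
      qed
    qed
    then show "converges_in_distribution M
      (\<lambda>t2. standardize M (hermite_functional B q (?D1 t1 \<times> ?D2 t2))) std_normal_distribution"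
      using F.converges_iff_defect[of "\<lambda>t2. ?D1 t1 \<times> ?D2 t2"] S[OF t1] by simp
  qed
qed

end
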